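(* Let $d\in\mathbb{N}$. Let $(U_n)_{n\in\mathbb{Z}_+}$ and $(B_n)_{n\in\mathbb{Z}_+}$ be $\mathbb{R}^d$-valued and $\mathbb{R}^{d\times d}$-valued stochastic processes, respectively, defined on a probability space $(\Omega,\mathcal{F},\mathbb{P})$ and adapted to a filtration $(\mathcal{F}_n)_{n\in\mathbb{Z}_+}$. Suppose that $B_n$ is invertible for all sufficiently large $n\in\mathbb{N}$. Let $(Q_n)_{n\in\mathbb{N}}$ be a (deterministic) sequence in $\mathbb{R}^{d\times d}$ such that $Q_n\to 0$ as $n\to\infty$ and $Q_n$ is invertible for all sufficiently large $n\in\mathbb{N}$. Let $G\in\mathcal{F}_\infty:=\sigma(\bigcup_{k=0}^\infty\mathcal{F}_k)$ with $\mathbb{P}(G)>0$. Let $\mu$ be the distribution of a $d$-dimensional symmetric $\alpha$-stable random variable $\zeta$ with characteristic exponent $\alpha\in(0,2)$ and spectral measure $\Pi$. Assume that: (i) there exists an $\mathbb{R}^{d\times d}$-valued, $\mathcal{F}_\infty$-measurable random matrix $\eta$ such that $\mathbb{P}(G\cap\{\exists\,\eta^{-1}\})>0$ and $Q_nB_n^{-1}\to\eta$ in $\mathbb{P}_G$-probability as $n\to\infty$; (ii) $\lim_{K\to\infty}\sup_{n\in\mathbb{N}}\mathbb{P}_{G\cap\{\exists\,\eta^{-1}\}}(\|Q_nU_n\|>K)=0$; (iii) there exists an invertible matrix $P\in\mathbb{R}^{d\times d}$ with $\varrho(P)<1$ such that for each $r\in\mathbb{N}$, $B_nB_{n-r}^{-1}\to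 P^r$ in $\mathbb{P}_G$-probability as $n\to\infty$; (iv) for all $\theta\in\mathbb{R}^d$, $$\mathbb{E}_{\mathbb{P}}\bigl(e^{i\langle\theta,B_n\Delta U_n\rangle}\mid\mathcal{F}_{n-1}\bigr)\to\int_{\mathbb{R}^d}e^{i\langle\theta,x\rangle}\,\mu(dx)\quad\text{in }\mathbb{P}_{G\cap\{\exists\,\eta^{-1}\}}\text{-probability as }n\to\infty.$$ Then $$B_nU_n\to Z\quad\mathcal{F}_\infty\text{-mixing under }\mathbb{P}_{G\cap\{\exists\,\eta^{-1}\}}\text{ as }n\to\infty,$$ and $$Q_nU_n\to\eta Z\quad\mathcal{F}_\infty\text{-stably under }\mathbb{P}_{G\cap\{\exists\,\eta^{-1}\}}\text{ as }n\to\infty,$$ where $Z$ denotes a $d$-dimensional random vector $\mathbb{P}$-independent of $\mathcal{F}_\infty$ with characteristic function $$\mathbb{E}_{\mathbb{P}}(e^{i\langle\theta,Z\rangle})=\exp\Bigl\{-\int_{S_{d-1}}\sum_{j=0}^\infty\bigl|\langle(P^j)^\top\theta,x\rangle\bigr|^\alpha\,\Pi(dx)\Bigr\},\qquad\theta\in\mathbb{R}^d.$$ In particular, if $\zeta$ has a $d$-dimensional Cauchy distribution with parameter $(0,I_d)$, then $Z$ has characteristic function $$\mathbb{E}_{\mathbb{P}}(e^{i\langle\theta,Z\rangle})=\exp\Bigl\{-\sum_{j=0}^\infty\|(P^j)^\top\theta\|\Bigr\},\qquad\theta\in\mathbb{R}^d.$$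
   Context: $\mathbb{Z}_+$ is the set of non-negative integers, $\mathbb{N}$ the set of positive integers. $\|\cdot\|$ and $\langle\cdot,\cdot\rangle$ are the Euclidean norm and inner product on $\mathbb{R}^d$; $\varrho(P)$ is the spectral radius of $P$; $I_d$ is the $d\times d$ identity matrix. $\Delta U_0:=0$ and $\Delta U_n:=U_n-U_{n-1}$ for $n\in\mathbb{N}$. $\{\exists\,\eta^{-1}\}$ is the event that $\eta$ is invertible. For an event $A$ with $\mathbb{P}(A)>0$, $\mathbb{P}_A(\cdot):=\mathbb{P}(\cdot\cap A)/\mathbb{P}(A)$. Every random variable is defined on a (suitable) probability space $(\Omega,\mathcal{F},\mathbb{P})$; in particular this space is assumed to be rich enough to carry an i.i.d. sequence of random vectors with distribution $\mu$ independent of $\mathcal{F}_\infty$, and the vector $Z$. Stable distributions: a $d$-dimensional random variable $\zeta$ is stable if for any $a_1,a_2>0$ there exist $b>0$ and $c\in\mathbb{R}^d$ such that $a_1\zeta^{(1)}+a_2\zeta^{(2)}$ and $b\zeta+c$ are equal in distribution, where $\zeta^{(1)},\zeta^{(2)}$ are independent copies of $\zeta$. This holds if and only if there is $\alpha\in(0,2]$ (the index of stability, or characteristic exponent) such that for each integer $n\ge2$ there is $c_n\in\mathbb{R}^d$ with $\zeta^{(1)}+\dots+\zeta^{(n)}$ equal in distribution to $n^{1/\alpha}\zeta+c_n$, for independent copies $\zeta^{(1)},\dots,\zeta^{(n)}$ of $\zeta$. It is symmetric stable if in addition $\zeta$ and $-\zeta$ have the same distribution. Let $S_{d-1}:=\{x\in\mathbb{R}^d:\|x\|=1\}$.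 It is known that $\zeta$ is symmetric $\alpha$-stable with $\alpha\in(0,2)$ if and only if there is a unique symmetric finite measure $\Pi$ on $(S_{d-1},\mathcal{B}(S_{d-1}))$ (symmetric: $\Pi(A)=\Pi(-A)$ for all $A\in\mathcal{B}(S_{d-1})$), called the spectral measure of $\zeta$, with $\mathbb{E}_{\mathbb{P}}(e^{i\langle\theta,\zeta\rangle})=\exp\{-\int_{S_{d-1}}|\langle\theta,x\rangle|^\alpha\,\Pi(dx)\}$ for all $\theta\in\mathbb{R}^d$. $\zeta$ has a $d$-dimensional Cauchy distribution with parameter $(0,I_d)$ if it has density $f_\zeta(x)=\Gamma(\frac{1+d}{2})\pi^{-\frac{1+d}{2}}(1+\|x\|^2)^{-\frac{1+d}{2}}$, $x\in\mathbb{R}^d$; it is known that then $\mathbb{E}_{\mathbb{P}}(e^{i\langle\theta,\zeta\rangle})=e^{-\|\theta\|}$ for all $\theta\in\mathbb{R}^d$ and $\zeta$ is symmetric $1$-stable. Stable and mixing convergence: let $\mathbb{Q}$ be a probability measure on $(\Omega,\mathcal{F})$, $\mathcal{G}\subset\mathcal{F}$ a sub-$\sigma$-field, and $X_n$ ($n\in\mathbb{N}$), $X$ be $\mathbb{R}^d$-valued random variables on $(\Omega,\mathcal{F})$. $X_n\to X$ $\mathcal{G}$-stably under $\mathbb{Q}$ as $n\to\infty$ if $\lim_{n\to\infty}\mathbb{E}_{\mathbb{Q}}(\xi\,\mathbb{E}_{\mathbb{Q}}(h(X_n)\mid\mathcal{G}))=\mathbb{E}_{\mathbb{Q}}(\xi\,\mathbb{E}_{\mathbb{Q}}(h(X)\mid\mathcal{G}))$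 for all random variables $\xi:\Omega\to\mathbb{R}$ with $\mathbb{E}_{\mathbb{Q}}(|\xi|)<\infty$ and all bounded continuous $h:\mathbb{R}^d\to\mathbb{R}$ (equivalently, $\lim_n\mathbb{E}_{\mathbb{Q}}(\xi h(X_n))=\mathbb{E}_{\mathbb{Q}}(\xi h(X))$ for all $\mathcal{G}$-measurable $\mathbb{Q}$-integrable real $\xi$ and all bounded continuous $h$). $X_n\to X$ $\mathcal{G}$-mixing under $\mathbb{Q}$ if $X_n\to X$ $\mathcal{G}$-stably under $\mathbb{Q}$ and $\sigma(X)$ and $\mathcal{G}$ are independent under $\mathbb{Q}$. *)

theory Defs
  imports "HOL-Probability.Probability"
begin

section \<open>Matrices\<close>

text \<open>On \<open>real^'n^'n\<close> the type-class operations \<open>*\<close> and \<open>^\<close> act entrywise, so powers with respect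
  to the matrix product \<open>**\<close> have to be introduced separately.\<close>

primrec matpow :: "real^'n^'n \<Rightarrow> nat \<Rightarrow> real^'n^'n" where
  "matpow A 0 = mat 1"
| "matpow A (Suc k) = A ** matpow A k"

definition spectral_radius :: "real^'n^'n \<Rightarrow> real" where
  "spectral_radius A = Max {cmod l | l.
     \<exists>v :: complex^'n. v \<noteq> 0 \<and> (\<chi> i j. complex_of_real (A $ i $ j)) *v v = l *s v}"


section \<open>Processes and modes of convergence\<close>

text \<open>Under the probability measure \<open>M\<close> and for an event \<open>A\<close> of positive probability, the measure
  \<open>P\<^sub>A = P(\<cdot> \<inter> A) / P(A)\<close> is the library's \<open>uniform_measure M A\<close>.\<close>

definition Delta :: "(nat \<Rightarrow> 'a \<Rightarrow> real^'n) \<Rightarrow> nat \<Rightarrow> 'a \<Rightarrow> real^'n" where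
  "Delta U n \<omega> = (if n = 0 then 0 else U n \<omega> - U (n - 1) \<omega>)"

definition limit_algebra :: "'a set \<Rightarrow> (nat \<Rightarrow> 'a measure) \<Rightarrow> 'a measure" where
  "limit_algebra \<Omega> F = sigma \<Omega> (\<Union>k. sets (F k))"

definition tendsto_in_prob ::
    "'a measure \<Rightarrow> (nat \<Rightarrow> 'a \<Rightarrow> 'b::metric_space) \<Rightarrow> ('a \<Rightarrow> 'b) \<Rightarrow> bool" where
  "tendsto_in_prob Q X Y \<longleftrightarrow>
     (\<forall>\<epsilon>>0. (\<lambda>n. measure Q {\<omega> \<in> space Q. dist (X n \<omega>) (Y \<omega>) > \<epsilon>}) \<longlonglongrightarrow> 0)"

definition complex_cond_exp ::
    "'a measure \<Rightarrow> 'a measure \<Rightarrow> ('a \<Rightarrow> complex) \<Rightarrow> 'a \<Rightarrow> complex" where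
  "complex_cond_exp M G X \<omega> =
     Complex (real_cond_exp M G (\<lambda>\<omega>. Re (X \<omega>)) \<omega>) (real_cond_exp M G (\<lambda>\<omega>. Im (X \<omega>)) \<omega>)"

text \<open>Independence, under \<open>Q\<close>, of the sigma-fields \<open>\<sigma>(X)\<close> and \<open>G\<close>, where \<open>X\<close> takes values in \<open>N\<close>.\<close>

definition indep_of :: "'a measure \<Rightarrow> 'b measure \<Rightarrow> ('a \<Rightarrow> 'b) \<Rightarrow> 'a measure \<Rightarrow> bool" where
  "indep_of Q N X G \<longleftrightarrow>
     prob_space.indep_set Q (sets (vimage_algebra (space Q) X N)) (sets G)"

definition stably_converges ::
    "'a measure \<Rightarrow> 'a measure \<Rightarrow> (nat \<Rightarrow> 'a \<Rightarrow> real^'n) \<Rightarrow> ('a \<Rightarrow> real^'n) \<Rightarrow> bool" where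
  "stably_converges Q G X Y \<longleftrightarrow>
     (\<forall>\<xi> :: 'a \<Rightarrow> real. \<forall>h :: real^'n \<Rightarrow> real.
        integrable Q \<xi> \<longrightarrow> continuous_on UNIV h \<longrightarrow> bounded (range h) \<longrightarrow>
        (\<lambda>n. \<integral>\<omega>. \<xi> \<omega> * real_cond_exp Q G (\<lambda>\<omega>. h (X n \<omega>)) \<omega> \<partial>Q)
          \<longlonglongrightarrow> (\<integral>\<omega>. \<xi> \<omega> * real_cond_exp Q G (\<lambda>\<omega>. h (Y \<omega>)) \<omega> \<partial>Q))"

definition mixing_converges ::
    "'a measure \<Rightarrow> 'a measure \<Rightarrow> (nat \<Rightarrow> 'a \<Rightarrow> real^'n) \<Rightarrow> ('a \<Rightarrow> real^'n) \<Rightarrow> bool" where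
  "mixing_converges Q G X Y \<longleftrightarrow> stably_converges Q G X Y \<and> indep_of Q borel Y G"


section \<open>Stable laws\<close>

definition char_vec :: "(real^'n) measure \<Rightarrow> real^'n \<Rightarrow> complex" where
  "char_vec \<nu> \<theta> = (CLINT x|\<nu>. iexp (\<theta> \<bullet> x))"

text \<open>The following notions concern the law \<open>\<nu>\<close> of a random vector \<open>\<zeta>\<close>; independent copies of \<open>\<zeta>\<close> are
  the coordinates of a product space.\<close>

definition stable_law :: "(real^'n) measure \<Rightarrow> bool" where
  "stable_law \<nu> \<longleftrightarrow>
     (\<forall>a\<^sub>1>0. \<forall>a\<^sub>2>0. \<exists>b>0. \<exists>c.
        distr (\<nu> \<Otimes>\<^sub>M \<nu>) borel (\<lambda>(x, y). a\<^sub>1 *\<^sub>R x + a\<^sub>2 *\<^sub>R y) = distr \<nu> borel (\<lambda>x. b *\<^sub>R x + c))"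

definition stability_index :: "real \<Rightarrow> (real^'n) measure \<Rightarrow> bool" where
  "stability_index \<alpha> \<nu> \<longleftrightarrow>
     0 < \<alpha> \<and> \<alpha> \<le> 2 \<and>
     (\<forall>n\<ge>2. \<exists>c.
        distr (Pi\<^sub>M {..<n} (\<lambda>_. \<nu>)) borel (\<lambda>x. \<Sum>i<n. x i)
          = distr \<nu> borel (\<lambda>x. (real n powr (1 / \<alpha>)) *\<^sub>R x + c))"

definition symmetric_stable :: "real \<Rightarrow> (real^'n) measure \<Rightarrow> bool" where
  "symmetric_stable \<alpha> \<nu> \<longleftrightarrow>
     stable_law \<nu> \<and> stability_index \<alpha> \<nu> \<and> distr \<nu> borel uminus = \<nu>"

text \<open>\<open>\<Lambda>\<close> is the spectral measure, usually denoted by a capital pi, which is a binder in HOL.\<close>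

definition spectral_measure :: "real \<Rightarrow> (real^'n) measure \<Rightarrow> (real^'n) measure \<Rightarrow> bool" where
  "spectral_measure \<alpha> \<nu> \<Lambda> \<longleftrightarrow>
     sets \<Lambda> = sets (restrict_space borel (sphere 0 1)) \<and>
     finite_measure \<Lambda> \<and>
     (\<forall>A \<in> sets \<Lambda>. measure \<Lambda> (uminus ` A) = measure \<Lambda> A) \<and>
     (\<forall>\<theta>. char_vec \<nu> \<theta> = complex_of_real (exp (- (\<integral>x. \<bar>\<theta> \<bullet> x\<bar> powr \<alpha> \<partial>\<Lambda>))))"

definition cauchy_law :: "(real^'n) measure" where
  "cauchy_law = density lborel (\<lambda>x. ennreal
     (Gamma ((1 + real CARD('n)) / 2) * pi powr (- ((1 + real CARD('n)) / 2))
        * (1 + (norm x)\<^sup>2) powr (- ((1 + real CARD('n)) / 2))))"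


section \<open>The limit vector\<close>

definition indep_vector_with_char ::
    "'a measure \<Rightarrow> 'a measure \<Rightarrow> (real^'n \<Rightarrow> complex) \<Rightarrow> ('a \<Rightarrow> real^'n) \<Rightarrow> bool" where
  "indep_vector_with_char M G \<phi> Z \<longleftrightarrow>
     Z \<in> borel_measurable M \<and> indep_of M borel Z G \<and>
     (\<forall>\<theta>. char_vec (distr M borel Z) \<theta> = \<phi> \<theta>)"

definition limit_char :: "real \<Rightarrow> (real^'n) measure \<Rightarrow> real^'n^'n \<Rightarrow> real^'n \<Rightarrow> complex" where
  "limit_char \<alpha> \<Lambda> P \<theta> = complex_of_real (exp (-
     (\<integral>x. (\<Sum>j. \<bar>(transpose (matpow P j) *v \<theta>) \<bullet> x\<bar> powr \<alpha>) \<partial>\<Lambda>)))"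

text \<open>The standing assumption that the probability space carries an i.i.d. sequence with law \<open>\<nu>\<close> which
  is, as a sequence, independent of \<open>G\<close>.\<close>

definition carries_iid_indep_of :: "'a measure \<Rightarrow> (real^'n) measure \<Rightarrow> 'a measure \<Rightarrow> bool" where
  "carries_iid_indep_of M \<nu> G \<longleftrightarrow>
     (\<exists>\<xi> :: nat \<Rightarrow> 'a \<Rightarrow> real^'n.
        prob_space.indep_vars M (\<lambda>_. borel) \<xi> UNIV \<and>
        (\<forall>j. distr M borel (\<xi> j) = \<nu>) \<and>
        indep_of M (Pi\<^sub>M UNIV (\<lambda>_. borel)) (\<lambda>\<omega> j. \<xi> j \<omega>) G)"

end

theory Submission
  imports Defs "HOL-Computational_Algebra.Fundamental_Theorem_Algebra" "HOL-Real_Asymp.Real_Asymp"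
begin

text \<open>Write \<open>V\<^sub>n = B\<^sub>n U\<^sub>n\<close> and \<open>Y\<^sub>n = B\<^sub>n \<Delta>U\<^sub>n\<close>. By (i) and (ii) the sequence \<open>V\<^sub>n\<close> is tight on the conditioning
  event, and then so is \<open>Y\<^sub>n = V\<^sub>n - (B\<^sub>n B\<^sub>n\<^sub>-\<^sub>1\<^sup>-\<^sup>1) V\<^sub>n\<^sub>-\<^sub>1\<close>. By (iii), up to a term vanishing in probability, \<open>V\<^sub>n\<close> is
  the sum of the \<open>P\<^sup>j Y\<^sub>n\<^sub>-\<^sub>j\<close> over \<open>j < r\<close> plus \<open>P\<^sup>r V\<^sub>n\<^sub>-\<^sub>r\<close>, and the last term is small for large \<open>r\<close>, uniformly in \<open>n\<close>,
  because the powers of \<open>P\<close> decay geometrically. Conditioning successively on the past, (iv) shows that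
  \<open>(Y\<^sub>n, \<dots>, Y\<^sub>n\<^sub>-\<^sub>r\<^sub>+\<^sub>1)\<close> behaves like \<open>r\<close> independent copies of \<open>\<zeta>\<close>, even against a bounded
  \<open>F\<^sub>\<infinity>\<close>-measurable weight, since such a weight is an \<open>L\<^sup>1\<close>-limit of \<open>F\<^sub>m\<close>-measurable ones. This gives the limit of
  \<open>E(f exp(i \<langle>\<theta>, V\<^sub>n\<rangle>))\<close>; the weights \<open>f exp(i \<langle>T, \<eta>\<rangle>)\<close> then yield the stable convergence of
  \<open>(Q\<^sub>n B\<^sub>n\<^sup>-\<^sup>1, V\<^sub>n)\<close> to \<open>(\<eta>, Z)\<close>, of which both claims are continuous images. The vector \<open>Z\<close> itself is a random series
  \<open>\<Sum>P\<^sup>j \<xi>\<^sub>j\<close>, almost surely convergent by Borel--Cantelli.\<close>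

section \<open>Matrices\<close>

text \<open>The conditional expectations in (iv) are taken under \<open>M\<close>, while all
  convergence is under the measure conditioned on \<open>G \<inter> E\<close>, an event known only
  at time infinity. Conditioning the measure first would change those expectations. Integrals are
  therefore kept under \<open>M\<close> and the density of the conditioned measure is absorbed into
  the weight, which is why the weights must be allowed to be merely \<open>Finf\<close>-measurable.

  The weights are signed or complex, so the weighted laws are not probability measures and the
  continuity theorem for characteristic functions does not apply to them. Bounded continuous
  functions are instead approximated by trigonometric polynomials that are close on a large ball and
  bounded everywhere; tightness handles the complement of the ball.

  A spectral radius below 1 does not force the norm of \<open>P\<close> below 1, so the decay of its
  powers is derived from a polynomial that annihilates \<open>P\<close>. For the random series,
  summable tail probabilities are needed; they are read off the characteristic function of
  \<zeta>.\<close>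

lemma norm_matrix_vector_mult_le:
  fixes A :: "real^'n^'m"
  shows "norm (A *v x) \<le> norm A * norm x"
proof -
  \<comment> \<open>The norm of a matrix is the Frobenius norm, so Cauchy-Schwarz is applied row by
    row.\<close>
  have "norm (A *v x) \<le> L2_set (\<lambda>i. norm (A $ i) * norm x) UNIV"
    unfolding norm_vec_def[of "A *v x"]
    by (rule L2_set_mono) (simp_all add: matrix_vector_mul_component Cauchy_Schwarz_ineq2)
  also have "\<dots> = norm A * norm x"
    by (simp add: norm_vec_def[of A] L2_set_left_distrib)
  finally show ?thesis .
qed

lemma bounded_bilinear_matrix_vector_mult:
  "bounded_bilinear ((*v) :: real^'n^'m \<Rightarrow> real^'n \<Rightarrow> real^'m)"
  by (standard, auto simp: matrix_vector_mult_add_rdistrib matrix_vector_right_distrib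
      scaleR_matrix_vector_assoc matrix_vector_mult_scaleR
      intro!: exI[of _ 1] norm_matrix_vector_mult_le)

lemma continuous_on_matrix_vector_mult [continuous_intros]:
  fixes f :: "_ \<Rightarrow> real^'n^'m"
  assumes "continuous_on S f" "continuous_on S g"
  shows "continuous_on S (\<lambda>x. f x *v g x)"
  using bounded_bilinear.continuous_on[OF bounded_bilinear_matrix_vector_mult assms] .

lemma borel_measurable_matrix_vector_mult [measurable (raw)]:
  fixes f :: "_ \<Rightarrow> real^'n^'m"
  assumes "f \<in> borel_measurable M" "g \<in> borel_measurable M"
  shows "(\<lambda>x. f x *v g x) \<in> borel_measurable M"
  by (rule borel_measurable_continuous_Pair[OF assms]) (intro continuous_intros)

text \<open>Entries may lie in any Euclidean space, so that the rule applies twice to a matrix: to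
  its rows, then to their entries.\<close>

lemma borel_measurable_vecI:
  fixes f :: "'a \<Rightarrow> ('b::euclidean_space)^'n"
  assumes "\<And>i. (\<lambda>x. f x $ i) \<in> borel_measurable M"
  shows "f \<in> borel_measurable M"
proof (subst borel_measurable_euclidean_space, intro ballI)
  fix b :: "'b^'n" assume "b \<in> Basis"
  then obtain i u where b: "b = axis i u" "u \<in> Basis" by (auto simp: Basis_vec_def)
  have "(\<lambda>x. f x \<bullet> b) = (\<lambda>x. f x $ i \<bullet> u)" by (simp add: b inner_axis)
  then show "(\<lambda>x. f x \<bullet> b) \<in> borel_measurable M" using assms[of i] by simp
qed

lemma borel_measurable_vec_nth [measurable (raw)]:
  fixes f :: "'a \<Rightarrow> ('b::euclidean_space)^'n"
  assumes "f \<in> borel_measurable M"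
  shows "(\<lambda>x. f x $ i) \<in> borel_measurable M"
  by (rule measurable_compose[OF assms]) (intro borel_measurable_continuous_onI continuous_intros)

lemma borel_measurable_matrix_mult [measurable (raw)]:
  fixes f :: "'a \<Rightarrow> real^'n^'m" and g :: "'a \<Rightarrow> real^'k^'n"
  assumes [measurable]: "f \<in> borel_measurable M" "g \<in> borel_measurable M"
  shows "(\<lambda>x. f x ** g x) \<in> borel_measurable M"
  by (intro borel_measurable_vecI) (simp add: matrix_matrix_mult_def)

lemma borel_measurable_det [measurable (raw)]:
  fixes f :: "'a \<Rightarrow> real^'n^'n"
  assumes [measurable]: "f \<in> borel_measurable M"
  shows "(\<lambda>x. det (f x)) \<in> borel_measurable M"
  unfolding det_def by measurable

lemma matrix_mult_inv_right:
  "invertible A \<Longrightarrow> A ** matrix_inv A = mat 1"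
  and matrix_mult_inv_left:
  "invertible A \<Longrightarrow> matrix_inv A ** A = mat 1"
  unfolding invertible_def matrix_inv_def by (metis (mono_tags, lifting) someI_ex)+

text \<open>Column \<open>l\<close> of the inverse solves \<open>A *v x = axis l 1\<close>, and
  Cramer's rule gives the solution. A quotient of determinants makes the measurability of the
  inverse evident.\<close>

lemma matrix_inv_eq_cramer:
  fixes A :: "real^'n^'n"
  assumes "det A \<noteq> 0"
  shows "matrix_inv A $ k $ l = det (\<chi> i j. if j = k then axis l 1 $ i else A $ i $ j) / det A"
proof -
  have "A *v (matrix_inv A *v axis l 1) = axis l 1"
    using assms by (simp add: matrix_vector_mul_assoc matrix_mult_inv_right invertible_det_nz)
  then have "matrix_inv A *v axis l 1
      = (\<chi> k. det (\<chi> i j. if j = k then axis l 1 $ i else A $ i $ j) / det A)"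
    using cramer[OF assms] by blast
  then have "(matrix_inv A *v axis l 1) $ k
      = det (\<chi> i j. if j = k then axis l 1 $ i else A $ i $ j) / det A"
    by simp
  then show ?thesis by (simp add: matrix_vector_mult_basis column_def)
qed

text \<open>On singular matrices \<^const>\<open>matrix_inv\<close> is an unspecified, but constant, value.\<close>

lemma borel_measurable_matrix_inv [measurable (raw)]:
  fixes f :: "'a \<Rightarrow> real^'n^'n"
  assumes [measurable]: "f \<in> borel_measurable M"
  shows "(\<lambda>x. matrix_inv (f x)) \<in> borel_measurable M"
proof (intro borel_measurable_vecI)
  fix k l
  define c :: "real^'n^'n" where "c = (SOME A'. False)"
  have sing: "matrix_inv A = c" if "\<not> invertible A" for A :: "real^'n^'n"
  proof -
    have "(\<lambda>A'. A ** A' = mat 1 \<and> A' ** A = mat 1) = (\<lambda>A'. False)"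
      using that unfolding invertible_def by auto
    then show ?thesis unfolding matrix_inv_def c_def by simp
  qed
  have "(\<lambda>x. matrix_inv (f x) $ k $ l) = (\<lambda>x. if det (f x) = 0 then c $ k $ l
      else det (\<chi> i j. if j = k then axis l 1 $ i else f x $ i $ j) / det (f x))"
    using sing by (auto simp: matrix_inv_eq_cramer invertible_det_nz)
  moreover have "(\<lambda>x. (\<chi> i j. if j = k then axis l 1 $ i else f x $ i $ j) :: real^'n^'n)
      \<in> borel_measurable M"
    by (intro borel_measurable_vecI) (simp, measurable)
  ultimately show "(\<lambda>x. matrix_inv (f x) $ k $ l) \<in> borel_measurable M"
    by simp
qed

lemma matrix_vector_mult_sum_right:
  fixes A :: "'a::comm_ring_1^'n^'m"
  shows "A *v (\<Sum>i\<in>I. f i) = (\<Sum>i\<in>I. A *v f i)"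
  by (induction I rule: infinite_finite_induct) (simp_all add: matrix_vector_right_distrib)

section \<open>Geometric decay of matrix powers\<close>

text \<open>Some nonzero polynomial annihilates the matrix. It splits into linear factors, and each factor
  \<open>A - l\<close> can be cancelled without destroying geometric decay of the orbit: if \<open>|l| < 1\<close> by solving the
  recursion, and otherwise because \<open>l\<close> is no eigenvalue.\<close>

definition poly_act :: "complex^'n^'n \<Rightarrow> complex poly \<Rightarrow> complex^'n \<Rightarrow> complex^'n" where
  "poly_act A p v = (\<Sum>i\<le>degree p. coeff p i *s (((*v) A ^^ i) v))"

lemma poly_act_ge:
  assumes "degree p \<le> N"
  shows "poly_act A p v = (\<Sum>i\<le>N. coeff p i *s (((*v) A ^^ i) v))"
  unfolding poly_act_def using assms
  by (intro sum.mono_neutral_left) (auto simp: coeff_eq_0)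

text \<open>Splitting a root off the polynomial becomes an application of \<open>A - l\<close> to a
  vector, the form in which a factor can be cancelled.\<close>

lemma poly_act_linear_factor:
  "poly_act A ([:- l, 1:] * q) v = A *v poly_act A q v - l *s poly_act A q v"
proof -
  let ?N = "degree q"
  have "poly_act A ([:- l, 1:] * q) v
      = (\<Sum>i\<le>Suc ?N. coeff ([:- l, 1:] * q) i *s (((*v) A ^^ i) v))"
    by (rule poly_act_ge) (use degree_mult_le[of "[:- l, 1:]" q] in simp)
  also have "\<dots> = (\<Sum>i\<le>Suc ?N. (- l * coeff q i) *s (((*v) A ^^ i) v))
      + (\<Sum>i\<le>Suc ?N. coeff (pCons 0 q) i *s (((*v) A ^^ i) v))"
    by (simp add: sum.distrib[symmetric] vector_sadd_rdistrib mult_pCons_left del: sum.atMost_Suc)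
  also have "(\<Sum>i\<le>Suc ?N. coeff (pCons 0 q) i *s (((*v) A ^^ i) v))
      = (\<Sum>i\<le>?N. coeff q i *s (A *v (((*v) A ^^ i) v)))"
    by (subst sum.atMost_Suc_shift) simp
  also have "\<dots> = A *v poly_act A q v"
    by (simp add: poly_act_def matrix_vector_mult_sum_right vector_scalar_commute)
  also have "(\<Sum>i\<le>Suc ?N. (- l * coeff q i) *s (((*v) A ^^ i) v)) = - (l *s poly_act A q v)"
    by (subst poly_act_ge[of q "Suc ?N"])
       (simp_all add: vec.scale_sum_right  vec.scale_scale sum_negf[symmetric] del: sum.atMost_Suc)
  finally show ?thesis by simp
qed

text \<open>Decay is tracked at a single vector, because factors are cancelled at a given vector;
  both constants may depend on it.\<close>

definition orbit_decays :: "complex^'n^'n \<Rightarrow> complex^'n \<Rightarrow> bool" where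
  "orbit_decays A v \<longleftrightarrow> (\<exists>C r. 0 < r \<and> r < 1 \<and> (\<forall>k. norm (((*v) A ^^ k) v) \<le> C * r ^ k))"

lemma norm_vector_scalar_mult: "norm (l *s v) = cmod l * norm v" for v :: "complex^'n"
  by (simp add: norm_vec_def norm_mult L2_set_right_distrib)

lemma funpow_matrix_diff_scale:
  "((*v) A ^^ k) (A *v v - l *s v) = A *v (((*v) A ^^ k) v) - l *s (((*v) A ^^ k) v)"
  for A :: "complex^'n^'n"
  by (induction k) (simp_all add: matrix_vector_mult_diff_distrib vector_scalar_commute)

text \<open>The orbit obeys \<open>v_(k+1) = l v_k + A^k (A v - l v)\<close> with a decaying forcing
  term. The new rate lies strictly above both \<open>r\<close> and \<open>cmod l\<close>, which also
  absorbs the resonant case \<open>cmod l = r\<close>, where a factor \<open>k\<close> would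
  appear.\<close>

lemma orbit_decays_cancel_small:
  fixes A :: "complex^'n^'n"
  assumes "orbit_decays A (A *v v - l *s v)" "cmod l < 1"
  shows "orbit_decays A v"
proof -
  obtain C r where C: "0 < r" "r < 1"
    "\<And>k. norm (((*v) A ^^ k) (A *v v - l *s v)) \<le> C * r ^ k"
    using assms(1) unfolding orbit_decays_def by blast
  have "0 \<le> C" using C(3)[of 0] by (auto intro: order_trans[OF norm_ge_zero])
  obtain s where s: "max r (cmod l) < s" "s < 1"
    using dense[of "max r (cmod l)" 1] C assms(2) by auto
  \<comment> \<open>Chosen so that \<open>cmod l * K + C \<le> K * s\<close>, which closes the
    induction step; \<open>norm v\<close> serves \<open>k = 0\<close>.\<close>
  define K where "K = max (norm v) (C / (s - cmod l))"
  have K: "C \<le> K * (s - cmod l)" "norm v \<le> K"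
    using s pos_divide_le_eq[of "s - cmod l" C K] by (auto simp: K_def)
  have "norm (((*v) A ^^ k) v) \<le> K * s ^ k" for k
  proof (induction k)
    case (Suc k)
    have "((*v) A ^^ Suc k) v = l *s (((*v) A ^^ k) v) + ((*v) A ^^ k) (A *v v - l *s v)"
      by (simp add: funpow_matrix_diff_scale)
    then have "norm (((*v) A ^^ Suc k) v) \<le> cmod l * norm (((*v) A ^^ k) v) + C * r ^ k"
      using C(3)[of k] norm_triangle_le by (metis add_left_mono norm_vector_scalar_mult)
    also have "\<dots> \<le> cmod l * (K * s ^ k) + C * s ^ k"
      using Suc s C(1) \<open>0 \<le> C\<close> by (intro add_mono mult_left_mono power_mono) auto
    also have "\<dots> = (cmod l * K + C) * s ^ k" by (simp add: algebra_simps)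
    also have "\<dots> \<le> (K * s) * s ^ k"
      using K(1) s C(1) by (intro mult_right_mono) (auto simp: algebra_simps)
    finally show ?case by (simp add: mult_ac)
  qed (use K in simp)
  moreover have "0 < s" using s C(1) by auto
  ultimately show ?thesis using s(2) unfolding orbit_decays_def by blast
qed

text \<open>\<open>A - l\<close> is injective on a finite-dimensional space, hence bounded below,
  and it commutes with the powers of \<open>A\<close>.\<close>

lemma orbit_decays_cancel_regular:
  fixes A :: "complex^'n^'n"
  assumes "orbit_decays A (A *v v - l *s v)" "\<And>w. A *v w = l *s w \<Longrightarrow> w = 0"
  shows "orbit_decays A v"
proof -
  let ?L = "\<lambda>w. A *v w - l *s w"
  obtain C r where C: "0 < r" "r < 1"
    "\<And>k. norm (((*v) A ^^ k) (A *v v - l *s v)) \<le> C * r ^ k"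
    using assms(1) unfolding orbit_decays_def by blast
  have lin: "linear ?L"
    by (rule linearI) (simp_all add: matrix_vector_right_distrib vector_add_ldistrib
        matrix_vector_mult_def vec_eq_iff scaleR_sum_right sum.distrib algebra_simps)
  moreover have "inj ?L"
    using assms(2) linear_injective_0[OF lin] by simp
  ultimately obtain B where B: "B > 0" "\<And>w. B * norm w \<le> norm (?L w)"
    using linear_inj_bounded_below_pos[of ?L] by blast
  have "norm (((*v) A ^^ k) v) \<le> (C / B) * r ^ k" for k
  proof -
    have "B * norm (((*v) A ^^ k) v) \<le> C * r ^ k"
      using B(2)[of "((*v) A ^^ k) v"] C(3)[of k] by (simp add: funpow_matrix_diff_scale)
    then show ?thesis using B(1) by (simp add: field_simps)
  qed
  then show ?thesis using C unfolding orbit_decays_def by blast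
qed

text \<open>The polynomial is any annihilating one, so its roots may be large without being
  eigenvalues; hence the two ways of cancelling a factor.\<close>

lemma orbit_decays_if_annihilated:
  fixes A :: "complex^'n^'n"
  assumes small: "\<And>l w. A *v w = l *s w \<Longrightarrow> w \<noteq> 0 \<Longrightarrow> cmod l < 1"
    and "p \<noteq> 0" "poly_act A p v = 0"
  shows "orbit_decays A v"
proof -
  \<comment> \<open>Vanishing is weakened to decay, since after one factor is cancelled the quotient
    only yields a decaying vector.\<close>
  have "orbit_decays A (poly_act A p v) \<Longrightarrow> orbit_decays A v"
    using \<open>p \<noteq> 0\<close>
  proof (induction "degree p" arbitrary: p)
    case 0
    then obtain c where c: "p = [:c:]" "c \<noteq> 0" by (metis degree_eq_zeroE pCons_0_0)
    have pw: "((*v) A ^^ k) (c *s v) = c *s (((*v) A ^^ k) v)" for k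
      by (induction k) (simp_all add: vector_scalar_commute)
    obtain C r where C: "0 < r" "r < 1" "\<And>k. norm (((*v) A ^^ k) (c *s v)) \<le> C * r ^ k"
      using 0 unfolding orbit_decays_def by (auto simp: c poly_act_def)
    have "norm (((*v) A ^^ k) v) \<le> (C / cmod c) * r ^ k" for k
      using C(3)[of k] c(2) by (simp add: pw norm_vector_scalar_mult field_simps)
    then show ?case using C unfolding orbit_decays_def by blast
  next
    case (Suc d)
    then have "\<not> constant (poly p)" by (simp add: constant_degree)
    then obtain l where "poly p l = 0" using fundamental_theorem_of_algebra by blast
    then obtain q where q: "p = [:- l, 1:] * q" using poly_eq_0_iff_dvd by (metis dvdE)
    with Suc.prems have "q \<noteq> 0" by auto
    moreover have "degree q = d"
      using Suc.hyps(2) \<open>q \<noteq> 0\<close> unfolding q by (subst (asm) degree_mult_eq) auto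
    moreover have "orbit_decays A (poly_act A q v)"
    proof (cases "\<exists>w. A *v w = l *s w \<and> w \<noteq> 0")
      case True
      then show ?thesis
        using small Suc.prems(1) unfolding q poly_act_linear_factor
        by (blast intro: orbit_decays_cancel_small)
    next
      case False
      then show ?thesis
        using Suc.prems(1) unfolding q poly_act_linear_factor
        by (blast intro: orbit_decays_cancel_regular)
    qed
    ultimately show ?case using Suc.hyps(1) by blast
  qed
  moreover have "orbit_decays A 0"
  proof -
    have "((*v) A ^^ k) 0 = 0" for k by (induction k) simp_all
    then show ?thesis unfolding orbit_decays_def by (intro exI[of _ 0] exI[of _ "1/2"]) simp
  qed
  ultimately show ?thesis using assms(3) by simp
qed

text \<open>There are \<open>N + 1\<close> powers in a space of dimension \<open>N\<close>. Linear
  dependence concerns sets of vectors, so a repetition among the powers is treated apart, with the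
  explicit relation \<open>1, -1\<close>.\<close>

lemma matpow_dependent:
  fixes A :: "real^'n^'n"
  obtains c :: "nat \<Rightarrow> real" and N where "(\<Sum>i\<le>N. c i *\<^sub>R matpow A i) = 0" "\<exists>i\<le>N. c i \<noteq> 0"
proof -
  define N where "N = DIM(real^'n^'n)"
  show ?thesis
  proof (cases "inj_on (matpow A) {..N}")
    case True
    then have "card (matpow A ` {..N}) = Suc N" by (simp add: card_image)
    then have "dependent (matpow A ` {..N})"
      using independent_bound[of "matpow A ` {..N}"] by (auto simp: N_def)
    then obtain u where u: "\<exists>v\<in>matpow A ` {..N}. u v \<noteq> 0"
      "(\<Sum>v\<in>matpow A ` {..N}. u v *\<^sub>R v) = 0"
      by (auto simp: dependent_finite)
    show ?thesis
    proof (rule that[of "\<lambda>i. u (matpow A i)" N])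
      show "(\<Sum>i\<le>N. u (matpow A i) *\<^sub>R matpow A i) = 0"
        using u(2) by (simp add: sum.reindex[OF True])
      show "\<exists>i\<le>N. u (matpow A i) \<noteq> 0"
        using u(1) by auto
    qed
  next
    case False
    then obtain i j where ij: "i \<le> N" "j \<le> N" "i \<noteq> j" "matpow A i = matpow A j"
      by (auto simp: inj_on_def)
    show ?thesis
    proof (rule that[of "\<lambda>k. if k = i then 1 else if k = j then -1 else 0" N])
      have "(\<Sum>k\<le>N. (if k = i then 1 else if k = j then -1 else 0) *\<^sub>R matpow A k)
          = (\<Sum>k\<le>N. (if k = i then matpow A k else 0) - (if k = j then matpow A k else 0))"
        by (rule sum.cong) (use ij in auto)
      also have "\<dots> = 0" using ij by (simp add: sum_subtractf)
      finally show "(\<Sum>k\<le>N. (if k = i then 1 else if k = j then -1 else 0) *\<^sub>R matpow A k) = 0" .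
    qed (use ij in auto)
  qed
qed

section \<open>Complexification and eigenvalues\<close>

definition cmat :: "real^'n^'n \<Rightarrow> complex^'n^'n" where
  "cmat A = (\<chi> i j. complex_of_real (A $ i $ j))"

lemma cmat_mult: "cmat (A ** B) = cmat A ** cmat B"
  by (simp add: cmat_def matrix_matrix_mult_def vec_eq_iff)

lemma funpow_cmat: "((*v) (cmat A) ^^ k) v = cmat (matpow A k) *v v"
proof (induction k)
  case 0
  have "cmat (mat 1 :: real^'a^'a) = mat 1" by (auto simp: cmat_def mat_def vec_eq_iff)
  then show ?case by simp
qed (simp add: cmat_mult matrix_vector_mul_assoc)

text \<open>Dimension counting takes the place of Cayley-Hamilton: any nonzero annihilating
  polynomial will do.\<close>

lemma annihilating_poly:
  fixes A :: "real^'n^'n"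
  obtains p where "p \<noteq> 0" "\<And>v. poly_act (cmat A) p v = 0"
proof -
  obtain c N where c: "(\<Sum>i\<le>N. c i *\<^sub>R matpow A i) = 0" "\<exists>i\<le>N. c i \<noteq> 0"
    by (rule matpow_dependent)
  define p where "p = (\<Sum>i\<le>N. monom (complex_of_real (c i)) i)"
  have cp: "coeff p i = (if i \<le> N then complex_of_real (c i) else 0)" for i
    by (simp add: p_def coeff_sum)
  have "p \<noteq> 0" using c(2) cp by (metis coeff_0 of_real_eq_0_iff)
  moreover have "poly_act (cmat A) p v = 0" for v
  proof -
    have "degree p \<le> N" by (rule degree_le) (simp add: cp)
    then have "poly_act (cmat A) p v = (\<Sum>i\<le>N. coeff p i *s (cmat (matpow A i) *v v))"
      by (simp add: poly_act_ge funpow_cmat)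
    also have "\<dots> = (\<Sum>i\<le>N. cmat (c i *\<^sub>R matpow A i) *v v)"
      by (rule sum.cong) (simp_all add: cp cmat_def matrix_vector_mult_def vec_eq_iff
          sum_distrib_left mult_ac)
    also have "\<dots> = cmat (\<Sum>i\<le>N. c i *\<^sub>R matpow A i) *v v"
      by (simp add: cmat_def matrix_vector_mult_def vec_eq_iff sum_distrib_right sum.swap[of _ UNIV])
    also have "\<dots> = 0" by (simp add: c cmat_def matrix_vector_mult_def vec_eq_iff)
    finally show ?thesis .
  qed
  ultimately show ?thesis by (rule that)
qed

lemma poly_act_eigenvector:
  assumes "A *v v = l *s v"
  shows "poly_act A p v = poly p l *s v"
proof -
  have "((*v) A ^^ k) v = l ^ k *s v" for k
    by (induction k) (simp_all add: assms vector_scalar_commute mult_ac)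
  then show ?thesis
    by (simp add: poly_act_def poly_altdef vec_eq_iff sum_distrib_right mult.assoc)
qed

text \<open>\<open>Max\<close> is meaningful only on a finite set; the eigenvalues are finitely many
  because they are roots of an annihilating polynomial.\<close>

lemma eigenvalue_le_spectral_radius:
  fixes A :: "real^'n^'n"
  assumes "cmat A *v v = l *s v" "v \<noteq> 0"
  shows "cmod l \<le> spectral_radius A"
proof -
  obtain p where p: "p \<noteq> 0" "\<And>v. poly_act (cmat A) p v = 0"
    using annihilating_poly[of A] by blast
  let ?S = "{cmod l | l. \<exists>v. v \<noteq> 0 \<and> cmat A *v v = l *s v}"
  have "?S \<subseteq> cmod ` {l. poly p l = 0}"
  proof clarify
    fix l and v :: "complex^'n" assume v: "v \<noteq> 0" "cmat A *v v = l *s v"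
    then have "poly p l = 0"
      using p(2)[of v] poly_act_eigenvector[OF v(2), of p] by simp
    then show "cmod l \<in> cmod ` {l. poly p l = 0}" by blast
  qed
  then have "finite ?S"
    using poly_roots_finite[OF p(1)] finite_subset by blast
  moreover have "cmod l \<in> ?S" using assms by blast
  ultimately show ?thesis
    unfolding spectral_radius_def cmat_def[symmetric] by (rule Max_ge)
qed

text \<open>The columns of \<open>matpow P k\<close> are orbits of the basis vectors, so decay at
  each vector suffices; the slowest of the finitely many rates serves for all.\<close>

lemma matpow_geometric_decay:
  fixes P :: "real^'n^'n"
  assumes "spectral_radius P < 1"
  obtains C r where "0 < r" "r < 1" "\<And>k. norm (matpow P k) \<le> C * r ^ k"
proof -
  have "\<forall>j. orbit_decays (cmat P) (axis j 1)"
  proof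
    fix j
    obtain p where "p \<noteq> 0" "\<And>v. poly_act (cmat P) p v = 0"
      using annihilating_poly[of P] by blast
    moreover have "cmod l < 1" if "cmat P *v w = l *s w" "w \<noteq> 0" for l w
      using eigenvalue_le_spectral_radius[OF that] assms by simp
    ultimately show "orbit_decays (cmat P) (axis j 1)"
      by (blast intro: orbit_decays_if_annihilated)
  qed
  then obtain C r where C: "\<And>j. 0 < r j" "\<And>j. r j < 1"
    "\<And>j k. norm (((*v) (cmat P) ^^ k) (axis j 1)) \<le> C j * r j ^ k"
    unfolding orbit_decays_def by metis
  define s where "s = Max (range r)"
  have s: "r j \<le> s" for j unfolding s_def by simp
  have "s \<in> range r" unfolding s_def by (rule Max_in) auto
  then have s01: "0 < s" "s < 1" using C by auto
  have C0: "0 \<le> C j" for j using C(3)[of 0 j] by (auto intro: order_trans[OF norm_ge_zero])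
  have "norm (matpow P k) \<le> (\<Sum>i\<in>(UNIV::'n set). \<Sum>j\<in>UNIV. C j) * s ^ k" for k
  proof -
    have ij: "\<bar>matpow P k $ i $ j\<bar> \<le> C j * s ^ k" for i j
    proof -
      have "\<bar>matpow P k $ i $ j\<bar> = norm ((cmat (matpow P k) *v axis j 1) $ i)"
        by (simp add: matrix_vector_mult_def axis_def cmat_def if_distrib cong: if_cong)
      also have "\<dots> \<le> norm (((*v) (cmat P) ^^ k) (axis j 1))"
        unfolding funpow_cmat norm_vec_def by (rule member_le_L2_set) simp_all
      also have "\<dots> \<le> C j * r j ^ k" by (rule C)
      also have "\<dots> \<le> C j * s ^ k"
        using s C C0 by (intro mult_left_mono power_mono) (auto intro: less_imp_le)
      finally show ?thesis .
    qed
    have "norm (matpow P k) \<le> (\<Sum>i\<in>UNIV. norm (matpow P k $ i))"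
      unfolding norm_vec_def by (rule L2_set_le_sum) simp
    also have "\<dots> \<le> (\<Sum>i\<in>UNIV. \<Sum>j\<in>UNIV. \<bar>matpow P k $ i $ j\<bar>)"
      by (intro sum_mono norm_le_l1_cart)
    also have "\<dots> \<le> (\<Sum>i\<in>(UNIV::'n set). \<Sum>j\<in>UNIV. C j * s ^ k)"
      by (intro sum_mono ij)
    finally show ?thesis by (simp add: sum_distrib_right mult.assoc)
  qed
  then show ?thesis using that s01 by blast
qed

section \<open>Convergence of integrals from characteristic functions\<close>

text \<open>Finite sums of exponentials: by linearity, their integrals against a weight converge as
  soon as the weighted characteristic functions do.\<close>

inductive trig_poly :: "('b::euclidean_space \<Rightarrow> complex) \<Rightarrow> bool" where
  trig_exp: "trig_poly (\<lambda>x. c * iexp (t \<bullet> x))"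
| trig_add: "trig_poly p \<Longrightarrow> trig_poly q \<Longrightarrow> trig_poly (\<lambda>x. p x + q x)"

lemma trig_const: "trig_poly (\<lambda>x. c)"
  using trig_exp[of c 0] by simp

lemma trig_sum: "(\<And>i. i \<in> I \<Longrightarrow> trig_poly (p i)) \<Longrightarrow> trig_poly (\<lambda>x. \<Sum>i\<in>I. p i x)"
  by (induction I rule: infinite_finite_induct) (auto intro: trig_const trig_add)

lemma trig_mult_exp: "trig_poly q \<Longrightarrow> trig_poly (\<lambda>x. c * iexp (t \<bullet> x) * q x)"
proof (induction rule: trig_poly.induct)
  case (trig_exp d u)
  have "c * iexp (t \<bullet> x) * (d * iexp (u \<bullet> x)) = (c * d) * iexp ((t + u) \<bullet> x)" for x
    by (simp add: inner_add_left distrib_left exp_add)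
  then show ?case using trig_poly.trig_exp[of "c * d" "t + u"] by (simp only:)
next
  case (trig_add p q)
  then show ?case using trig_poly.trig_add by (simp add: distrib_left)
qed

lemma trig_mult: "trig_poly p \<Longrightarrow> trig_poly q \<Longrightarrow> trig_poly (\<lambda>x. p x * q x)"
proof (induction rule: trig_poly.induct)
  case (trig_exp c t)
  then show ?case by (rule trig_mult_exp)
next
  case (trig_add p p')
  then show ?case using trig_poly.trig_add by (simp add: distrib_right)
qed

lemma trig_sin: "trig_poly (\<lambda>x. complex_of_real (sin (t \<bullet> x)))"
proof -
  have "complex_of_real (sin (t \<bullet> x)) = (- \<i> / 2) * iexp (t \<bullet> x) + (\<i> / 2) * iexp ((- t) \<bullet> x)" for x
    unfolding sin_of_real[symmetric] sin_exp_eq by (simp add: inner_minus_left field_simps)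
  then show ?thesis
    using trig_add[OF trig_exp[of "- \<i> / 2" t] trig_exp[of "\<i> / 2" "- t"]] by (simp only:)
qed

text \<open>Sines are combinations of two exponentials and trigonometric polynomials are closed
  under products; linear functionals are expanded over \<open>Basis\<close>.\<close>

lemma trig_poly_of_polynomial_in_sines:
  fixes f :: "'b::euclidean_space \<Rightarrow> real"
  assumes "real_polynomial_function f"
  shows "trig_poly (\<lambda>x. complex_of_real (f (\<Sum>b\<in>Basis. sin (c * (x \<bullet> b)) *\<^sub>R b)))"
  using assms
proof (induction rule: real_polynomial_function.induct)
  case (linear f)
  interpret f: bounded_linear f by (rule linear)
  have "complex_of_real (f (\<Sum>b\<in>Basis. sin (c * (x \<bullet> b)) *\<^sub>R b))
      = (\<Sum>b\<in>Basis. complex_of_real (f b) * complex_of_real (sin ((c *\<^sub>R b) \<bullet> x)))" for x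
    by (simp add: f.sum f.scaleR inner_commute mult.commute)
  then show ?case by (simp only:) (intro trig_sum trig_mult trig_const trig_sin)
qed (auto intro: trig_const trig_add trig_mult)

lemma trig_poly_bounded_continuous:
  assumes "trig_poly p"
  shows "continuous_on UNIV p" "bounded (range p)"
  using assms
proof (induction rule: trig_poly.induct)
  case (trig_exp c t)
  { case 1 show ?case by (intro continuous_intros) }
  { case 2 show ?case by (auto intro!: boundedI[of _ "cmod c"] simp: norm_mult) }
next
  case (trig_add p q)
  { case 1 show ?case using trig_add by (intro continuous_intros) }
  { case 2 show ?case using trig_add bounded_plus_comp[of p UNIV q] by simp }
qed

text \<open>The approximating polynomial is a polynomial in the functions \<open>sin (c x\<^sub>b)\<close>, which take values in
  a fixed cube; this is what keeps it bounded outside the given ball.\<close>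

lemma trig_poly_approximation:
  fixes h :: "'b::euclidean_space \<Rightarrow> real"
  assumes h: "continuous_on UNIV h" "\<And>x. \<bar>h x\<bar> \<le> H" and "K > 0" "e > 0"
  obtains f where "trig_poly (\<lambda>x. complex_of_real (f x))" "\<And>x. \<bar>f x\<bar> \<le> H + e"
    "\<And>x. norm x \<le> K \<Longrightarrow> \<bar>f x - h x\<bar> \<le> e"
proof -
  \<comment> \<open>With this scale the arguments \<open>c * (x \<bullet> b)\<close> stay in
    \<open>[-pi/2, pi/2]\<close> for \<open>norm x \<le> K\<close>, so that \<open>\<tau>\<close>,
    built from \<open>arcsin\<close>, inverts \<open>s\<close> on that ball.\<close>
  define c where "c = pi / (2 * K)"
  have "c > 0" using \<open>K > 0\<close> by (simp add: c_def)
  define s where "s x = (\<Sum>b\<in>Basis. sin (c * (x \<bullet> b)) *\<^sub>R b)" for x :: 'b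
  define \<tau> where "\<tau> y = (\<Sum>b\<in>Basis. (arcsin (y \<bullet> b) / c) *\<^sub>R b)" for y :: 'b
  let ?C = "cbox (- One) (One :: 'b)"
  have C: "y \<in> ?C \<longleftrightarrow> (\<forall>b\<in>Basis. -1 \<le> y \<bullet> b \<and> y \<bullet> b \<le> 1)" for y
    by (simp add: mem_box)
  have sC: "s x \<in> ?C" for x by (simp add: C s_def)
  have "continuous_on ?C \<tau>"
    unfolding \<tau>_def using \<open>c > 0\<close> C by (intro continuous_intros) auto
  then have "continuous_on ?C (h \<circ> \<tau>)"
    by (rule continuous_on_compose) (rule continuous_on_subset[OF h(1)], simp)
  then obtain q where q: "real_polynomial_function q" "\<And>y. y \<in> ?C \<Longrightarrow> \<bar>(h \<circ> \<tau>) y - q y\<bar> < e"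
    using Stone_Weierstrass_real_polynomial_function[of ?C "h \<circ> \<tau>" e] \<open>e > 0\<close>
    by (metis compact_cbox)
  have \<tau>s: "\<tau> (s x) = x" if "norm x \<le> K" for x
  proof -
    have "arcsin (s x \<bullet> b) / c = x \<bullet> b" if b: "b \<in> Basis" for b
    proof -
      have "\<bar>x \<bullet> b\<bar> \<le> K" using Basis_le_norm[OF b, of x] \<open>norm x \<le> K\<close> by simp
      then have "\<bar>c * (x \<bullet> b)\<bar> \<le> c * K"
        using \<open>c > 0\<close> by (simp add: abs_mult)
      also have "c * K = pi / 2" using \<open>K > 0\<close> by (simp add: c_def)
      finally have "arcsin (sin (c * (x \<bullet> b))) = c * (x \<bullet> b)"
        by (intro arcsin_sin) auto
      then show ?thesis using b \<open>c > 0\<close> by (simp add: s_def)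
    qed
    then show ?thesis by (simp add: \<tau>_def euclidean_representation)
  qed
  show ?thesis
  proof (rule that[of "\<lambda>x. q (s x)"])
    show "trig_poly (\<lambda>x. complex_of_real (q (s x)))"
      unfolding s_def by (rule trig_poly_of_polynomial_in_sines[OF q(1)])
    show "\<bar>q (s x)\<bar> \<le> H + e" for x
      using q(2)[OF sC[of x]] h(2)[of "\<tau> (s x)"] by simp
    show "\<bar>q (s x) - h x\<bar> \<le> e" if "norm x \<le> K" for x
      using q(2)[OF sC[of x]] \<tau>s[OF that] by simp
  qed
qed

lemma norm_integral_le:
  fixes f :: "'a \<Rightarrow> 'b::{banach,second_countable_topology}"
  assumes "integrable M f" "integrable M g" "\<And>x. x \<in> space M \<Longrightarrow> norm (f x) \<le> g x"
  shows "norm (\<integral>x. f x \<partial>M) \<le> (\<integral>x. g x \<partial>M)"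
  using assms by (intro order_trans[OF integral_norm_bound] integral_mono) auto

lemma integrable_mult_bounded:
  fixes u v :: "'a \<Rightarrow> 'b::{real_normed_field,banach,second_countable_topology}"
  assumes u: "integrable M u" and v: "v \<in> borel_measurable M" "AE x in M. norm (v x) \<le> c"
  shows "integrable M (\<lambda>x. u x * v x)"
proof (rule Bochner_Integration.integrable_bound)
  show "integrable M (\<lambda>x. c * norm (u x))" using u by simp
  show "(\<lambda>x. u x * v x) \<in> borel_measurable M" using u v by simp
  show "AE x in M. norm (u x * v x) \<le> norm (c * norm (u x))"
    using v(2)
  proof eventually_elim
    case (elim x)
    then have "norm (u x) * norm (v x) \<le> norm (u x) * c" by (intro mult_left_mono) auto
    then show ?case by (simp add: norm_mult mult.commute)
  qed
qed

section \<open>Tightness\<close>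

lemma (in finite_measure) random_vector_tight:
  fixes Y :: "'a \<Rightarrow> 'b::euclidean_space"
  assumes [measurable]: "Y \<in> borel_measurable M" and "e > 0"
  obtains K where "K > 0" "measure M {w \<in> space M. norm (Y w) > K} < e"
proof -
  let ?A = "\<lambda>i. {w \<in> space M. norm (Y w) > real i}"
  have "(\<lambda>i. measure M (?A i)) \<longlonglongrightarrow> measure M (\<Inter>i. ?A i)"
    by (rule finite_Lim_measure_decseq) (auto simp: decseq_def)
  also have "(\<Inter>i. ?A i) = {}"
    by (auto simp: not_less) (metis reals_Archimedean2 less_asym)
  finally have "(\<lambda>i. measure M (?A i)) \<longlonglongrightarrow> 0" by simp
  then have "\<forall>\<^sub>F i in sequentially. measure M (?A i) < e \<and> i > 0"
    using order_tendstoD(2)[OF _ \<open>e > 0\<close>] eventually_gt_at_top[of 0] by (intro eventually_conj) auto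
  then obtain i where "measure M (?A i) < e" "i > 0"
    using eventually_happens'[OF sequentially_bot] by blast
  then show ?thesis using that[of "real i"] by simp
qed

text \<open>Only eventual in \<open>n\<close>, because for small \<open>n\<close> the matrices
  \<open>B n\<close> may be singular and nothing is known about the rescaled process.\<close>

definition tight_seq :: "'a measure \<Rightarrow> (nat \<Rightarrow> 'a \<Rightarrow> 'b::real_normed_vector) \<Rightarrow> bool" where
  "tight_seq Q X \<longleftrightarrow>
     (\<forall>e>0. \<exists>K. \<forall>\<^sub>F n in sequentially. measure Q {w \<in> space Q. norm (X n w) > K} \<le> e)"

lemma (in finite_measure) tight_seqE:
  fixes X :: "nat \<Rightarrow> 'a \<Rightarrow> 'b::euclidean_space"
  assumes "tight_seq M X" and [measurable]: "\<And>n. X n \<in> borel_measurable M" and "e > 0"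
  obtains K where "K \<ge> K0"
    "\<forall>\<^sub>F n in sequentially. measure M {w \<in> space M. norm (X n w) > K} \<le> e"
proof -
  obtain K where K: "\<forall>\<^sub>F n in sequentially. measure M {w \<in> space M. norm (X n w) > K} \<le> e"
    using assms unfolding tight_seq_def by blast
  have "measure M {w \<in> space M. norm (X n w) > max K K0}
      \<le> measure M {w \<in> space M. norm (X n w) > K}" for n
    by (rule finite_measure_mono) auto
  then have "\<forall>\<^sub>F n in sequentially. measure M {w \<in> space M. norm (X n w) > max K K0} \<le> e"
    using K by (rule_tac eventually_mono[OF K]) (rule order_trans)
  then show ?thesis using that[of "max K K0"] by simp
qed

lemma (in prob_space) integral_trig_poly_tendsto:
  fixes X :: "nat \<Rightarrow> 'a \<Rightarrow> 'b::euclidean_space" and g :: "'a \<Rightarrow> real" and p :: "'b \<Rightarrow> complex"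
  assumes [measurable]: "\<And>n. X n \<in> borel_measurable M" "Y \<in> borel_measurable M"
    and g: "integrable M g"
    and chars: "\<And>t. (\<lambda>n. CLINT w|M. g w * iexp (t \<bullet> X n w)) \<longlonglongrightarrow> (CLINT w|M. g w * iexp (t \<bullet> Y w))"
    and p: "trig_poly p"
  shows "(\<lambda>n. CLINT w|M. g w * p (X n w)) \<longlonglongrightarrow> (CLINT w|M. g w * p (Y w))"
  using p
proof (induction rule: trig_poly.induct)
  case (trig_exp c t)
  have "(CLINT w|M. g w * (c * iexp (t \<bullet> W w))) = c * (CLINT w|M. g w * iexp (t \<bullet> W w))" for W
    by (simp add: mult.left_commute)
  then show ?case using tendsto_mult_left[OF chars, of c] by simp
next
  case (trig_add p q)
  have int: "integrable M (\<lambda>w. g w * f (W w))"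
    if tf: "trig_poly f" and [measurable]: "W \<in> borel_measurable M" for f :: "'b \<Rightarrow> complex" and W
  proof -
    obtain C where C: "\<And>x. cmod (f x) \<le> C"
      using trig_poly_bounded_continuous(2)[OF tf] by (auto simp: bounded_iff)
    have [measurable]: "f \<in> borel_measurable borel"
      using trig_poly_bounded_continuous(1)[OF tf] by (rule borel_measurable_continuous_onI)
    show ?thesis
      by (rule integrable_mult_bounded[where c = C]) (use g C in auto)
  qed
  show ?case using tendsto_add[OF trig_add.IH] trig_add.hyps
    by (simp add: distrib_left int)
qed

text \<open>A substitute for the continuity theorem in the presence of a signed weight. On a large
  ball \<open>h\<close> is replaced by a trigonometric polynomial; outside, tightness makes the
  probability small and the uniform bound of the polynomial controls the error.\<close>

lemma (in prob_space) integral_tendsto_of_characteristic: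
  fixes X :: "nat \<Rightarrow> 'a \<Rightarrow> 'b::euclidean_space" and g :: "'a \<Rightarrow> real"
  assumes X[measurable]: "\<And>n. X n \<in> borel_measurable M" "Y \<in> borel_measurable M"
    and g[measurable]: "g \<in> borel_measurable M" "\<And>w. \<bar>g w\<bar> \<le> k"
    and chars: "\<And>t. (\<lambda>n. CLINT w|M. g w * iexp (t \<bullet> X n w)) \<longlonglongrightarrow> (CLINT w|M. g w * iexp (t \<bullet> Y w))"
    and tight: "tight_seq M X"
    and h: "continuous_on UNIV h" "bounded (range h)"
  shows "(\<lambda>n. \<integral>w. g w * h (X n w) \<partial>M) \<longlonglongrightarrow> (\<integral>w. g w * h (Y w) \<partial>M)"
proof (rule LIMSEQ_I)
  fix e :: real assume "e > 0"
  have k0: "0 \<le> k" using g(2) by (rule order_trans[OF abs_ge_zero])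
  obtain H where H: "\<And>x. \<bar>h x\<bar> \<le> H" using h(2) by (auto simp: bounded_iff)
  then have H0: "0 \<le> H" by (rule order_trans[OF abs_ge_zero])
  have [measurable]: "h \<in> borel_measurable borel"
    using h(1) by (rule borel_measurable_continuous_onI)
  \<comment> \<open>Makes each replacement error \<open>k * (d + (2 * H + 1) * d)\<close> at most
    \<open>e / 4\<close>. The cap at 1 bounds the discrepancy \<open>2 * H + d\<close> outside the
    ball by \<open>2 * H + 1\<close>.\<close>
  define d where "d = min 1 (e / (4 * (k + 1) * (2 * H + 2)))"
  have d: "0 < d" "d \<le> 1" using \<open>e > 0\<close> k0 H0 by (auto simp: d_def)
  obtain KY where KY: "KY > 0" "prob {w \<in> space M. norm (Y w) > KY} < d"
    using random_vector_tight[OF X(2) d(1)] by blast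
  obtain K where K: "K \<ge> KY"
    "\<forall>\<^sub>F n in sequentially. prob {w \<in> space M. norm (X n w) > K} \<le> d"
    using tight_seqE[OF tight X(1) d(1)] by blast
  have "K > 0" using K KY by simp
  have "prob {w \<in> space M. norm (Y w) > K} \<le> prob {w \<in> space M. norm (Y w) > KY}"
    by (rule finite_measure_mono) (use K in auto)
  with KY have KY': "prob {w \<in> space M. norm (Y w) > K} \<le> d" by simp
  obtain f where f: "trig_poly (\<lambda>x. complex_of_real (f x))" "\<And>x. \<bar>f x\<bar> \<le> H + d"
    "\<And>x. norm x \<le> K \<Longrightarrow> \<bar>f x - h x\<bar> \<le> d"
    using trig_poly_approximation[OF h(1) H \<open>K > 0\<close> d(1)] by blast
  have "continuous_on UNIV f"
    using continuous_on_Re[OF trig_poly_bounded_continuous(1)[OF f(1)]] by simp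
  then have [measurable]: "f \<in> borel_measurable borel"
    by (rule borel_measurable_continuous_onI)
  have int: "integrable M (\<lambda>w. g w * u (W w))"
    if [measurable]: "u \<in> borel_measurable borel" and u: "\<And>x. \<bar>u x\<bar> \<le> C"
      and [measurable]: "W \<in> borel_measurable M" for u :: "'b \<Rightarrow> real" and W C
    by (rule integrable_const_bound[of _ "k * C"])
       (auto simp: abs_mult intro!: AE_I2 mult_mono g u order_trans[OF abs_ge_zero g(2)])
  have close: "\<bar>(\<integral>w. g w * f (W w) \<partial>M) - (\<integral>w. g w * h (W w) \<partial>M)\<bar> \<le> k * (d + (2 * H + 1) * d)"
    if Wm[measurable]: "W \<in> borel_measurable M"
      and W: "prob {w \<in> space M. norm (W w) > K} \<le> d" for W
  proof -
    let ?D = "{w \<in> space M. norm (W w) > K}"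
    have ind: "integrable M (indicat_real ?D)"
      by (intro integrable_real_indicator) (auto simp: emeasure_eq_measure)
    have "\<bar>(\<integral>w. g w * f (W w) \<partial>M) - (\<integral>w. g w * h (W w) \<partial>M)\<bar>
        = \<bar>\<integral>w. g w * f (W w) - g w * h (W w) \<partial>M\<bar>"
      using int[of f _ W, OF _ f(2)] int[of h _ W, OF _ H] by simp
    also have "\<dots> \<le> (\<integral>w. k * (d + (2 * H + 1) * indicator ?D w) \<partial>M)"
      unfolding real_norm_def[symmetric]
    proof (rule norm_integral_le)
      show "integrable M (\<lambda>w. g w * f (W w) - g w * h (W w))"
        using int[of f _ W, OF _ f(2)] int[of h _ W, OF _ H] by simp
      show "integrable M (\<lambda>w. k * (d + (2 * H + 1) * indicat_real ?D w))"
        using ind by simp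
      fix w assume w: "w \<in> space M"
      have "\<bar>f (W w) - h (W w)\<bar> \<le> d + (2 * H + 1) * indicator ?D w"
        using f(2)[of "W w"] f(3)[of "W w"] H[of "W w"] d w by (auto simp: indicator_def)
      then show "norm (g w * f (W w) - g w * h (W w)) \<le> k * (d + (2 * H + 1) * indicat_real ?D w)"
        unfolding real_norm_def right_diff_distrib[symmetric] abs_mult using g(2) k0 by (intro mult_mono) auto
    qed
    also have "\<dots> = k * (d + (2 * H + 1) * prob ?D)"
      using ind by (simp add: prob_space)
    also have "\<dots> \<le> k * (d + (2 * H + 1) * d)"
      using W k0 H0 by (intro mult_left_mono add_left_mono) auto
    finally show ?thesis .
  qed
  have bound: "k * (d + (2 * H + 1) * d) \<le> e / 4"
  proof -
    have "k * (d + (2 * H + 1) * d) = d * (k * (2 * H + 2))" by (simp add: algebra_simps)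
    also have "\<dots> \<le> (e / (4 * (k + 1) * (2 * H + 2))) * ((k + 1) * (2 * H + 2))"
      using k0 H0 \<open>e > 0\<close> by (intro mult_mono) (auto simp: d_def)
    also have "\<dots> = e / 4"
    proof -
      have "e / (4 * b * c) * (b * c) = e / 4" if "b \<noteq> 0" "c \<noteq> 0" for b c :: real
        using that by simp
      from this[of "k + 1" "2 * H + 2"] show ?thesis using k0 H0 by (simp del: distrib_right_numeral distrib_left_numeral)
    qed
    finally show ?thesis .
  qed
  have "integrable M g" by (rule integrable_const_bound[of _ k]) (auto simp: g)
  then have "(\<lambda>n. CLINT w|M. g w * complex_of_real (f (X n w)))
      \<longlonglongrightarrow> (CLINT w|M. g w * complex_of_real (f (Y w)))"
    by (intro integral_trig_poly_tendsto[OF X _ chars f(1)])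
  then have "(\<lambda>n. \<integral>w. g w * f (X n w) \<partial>M) \<longlonglongrightarrow> (\<integral>w. g w * f (Y w) \<partial>M)"
    unfolding of_real_mult[symmetric] integral_complex_of_real tendsto_of_real_iff .
  then have "\<forall>\<^sub>F n in sequentially.
      norm ((\<integral>w. g w * f (X n w) \<partial>M) - (\<integral>w. g w * f (Y w) \<partial>M)) < e / 4"
    unfolding dist_norm[symmetric] by (rule tendstoD) (use \<open>e > 0\<close> in simp)
  with K(2) have "\<forall>\<^sub>F n in sequentially.
      norm ((\<integral>w. g w * h (X n w) \<partial>M) - (\<integral>w. g w * h (Y w) \<partial>M)) < e"
  proof eventually_elim
    case (elim n)
    show ?case
      using close[OF X(1) elim(1)] close[OF X(2) KY'] bound elim(2) \<open>e > 0\<close>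
      unfolding real_norm_def by argo
  qed
  then show "\<exists>N. \<forall>n\<ge>N. norm ((\<integral>w. g w * h (X n w) \<partial>M) - (\<integral>w. g w * h (Y w) \<partial>M)) < e"
    by (simp add: eventually_sequentially)
qed

section \<open>The Cauchy law\<close>

text \<open>The derivative is obtained by comparing \<Phi> with an antiderivative \<open>E\<close>
  of the density: both assign the same increments to intervals, so they differ by a
  constant.\<close>

lemma std_normal_cdf_properties:
  defines "\<Phi> \<equiv> cdf std_normal_distribution"
  shows "(\<Phi> has_real_derivative std_normal_density x) (at x)"
    and "(\<Phi> \<longlongrightarrow> 1) at_top" and "(\<Phi> \<longlongrightarrow> 0) at_bot"
proof -
  interpret N: real_distribution std_normal_distribution by (rule real_dist_normal_dist)
  show "(\<Phi> \<longlongrightarrow> 1) at_top" "(\<Phi> \<longlongrightarrow> 0) at_bot"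
    unfolding \<Phi>_def by (rule N.cdf_lim_at_top_prob N.cdf_lim_at_bot)+
  have cont: "isCont std_normal_density x" for x
    unfolding std_normal_density_def by (intro continuous_intros) auto
  then obtain E where E: "\<And>x. (E has_real_derivative std_normal_density x) (at x)"
    using einterval_antiderivative[of "-\<infinity>" \<infinity> std_normal_density]
    by (auto simp: has_real_derivative_iff_has_vector_derivative)
  have diff: "\<Phi> b - \<Phi> a = E b - E a" if "a < b" for a b
  proof -
    have "emeasure std_normal_distribution {a<..b}
        = (\<integral>\<^sup>+x. ennreal (std_normal_density x) * indicator {a..b} x \<partial>lborel)"
      using AE_lborel_singleton[of a]
      by (simp add: emeasure_density) (intro nn_integral_cong_AE, auto simp: indicator_def)
    also have "\<dots> = E b - E a"
      using that E by (intro nn_integral_FTC_Icc) auto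
    finally have "ennreal (N.prob {a<..b}) = ennreal (E b - E a)"
      by (simp add: N.emeasure_eq_measure)
    moreover have "E a \<le> E b"
    proof (rule DERIV_nonneg_imp_nondecreasing[where f = E])
      fix x assume "a \<le> x" "x \<le> b"
      show "\<exists>y. (E has_real_derivative y) (at x) \<and> 0 \<le> y"
        by (rule exI[of _ "std_normal_density x"]) (simp add: E)
    qed (use that in simp)
    ultimately show ?thesis
      using that by (simp add: \<Phi>_def N.cdf_diff_eq)
  qed
  have "\<Phi> y = E y + (\<Phi> 0 - E 0)" for y
    using diff[of 0 y] diff[of y 0] by (cases "y > 0"; cases "y = 0") auto
  then have "\<Phi> = (\<lambda>y. E y + (\<Phi> 0 - E 0))" by blast
  then show "(\<Phi> has_real_derivative std_normal_density x) (at x)"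
    using DERIV_add[OF E[of x] DERIV_const] by (metis add.right_neutral)
qed

text \<open>The integrand has the explicit antiderivative \<open>F\<close>: in its derivative the terms in \<open>c\<close> cancel.\<close>

lemma integral_inverse_sqrt_exp:
  fixes c :: real
  assumes "c > 0"
  shows "(LBINT s:{0<..}. exp (- s - c\<^sup>2 / s) / sqrt (pi * s)) = exp (- 2 * c)"
proof -
  define \<Phi> where "\<Phi> = cdf std_normal_distribution"
  note \<Phi> = std_normal_cdf_properties[folded \<Phi>_def]
  \<comment> \<open>\<open>(u s)^2 / 2 = s - 2 c + c^2 / s\<close> and
    \<open>(w s)^2 / 2 = s + 2 c + c^2 / s\<close>, so the prefactors in \<open>F\<close> bring both
    Gaussian factors to the common value \<open>exp (- s - c^2 / s)\<close>.\<close>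
  define u where "u s = sqrt 2 * (sqrt s - c / sqrt s)" for s
  define w where "w s = sqrt 2 * (sqrt s + c / sqrt s)" for s
  define F where "F s = exp (- 2 * c) * \<Phi> (u s) + exp (2 * c) * \<Phi> (w s)" for s
  define f where "f s = exp (- s - c\<^sup>2 / s) / sqrt (pi * s)" for s
  have n: "std_normal_density (sqrt 2 * v) = exp (- v\<^sup>2) / (sqrt 2 * sqrt pi)" for v
    by (simp add: std_normal_density_def power_mult_distrib real_sqrt_mult)
  have dF: "(F has_real_derivative f s) (at s)" if "s > 0" for s
  proof -
    define q where "q = sqrt s"
    have q: "q > 0" "s = q\<^sup>2" using that by (auto simp: q_def)
    have du: "(u has_real_derivative sqrt 2 * (1 / (2 * q) + c / (2 * q ^ 3))) (at s)"
      unfolding u_def using that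
      using q(1) by (auto intro!: derivative_eq_intros
          simp: q_def[symmetric] power2_eq_square power3_eq_cube field_simps)
    have dw: "(w has_real_derivative sqrt 2 * (1 / (2 * q) - c / (2 * q ^ 3))) (at s)"
      unfolding w_def using that
      using q(1) by (auto intro!: derivative_eq_intros
          simp: q_def[symmetric] power2_eq_square power3_eq_cube field_simps)
    have eu: "exp (- 2 * c) * exp (- (q - c / q)\<^sup>2) = exp (- s - c\<^sup>2 / s)"
      unfolding exp_add[symmetric] using q(1) by (simp add: q(2) power2_eq_square field_simps)
    have ew: "exp (2 * c) * exp (- (q + c / q)\<^sup>2) = exp (- s - c\<^sup>2 / s)"
      unfolding exp_add[symmetric] using q(1) by (simp add: q(2) power2_eq_square field_simps)
    have "(F has_real_derivative
        exp (- 2 * c) * (std_normal_density (u s) * (sqrt 2 * (1 / (2 * q) + c / (2 * q ^ 3))))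
        + exp (2 * c) * (std_normal_density (w s) * (sqrt 2 * (1 / (2 * q) - c / (2 * q ^ 3))))) (at s)"
      unfolding F_def
      by (intro DERIV_add DERIV_cmult DERIV_chain2[OF \<Phi>(1) du] DERIV_chain2[OF \<Phi>(1) dw])
    also have "exp (- 2 * c) * (std_normal_density (u s) * (sqrt 2 * (1 / (2 * q) + c / (2 * q ^ 3))))
        = (exp (- 2 * c) * exp (- (q - c / q)\<^sup>2)) * (1 / (2 * q) + c / (2 * q ^ 3)) / sqrt pi"
      by (simp add: u_def n q_def[symmetric])
    also have "exp (2 * c) * (std_normal_density (w s) * (sqrt 2 * (1 / (2 * q) - c / (2 * q ^ 3))))
        = (exp (2 * c) * exp (- (q + c / q)\<^sup>2)) * (1 / (2 * q) - c / (2 * q ^ 3)) / sqrt pi"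
      by (simp add: w_def n q_def[symmetric])
    also have "(exp (- 2 * c) * exp (- (q - c / q)\<^sup>2)) * (1 / (2 * q) + c / (2 * q ^ 3)) / sqrt pi
        + (exp (2 * c) * exp (- (q + c / q)\<^sup>2)) * (1 / (2 * q) - c / (2 * q ^ 3)) / sqrt pi
        = exp (- s - c\<^sup>2 / s) * (1 / q) / sqrt pi"
      unfolding eu ew by (simp add: field_simps)
    also have "\<dots> = f s"
      by (simp add: f_def q_def real_sqrt_mult)
    finally show ?thesis .
  qed
  \<comment> \<open>Near 0 the arguments diverge with opposite signs, so \<open>F\<close> tends to
    \<open>exp (2 * c)\<close> there and to \<open>exp (- 2 * c) + exp (2 * c)\<close> at infinity;
    the integral is the difference.\<close>
  have lims: "filterlim u at_bot (at_right 0)" "filterlim w at_top (at_right 0)"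
    "filterlim u at_top at_top" "filterlim w at_top at_top"
    unfolding u_def w_def using \<open>c > 0\<close> by real_asymp+
  have "((F \<circ> real_of_ereal) \<longlongrightarrow> exp (- 2 * c) * 0 + exp (2 * c) * 1) (at_right (ereal 0))"
    unfolding F_def ereal_tendsto_simps
    by (intro tendsto_intros filterlim_compose[OF \<Phi>(2)] filterlim_compose[OF \<Phi>(3)] lims)
  moreover have "((F \<circ> real_of_ereal) \<longlongrightarrow> exp (- 2 * c) * 1 + exp (2 * c) * 1) (at_left \<infinity>)"
    unfolding F_def ereal_tendsto_simps
    by (intro tendsto_intros filterlim_compose[OF \<Phi>(2)] lims)
  moreover have "isCont f s" if "s > 0" for s
    unfolding f_def using that by (intro continuous_intros) auto
  ultimately have "(LBINT s=0..\<infinity>. f s) = exp (- 2 * c)"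
    using interval_integral_FTC_nonneg(2)[of 0 \<infinity> F f "exp (2 * c)" "exp (- 2 * c) + exp (2 * c)"] dF
    by (simp add: f_def zero_ereal_def)
  then show ?thesis
    by (simp add: f_def interval_lebesgue_integral_def einterval_def greaterThan_def)
qed

text \<open>The standard normal characteristic function, rescaled by
  \<open>r = sqrt (2 * s)\<close>.\<close>

lemma gaussian_fourier_real:
  fixes t s :: real
  assumes "s > 0"
  shows "integrable lborel (\<lambda>x. iexp (t * x) * complex_of_real (exp (- s * x\<^sup>2)))"
    and "(CLINT x|lborel. iexp (t * x) * complex_of_real (exp (- s * x\<^sup>2)))
      = complex_of_real (sqrt (pi / s) * exp (- t\<^sup>2 / (4 * s)))"
proof -
  define r where "r = sqrt (2 * s)"
  have r: "r > 0" "r\<^sup>2 = 2 * s" using assms by (auto simp: r_def)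
  interpret N: real_distribution std_normal_distribution by (rule real_dist_normal_dist)
  let ?f = "\<lambda>x. std_normal_density x *\<^sub>R iexp (t / r * x)"
  have int: "integrable lborel ?f"
  proof -
    have "integrable std_normal_distribution (\<lambda>x. iexp (t / r * x))"
      by (rule N.integrable_iexp) auto
    then show ?thesis by (subst (asm) integrable_density) auto
  qed
  have val: "integral\<^sup>L lborel ?f = complex_of_real (exp (- (t / r)\<^sup>2 / 2))"
    using fun_cong[OF char_std_normal_distribution, of "t / r"] unfolding char_def
    by (subst (asm) integral_density) auto
  have eq0: "iexp (t * x) * complex_of_real (exp (- s * x\<^sup>2)) = sqrt (2 * pi) *\<^sub>R ?f (0 + r * x)" for x
  proof -
    have "sqrt (2 * pi) * std_normal_density (r * x) = exp (- s * x\<^sup>2)"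
      by (simp add: std_normal_density_def power_mult_distrib r)
    moreover have "?f (0 + r * x) = std_normal_density (r * x) *\<^sub>R iexp (t * x)"
      using r(1) by simp
    ultimately show ?thesis
      by (simp only: scaleR_scaleR) (simp add: scaleR_conv_of_real mult.commute)
  qed
  have eq: "(\<lambda>x. iexp (t * x) * complex_of_real (exp (- s * x\<^sup>2)))
      = (\<lambda>x. sqrt (2 * pi) *\<^sub>R ?f (0 + r * x))" by (intro ext eq0)
  show "integrable lborel (\<lambda>x. iexp (t * x) * complex_of_real (exp (- s * x\<^sup>2)))"
    unfolding eq using lborel_integrable_real_affine[OF int, of r 0] r(1)
    by (intro integrable_scaleR_right) simp
  have "(CLINT x|lborel. iexp (t * x) * complex_of_real (exp (- s * x\<^sup>2)))
      = sqrt (2 * pi) *\<^sub>R (CLINT x|lborel. ?f (0 + r * x))"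
    unfolding eq by (rule integral_scaleR_right)
  also have "(CLINT x|lborel. ?f (0 + r * x)) = (1 / r) *\<^sub>R integral\<^sup>L lborel ?f"
    using lborel_integral_real_affine[of r ?f 0] r(1) by (simp only:) simp
  also have "sqrt (2 * pi) *\<^sub>R (1 / r) *\<^sub>R integral\<^sup>L lborel ?f
      = complex_of_real (sqrt (2 * pi) / r * exp (- (t / r)\<^sup>2 / 2))"
    unfolding val by (simp add: scaleR_conv_of_real)
  also have "sqrt (2 * pi) / r = sqrt (pi / s)"
    unfolding r_def using assms by (simp add: real_sqrt_divide[symmetric])
  also have "- (t / r)\<^sup>2 / 2 = - t\<^sup>2 / (4 * s)" by (simp add: power_divide r)
  finally show "(CLINT x|lborel. iexp (t * x) * complex_of_real (exp (- s * x\<^sup>2)))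
      = complex_of_real (sqrt (pi / s) * exp (- t\<^sup>2 / (4 * s)))" .
qed

text \<open>Both \<open>\<theta> \<bullet> x\<close> and the squared norm are sums over coordinates,
  so the integrand is a product and Lebesgue measure factorises.\<close>

lemma gaussian_fourier:
  fixes \<theta> :: "'b::euclidean_space" and s :: real
  assumes "s > 0"
  shows "(CLINT x|lborel. iexp (\<theta> \<bullet> x) * complex_of_real (exp (- s * (norm x)\<^sup>2)))
      = complex_of_real ((pi / s) powr (DIM('b) / 2) * exp (- (norm \<theta>)\<^sup>2 / (4 * s)))"
proof -
  interpret product_sigma_finite "\<lambda>_::'b. lborel :: real measure" ..
  let ?g = "\<lambda>b y. iexp ((\<theta> \<bullet> b) * y) * complex_of_real (exp (- s * y\<^sup>2))"
  have eq: "iexp (\<theta> \<bullet> (\<Sum>b\<in>Basis. f b *\<^sub>R b)) * complex_of_real (exp (- s * (norm (\<Sum>b\<in>Basis. f b *\<^sub>R b))\<^sup>2))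
      = (\<Prod>b\<in>Basis. ?g b (f b))" for f :: "'b \<Rightarrow> real"
  proof -
    have "(norm (\<Sum>b\<in>Basis. f b *\<^sub>R b))\<^sup>2 = (\<Sum>b\<in>Basis. (f b)\<^sup>2)"
      by (subst norm_sum_Pythagorean) (auto simp: pairwise_def orthogonal_def inner_Basis power_mult_distrib)
    moreover have "\<theta> \<bullet> (\<Sum>b\<in>Basis. f b *\<^sub>R b) = (\<Sum>b\<in>Basis. (\<theta> \<bullet> b) * f b)"
      by (simp add: inner_sum_right mult.commute)
    ultimately show ?thesis
      by (simp add: prod.distrib exp_sum sum_distrib_left sum_negf[symmetric])
  qed
  have "(CLINT x|lborel. iexp (\<theta> \<bullet> x) * complex_of_real (exp (- s * (norm x)\<^sup>2)))
      = (CLINT f|(\<Pi>\<^sub>M b\<in>(Basis :: 'b set). lborel). \<Prod>b\<in>Basis. ?g b (f b))"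
    by (subst lborel_eq, subst integral_distr) (simp, simp, simp only: eq)
  also have "\<dots> = (\<Prod>b\<in>Basis. integral\<^sup>L lborel (?g b))"
    by (rule product_integral_prod) (use gaussian_fourier_real[OF assms] in auto)
  also have "\<dots> = (\<Prod>b\<in>(Basis :: 'b set). complex_of_real (sqrt (pi / s) * exp (- (\<theta> \<bullet> b)\<^sup>2 / (4 * s))))"
    unfolding gaussian_fourier_real(2)[OF assms] ..
  also have "\<dots> = complex_of_real (sqrt (pi / s) ^ DIM('b) * exp (- (\<Sum>b\<in>Basis. (\<theta> \<bullet> b)\<^sup>2) / (4 * s)))"
    unfolding of_real_prod[symmetric]
    by (simp add: prod.distrib exp_sum[symmetric] sum_negf sum_divide_distrib[symmetric])
  also have "(\<Sum>b\<in>Basis. (\<theta> \<bullet> b)\<^sup>2) = (norm \<theta>)\<^sup>2"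
    unfolding power2_norm_eq_inner by (subst (2) euclidean_inner) (simp add: power2_eq_square)
  also have "sqrt (pi / s) ^ DIM('b) = (pi / s) powr (DIM('b) / 2)"
    using assms by (simp add: powr_half_sqrt[symmetric] powr_powr powr_realpow[symmetric])
  finally show ?thesis .
qed

lemma nn_integral_gamma_scaled:
  assumes "a > 0" "m > (0::real)"
  shows "(\<integral>\<^sup>+s. ennreal (indicator {0<..} s * (s powr (m - 1) * exp (- s * a))) \<partial>lborel)
    = ennreal (Gamma m * a powr (- m))"
proof -
  let ?f = "\<lambda>s. ennreal (indicator {0..} s * (s powr (m - 1) / exp s))"
  have eq: "ennreal (indicator {0<..} s * (s powr (m - 1) * exp (- s * a)))
      = ennreal (a powr (1 - m)) * ?f (0 + a * s)" if "s \<noteq> 0" for s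
  proof (cases "s > 0")
    case True
    have "a powr (1 - m) * ((a * s) powr (m - 1) / exp (a * s)) = s powr (m - 1) * exp (- s * a)"
      using True assms by (simp add: powr_mult powr_diff exp_minus field_simps powr_minus)
    then show ?thesis using True assms by (simp add: ennreal_mult[symmetric] indicator_def)
  next
    case False
    then show ?thesis using that assms by (auto simp: indicator_def zero_le_mult_iff)
  qed
  have "(\<integral>\<^sup>+s. ennreal (indicator {0<..} s * (s powr (m - 1) * exp (- s * a))) \<partial>lborel)
      = (\<integral>\<^sup>+s. ennreal (a powr (1 - m)) * ?f (0 + a * s) \<partial>lborel)"
  proof (rule nn_integral_cong_AE)
    show "AE s in lborel. ennreal (indicator {0<..} s * (s powr (m - 1) * exp (- s * a)))
        = ennreal (a powr (1 - m)) * ?f (0 + a * s)"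
      using AE_lborel_singleton[of "0::real"] by eventually_elim (rule eq)
  qed
  also have "\<dots> = ennreal (a powr (1 - m)) * (\<integral>\<^sup>+s. ?f (0 + a * s) \<partial>lborel)"
    by (rule nn_integral_cmult) measurable
  also have "(\<integral>\<^sup>+s. ?f (0 + a * s) \<partial>lborel) = ennreal (1 / a) * (\<integral>\<^sup>+s. ?f s \<partial>lborel)"
    using assms by (subst nn_integral_real_affine[of ?f a 0])
      (auto simp: mult.assoc[symmetric] ennreal_mult[symmetric])
  also have "(\<integral>\<^sup>+s. ?f s \<partial>lborel) = ennreal (Gamma m)"
    using Gamma_conv_nn_integral_real[OF assms(2)] by (simp add: mult.assoc)
  also have "ennreal (a powr (1 - m)) * (ennreal (1 / a) * ennreal (Gamma m)) = ennreal (Gamma m * a powr (- m))"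
    using assms Gamma_real_pos[of m] by (simp add: ennreal_mult[symmetric] powr_diff powr_minus field_simps)
  finally show ?thesis .
qed

text \<open>By the Gamma integral, the Cauchy density is a mixture of Gaussians \<open>exp (- s |x|\<^sup>2)\<close>.\<close>

lemma char_vec_cauchy_law:
  fixes \<theta> :: "real^'n"
  assumes "prob_space (cauchy_law :: (real^'n) measure)"
  shows "char_vec cauchy_law \<theta> = complex_of_real (exp (- norm \<theta>))"
\<comment> \<open>The one-dimensional integral used at the end requires a positive parameter, here
  \<open>norm \<theta> / 2\<close>.\<close>
proof (cases "\<theta> = 0")
  case True
  interpret prob_space "cauchy_law :: (real^'n) measure" by fact
  show ?thesis using True by (simp add: char_vec_def prob_space)
next
  case False
  interpret prob_space "cauchy_law :: (real^'n) measure" by fact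
  define m where "m = (1 + real CARD('n)) / 2"
  have m: "m > 0" "m \<ge> 1" by (simp_all add: m_def)
  define k where "k s x = pi powr (- m) * (indicator {0<..} s * (s powr (m - 1) * exp (- s * (1 + (norm x)\<^sup>2))))"
    for s and x :: "real^'n"
  have k_nonneg: "k s x \<ge> 0" for s x by (simp add: k_def)
  have [measurable]: "(\<lambda>(x, s). k s x) \<in> borel_measurable (borel \<Otimes>\<^sub>M borel)"
    "(\<lambda>(s, x). k s x) \<in> borel_measurable (borel \<Otimes>\<^sub>M borel)" for s
    unfolding k_def by measurable
  have [measurable]: "k s \<in> borel_measurable borel" "(\<lambda>s. k s x) \<in> borel_measurable borel" for s x
    unfolding k_def by measurable
  define \<rho> where "\<rho> x = Gamma m * pi powr (- m) * (1 + (norm x)\<^sup>2) powr (- m)" for x :: "real^'n"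
  have \<rho>_nonneg: "\<rho> x \<ge> 0" for x using Gamma_real_pos[OF m(1)] by (simp add: \<rho>_def)
  have [measurable]: "\<rho> \<in> borel_measurable borel" unfolding \<rho>_def by measurable
  have cauchy: "cauchy_law = density lborel (\<lambda>x. ennreal (\<rho> x))"
    by (simp add: cauchy_law_def \<rho>_def m_def)
  have mix: "(\<integral>\<^sup>+s. ennreal (k s x) \<partial>lborel) = ennreal (\<rho> x)" for x
  proof -
    have "1 + (norm x)\<^sup>2 > 0" by (simp add: add_pos_nonneg)
    then show ?thesis
      unfolding k_def \<rho>_def using nn_integral_gamma_scaled[of "1 + (norm x)\<^sup>2" m] m
      by (simp add: ennreal_mult' nn_integral_cmult) (simp add: ennreal_mult'[symmetric] mult_ac)
  qed
  have "has_bochner_integral lborel (\<lambda>s. k s x) (\<rho> x)" for x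
    by (rule has_bochner_integral_nn_integral) (use mix k_nonneg \<rho>_nonneg in auto)
  then have mix_int: "integrable lborel (\<lambda>s. k s x)" "(LBINT s. k s x) = \<rho> x" for x
    by (auto simp: has_bochner_integral_iff)
  let ?f = "\<lambda>(x, s). k s x *\<^sub>R iexp (\<theta> \<bullet> x)"
  have int: "integrable (lborel \<Otimes>\<^sub>M lborel) ?f"
  proof (rule integrableI_bounded)
    have "(\<integral>\<^sup>+z. ennreal (norm (?f z)) \<partial>(lborel \<Otimes>\<^sub>M lborel))
        = (\<integral>\<^sup>+x. \<integral>\<^sup>+s. ennreal (k s x) \<partial>lborel \<partial>lborel)"
      by (subst lborel.nn_integral_fst[symmetric]) (auto simp: k_nonneg norm_mult split_beta')
    \<comment> \<open>Integrability for Fubini comes from the finite total mass of the law, so its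
      normalising constant never has to be computed.\<close>
    also have "\<dots> = emeasure cauchy_law (UNIV :: (real^'n) set)"
      unfolding mix cauchy by (subst emeasure_density) auto
    also have "\<dots> < \<infinity>" by (simp add: less_top[symmetric])
    finally show "(\<integral>\<^sup>+z. ennreal (norm (?f z)) \<partial>(lborel \<Otimes>\<^sub>M lborel)) < \<infinity>" .
  qed measurable
  have "char_vec cauchy_law \<theta> = (CLINT x|lborel. \<rho> x *\<^sub>R iexp (\<theta> \<bullet> x))"
    unfolding char_vec_def cauchy by (rule integral_density) (auto simp: \<rho>_nonneg)
  also have "\<dots> = (CLINT x|lborel. CLINT s|lborel. k s x *\<^sub>R iexp (\<theta> \<bullet> x))"
    by (rule Bochner_Integration.integral_cong)
       (simp_all only: integral_scaleR_left[OF mix_int(1)] mix_int(2))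
  also have "\<dots> = (CLINT s|lborel. CLINT x|lborel. k s x *\<^sub>R iexp (\<theta> \<bullet> x))"
    by (rule lborel_pair.Fubini_integral[symmetric]) (use int in simp)
  also have "\<dots> = (CLINT s|lborel. complex_of_real (indicator {0<..} s * (exp (- s - (norm \<theta> / 2)\<^sup>2 / s) / sqrt (pi * s))))"
  proof (rule Bochner_Integration.integral_cong)
    fix s :: real
    show "(CLINT x|lborel. k s x *\<^sub>R iexp (\<theta> \<bullet> x))
        = complex_of_real (indicator {0<..} s * (exp (- s - (norm \<theta> / 2)\<^sup>2 / s) / sqrt (pi * s)))"
    proof (cases "s > 0")
      case True
      have "k s x *\<^sub>R iexp (\<theta> \<bullet> x) = complex_of_real (pi powr (- m) * s powr (m - 1) * exp (- s))
          * (iexp (\<theta> \<bullet> x) * complex_of_real (exp (- s * (norm x)\<^sup>2)))" for x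
      proof -
        have "exp (- s * (1 + (norm x)\<^sup>2)) = exp (- s) * exp (- s * (norm x)\<^sup>2)"
          by (simp add: exp_add[symmetric] algebra_simps)
        then show ?thesis using True by (simp add: k_def scaleR_conv_of_real)
      qed
      then have "(CLINT x|lborel. k s x *\<^sub>R iexp (\<theta> \<bullet> x))
          = complex_of_real (pi powr (- m) * s powr (m - 1) * exp (- s)
            * ((pi / s) powr (CARD('n) / 2) * exp (- (norm \<theta>)\<^sup>2 / (4 * s))))"
        using gaussian_fourier[OF True, of \<theta>] by simp
      also have "pi powr (- m) * s powr (m - 1) * exp (- s)
            * ((pi / s) powr (CARD('n) / 2) * exp (- (norm \<theta>)\<^sup>2 / (4 * s)))
          = (pi powr (- m) * pi powr (CARD('n) / 2)) * (s powr (m - 1) * s powr (- (CARD('n) / 2)))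
            * (exp (- s) * exp (- (norm \<theta>)\<^sup>2 / (4 * s)))"
        using True by (simp add: powr_divide powr_minus field_simps)
      \<comment> \<open>Since \<open>m = (1 + d) / 2\<close> for dimension \<open>d\<close>, both
        exponents \<open>- m + d / 2\<close> and \<open>m - 1 - d / 2\<close> equal
        \<open>- 1 / 2\<close>: the dimension disappears.\<close>
      also have "pi powr (- m) * pi powr (CARD('n) / 2) = 1 / sqrt pi"
        unfolding powr_add[symmetric] by (simp add: m_def field_simps powr_minus powr_half_sqrt[symmetric])
      also have "s powr (m - 1) * s powr (- (CARD('n) / 2)) = 1 / sqrt s"
        unfolding powr_add[symmetric] using True
        by (simp add: m_def field_simps powr_minus powr_half_sqrt[symmetric])
      also have "exp (- s) * exp (- (norm \<theta>)\<^sup>2 / (4 * s)) = exp (- s - (norm \<theta> / 2)\<^sup>2 / s)"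
        by (simp add: exp_add[symmetric] power_divide)
      finally show ?thesis using True by (simp add: real_sqrt_mult)
    qed (simp add: k_def)
  qed simp
  also have "\<dots> = complex_of_real (LBINT s:{0<..}. exp (- s - (norm \<theta> / 2)\<^sup>2 / s) / sqrt (pi * s))"
    unfolding set_lebesgue_integral_def by (simp del: of_real_mult of_real_divide)
  also have "\<dots> = complex_of_real (exp (- norm \<theta>))"
    using integral_inverse_sqrt_exp[of "norm \<theta> / 2"] False by simp
  finally show ?thesis .
qed

section \<open>The limit vector\<close>

text \<open>For \<open>y\<close> the image of \<open>x\<close> under the transpose, the squared norm
  of \<open>y\<close> is \<open>x \<bullet> (A *v y)\<close>.\<close>

lemma norm_transpose_mult_le:
  fixes A :: "real^'n^'m"
  shows "norm (transpose A *v x) \<le> norm A * norm x"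
proof -
  let ?y = "transpose A *v x"
  have "norm ?y * norm ?y = x \<bullet> (A *v ?y)"
    by (simp add: power2_norm_eq_inner[symmetric, unfolded power2_eq_square] dot_lmul_matrix[symmetric]
        transpose_matrix_vector)
  also have "\<dots> \<le> norm x * (norm A * norm ?y)"
    by (intro order_trans[OF norm_cauchy_schwarz] mult_left_mono norm_matrix_vector_mult_le) simp
  finally have "norm ?y * norm ?y \<le> (norm A * norm x) * norm ?y" by (simp add: mult_ac)
  then show ?thesis by (cases "?y = 0") (auto simp: mult_le_cancel_right)
qed

lemma spectral_measure_facts:
  fixes \<Lambda> :: "(real^'n) measure"
  assumes "spectral_measure \<alpha> \<nu> \<Lambda>" "\<alpha> > 0"
  shows "integrable \<Lambda> (\<lambda>x. \<bar>\<theta> \<bullet> x\<bar> powr \<alpha>)"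
    and "(\<integral>x. \<bar>\<theta> \<bullet> x\<bar> powr \<alpha> \<partial>\<Lambda>) \<le> norm \<theta> powr \<alpha> * measure \<Lambda> (space \<Lambda>)"
    and "x \<in> space \<Lambda> \<Longrightarrow> \<bar>\<theta> \<bullet> x\<bar> powr \<alpha> \<le> norm \<theta> powr \<alpha>"
proof -
  have sets: "sets \<Lambda> = sets (restrict_space borel (sphere 0 1))" and "finite_measure \<Lambda>"
    using assms by (auto simp: spectral_measure_def)
  interpret finite_measure \<Lambda> by fact
  have space: "space \<Lambda> = sphere 0 1"
    using sets_eq_imp_space_eq[OF sets] by (simp add: space_restrict_space)
  show le: "\<bar>\<theta> \<bullet> x\<bar> powr \<alpha> \<le> norm \<theta> powr \<alpha>" if "x \<in> space \<Lambda>" for x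
    using that assms(2) Cauchy_Schwarz_ineq2[of \<theta> x] by (intro powr_mono2) (auto simp: space)
  have "(\<lambda>x. \<bar>\<theta> \<bullet> x\<bar> powr \<alpha>) \<in> borel_measurable (restrict_space borel (sphere 0 1))"
    by (rule measurable_restrict_space1) simp
  then have "(\<lambda>x. \<bar>\<theta> \<bullet> x\<bar> powr \<alpha>) \<in> borel_measurable \<Lambda>"
    using measurable_cong_sets[OF sets refl] by blast
  then show int: "integrable \<Lambda> (\<lambda>x. \<bar>\<theta> \<bullet> x\<bar> powr \<alpha>)"
    by (rule integrable_const_bound[of _ "norm \<theta> powr \<alpha>", rotated]) (auto intro!: AE_I2 le)
  have "(\<integral>x. \<bar>\<theta> \<bullet> x\<bar> powr \<alpha> \<partial>\<Lambda>) \<le> (\<integral>x. norm \<theta> powr \<alpha> \<partial>\<Lambda>)"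
    by (intro integral_mono int le) auto
  then show "(\<integral>x. \<bar>\<theta> \<bullet> x\<bar> powr \<alpha> \<partial>\<Lambda>) \<le> norm \<theta> powr \<alpha> * measure \<Lambda> (space \<Lambda>)"
    by (simp add: mult.commute)
qed

text \<open>The product is the exponential of a partial sum of integrals. Sum and integral may be
  exchanged because, on the unit sphere, the terms are dominated by a geometric series of ratio
  \<open>\<rho> powr \<alpha>\<close> and the spectral measure is finite.\<close>

lemma prod_char_tendsto_limit_char:
  fixes P :: "real^'n^'n"
  assumes \<Lambda>: "spectral_measure \<alpha> \<nu> \<Lambda>" "\<alpha> > 0" and P: "spectral_radius P < 1"
  shows "(\<lambda>r. \<Prod>j<r. char_vec \<nu> (transpose (matpow P j) *v \<theta>)) \<longlonglongrightarrow> limit_char \<alpha> \<Lambda> P \<theta>"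
proof -
  obtain C \<rho> where C: "0 < \<rho>" "\<rho> < 1" "\<And>k. norm (matpow P k) \<le> C * \<rho> ^ k"
    by (rule matpow_geometric_decay[OF P], rule that)
  have "C \<ge> 0" using order_trans[OF norm_ge_zero C(3)[of 0]] by simp
  define f where "f j x = \<bar>(transpose (matpow P j) *v \<theta>) \<bullet> x\<bar> powr \<alpha>" for j x
  define b where "b j = (C * norm \<theta>) powr \<alpha> * (\<rho> powr \<alpha>) ^ j" for j :: nat
  have b: "norm (transpose (matpow P j) *v \<theta>) powr \<alpha> \<le> b j" for j
  proof -
    have "norm (transpose (matpow P j) *v \<theta>) \<le> (C * norm \<theta>) * \<rho> ^ j"
      using mult_right_mono[OF C(3)[of j], of "norm \<theta>"] norm_transpose_mult_le[of "matpow P j" \<theta>]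
      by (simp add: mult_ac)
    then have "norm (transpose (matpow P j) *v \<theta>) powr \<alpha> \<le> ((C * norm \<theta>) * \<rho> ^ j) powr \<alpha>"
      using \<Lambda>(2) by (intro powr_mono2) auto
    also have "\<dots> = b j"
      using C \<open>C \<ge> 0\<close> by (simp add: b_def powr_mult powr_powr powr_realpow[symmetric] mult.commute)
    finally show ?thesis .
  qed
  have "\<rho> powr \<alpha> < 1" using C \<Lambda>(2) powr_less_mono2[of \<alpha> \<rho> 1] by simp
  then have "summable b"
    unfolding b_def by (intro summable_mult summable_geometric) simp
  note int = spectral_measure_facts[OF \<Lambda>]
  have int_f: "integrable \<Lambda> (f j)" for j unfolding f_def by (rule int)
  have f0: "0 \<le> f j x" for j x by (simp add: f_def)
  have "(\<lambda>j. \<integral>x. f j x \<partial>\<Lambda>) sums (\<integral>x. (\<Sum>j. f j x) \<partial>\<Lambda>)"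
  proof (rule sums_integral[OF int_f])
    show "AE x in \<Lambda>. summable (\<lambda>j. norm (f j x))"
    proof (rule AE_I2)
      fix x assume "x \<in> space \<Lambda>"
      then have "norm (f j x) \<le> b j" for j
        using order_trans[OF int(3) b] by (simp add: f_def)
      then show "summable (\<lambda>j. norm (f j x))"
        by (intro summable_comparison_test'[OF \<open>summable b\<close>]) auto
    qed
    have "norm (\<integral>x. norm (f j x) \<partial>\<Lambda>) \<le> b j * measure \<Lambda> (space \<Lambda>)" for j
    proof -
      have "norm (\<integral>x. norm (f j x) \<partial>\<Lambda>) = (\<integral>x. f j x \<partial>\<Lambda>)"
        using f0 by simp
      also have "\<dots> \<le> norm (transpose (matpow P j) *v \<theta>) powr \<alpha> * measure \<Lambda> (space \<Lambda>)"
        unfolding f_def by (rule int)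
      also have "\<dots> \<le> b j * measure \<Lambda> (space \<Lambda>)" by (intro mult_right_mono b) simp
      finally show ?thesis .
    qed
    then show "summable (\<lambda>j. \<integral>x. norm (f j x) \<partial>\<Lambda>)"
      by (intro summable_comparison_test'[OF summable_mult2[OF \<open>summable b\<close>]])
  qed
  then have "(\<lambda>r. complex_of_real (exp (- (\<Sum>j<r. \<integral>x. f j x \<partial>\<Lambda>))))
      \<longlonglongrightarrow> complex_of_real (exp (- (\<integral>x. (\<Sum>j. f j x) \<partial>\<Lambda>)))"
    unfolding sums_def by (intro tendsto_intros)
  moreover have "complex_of_real (exp (- (\<Sum>j<r. \<integral>x. f j x \<partial>\<Lambda>)))
      = (\<Prod>j<r. char_vec \<nu> (transpose (matpow P j) *v \<theta>))" for r
    using \<Lambda>(1) by (simp add: spectral_measure_def f_def exp_sum sum_negf[symmetric])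
  ultimately show ?thesis by (simp add: limit_char_def f_def)
qed

text \<open>Averaging the characteristic function over a Gaussian frequency turns it into
  \<open>\<integral> exp (- X\<^sup>2 / (2 a\<^sup>2))\<close>, whose defect from 1 controls the tail.\<close>

lemma (in prob_space) tail_bound_of_characteristic:
  fixes X :: "'a \<Rightarrow> real"
  assumes [measurable]: "X \<in> borel_measurable M"
    and chars: "\<And>t. (CLINT w|M. iexp (t * X w)) = complex_of_real (exp (- (\<sigma> * \<bar>t\<bar> powr \<alpha>)))"
    and "0 < \<alpha>" "\<alpha> \<le> 2" "\<sigma> \<ge> 0" "a > 0"
  shows "prob {w \<in> space M. \<bar>X w\<bar> > a} * (1 - exp (- 1 / 2)) \<le> 2 * \<sigma> * a powr (- \<alpha>)"
proof -
  let ?N = "std_normal_distribution"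
  interpret N: real_distribution ?N by (rule real_dist_normal_dist)
  interpret MN: pair_prob_space M ?N ..
  let ?D = "{w \<in> space M. \<bar>X w\<bar> > a}"
  let ?g = "\<lambda>w. exp (- (X w / a)\<^sup>2 / 2)"
  have inner_N: "(CLINT y|?N. iexp (y * (X w / a))) = complex_of_real (?g w)" for w
    using fun_cong[OF char_std_normal_distribution, of "X w / a"]
    unfolding char_def by (simp add: mult.commute)
  have inner_M: "(CLINT w|M. iexp (y * (X w / a)))
      = complex_of_real (exp (- (\<sigma> * a powr (- \<alpha>) * \<bar>y\<bar> powr \<alpha>)))" for y
    using chars[of "y / a"] \<open>a > 0\<close> by (simp add: powr_divide powr_minus field_simps)
  have "integrable (M \<Otimes>\<^sub>M ?N) (\<lambda>(w, y). iexp (y * (X w / a)))"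
    by (rule MN.P.integrable_const_bound[where B = 1]) auto
  then have "(CLINT y|?N. CLINT w|M. iexp (y * (X w / a))) = (CLINT w|M. CLINT y|?N. iexp (y * (X w / a)))"
    by (rule MN.Fubini_integral)
  then have eq: "(\<integral>y. exp (- (\<sigma> * a powr (- \<alpha>) * \<bar>y\<bar> powr \<alpha>)) \<partial>?N) = (\<integral>w. ?g w \<partial>M)"
    unfolding inner_N inner_M integral_complex_of_real of_real_eq_iff .
  have int_g: "integrable M ?g"
    by (rule integrable_const_bound[where B = 1]) auto
  have int_y2: "integrable ?N (\<lambda>y. y\<^sup>2)" "(\<integral>y. y\<^sup>2 \<partial>?N) = 1"
    using integrable_std_normal_distribution_moment[of 2] std_normal_distribution_even_moments(1)[of 1]
    by simp_all
  \<comment> \<open>Markov's inequality for \<open>1 - ?g\<close>, which on \<open>?D\<close> is at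
    least \<open>1 - exp (- 1 / 2)\<close>.\<close>
  have "prob ?D * (1 - exp (- 1 / 2)) = (\<integral>w. indicator ?D w * (1 - exp (- 1 / 2)) \<partial>M)"
    by simp
  also have "\<dots> \<le> (\<integral>w. 1 - ?g w \<partial>M)"
  proof (rule integral_mono)
    show "integrable M (\<lambda>w. indicator ?D w * (1 - exp (- 1 / 2) :: real))"
      by (rule integrable_const_bound[where B = 1]) (auto simp: indicator_def)
    show "integrable M (\<lambda>w. 1 - ?g w)" using int_g by simp
    fix w
    have "exp (- (X w / a)\<^sup>2 / 2) \<le> exp (- 1 / 2)" if "\<bar>X w\<bar> > a"
    proof -
      have "1 \<le> \<bar>X w / a\<bar>" using that \<open>a > 0\<close> by simp
      then have "1 \<le> (X w / a)\<^sup>2" using power_mono[of 1 "\<bar>X w / a\<bar>" 2] unfolding power2_abs by simp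
      then show ?thesis by simp
    qed
    then show "indicator ?D w * (1 - exp (- 1 / 2)) \<le> 1 - ?g w"
      by (auto simp: indicator_def)
  qed
  also have "\<dots> = 1 - (\<integral>y. exp (- (\<sigma> * a powr (- \<alpha>) * \<bar>y\<bar> powr \<alpha>)) \<partial>?N)"
    unfolding eq using int_g by (simp add: prob_space)
  also have "\<dots> = (\<integral>y. 1 - exp (- (\<sigma> * a powr (- \<alpha>) * \<bar>y\<bar> powr \<alpha>)) \<partial>?N)"
  proof -
    have "integrable ?N (\<lambda>y. exp (- (\<sigma> * a powr (- \<alpha>) * \<bar>y\<bar> powr \<alpha>)))"
      by (rule N.integrable_const_bound[of _ 1]) (use \<open>\<sigma> \<ge> 0\<close> in auto)
    then show ?thesis using N.prob_space by simp
  qed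
  \<comment> \<open>Uses \<open>1 - exp (- t) \<le> t\<close> and
    \<open>\<bar>y\<bar> powr \<alpha> \<le> 1 + y^2\<close>, valid for every \<alpha> in (0,2]; the
    Gaussian mean of \<open>1 + y^2\<close> is the factor 2 of the claim.\<close>
  also have "\<dots> \<le> (\<integral>y. \<sigma> * a powr (- \<alpha>) * (1 + y\<^sup>2) \<partial>?N)"
  proof (rule integral_mono)
    show "integrable ?N (\<lambda>y. 1 - exp (- (\<sigma> * a powr (- \<alpha>) * \<bar>y\<bar> powr \<alpha>)))"
      by (rule N.integrable_const_bound[of _ 1]) (use \<open>\<sigma> \<ge> 0\<close> in auto)
    show "integrable ?N (\<lambda>y. \<sigma> * a powr (- \<alpha>) * (1 + y\<^sup>2))" using int_y2 by simp
    fix y :: real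
    have "\<bar>y\<bar> powr \<alpha> \<le> 1 + y\<^sup>2"
    proof (cases "\<bar>y\<bar> \<le> 1")
      case True
      then have "\<bar>y\<bar> powr \<alpha> \<le> 1 powr \<alpha>" using \<open>0 < \<alpha>\<close> by (intro powr_mono2) auto
      then show ?thesis by (simp add: add_increasing2)
    next
      case False
      then have "\<bar>y\<bar> powr \<alpha> \<le> \<bar>y\<bar> powr 2" using \<open>\<alpha> \<le> 2\<close> by (intro powr_mono) auto
      then show ?thesis using False by simp
    qed
    then have "\<sigma> * a powr (- \<alpha>) * \<bar>y\<bar> powr \<alpha> \<le> \<sigma> * a powr (- \<alpha>) * (1 + y\<^sup>2)"
      using \<open>\<sigma> \<ge> 0\<close> by (intro mult_left_mono) auto
    then show "1 - exp (- (\<sigma> * a powr (- \<alpha>) * \<bar>y\<bar> powr \<alpha>)) \<le> \<sigma> * a powr (- \<alpha>) * (1 + y\<^sup>2)"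
      using exp_ge_add_one_self[of "- (\<sigma> * a powr (- \<alpha>) * \<bar>y\<bar> powr \<alpha>)"] by linarith
  qed
  also have "\<dots> = 2 * \<sigma> * a powr (- \<alpha>)"
    using int_y2 N.prob_space by simp
  finally show ?thesis .
qed

text \<open>Along an axis the characteristic function has the form
  \<open>exp (- (\<sigma> * \<bar>t\<bar> powr \<alpha>))\<close>, so each coordinate has the
  one-dimensional tail. If all coordinates are at most \<open>a / CARD('n)\<close>, then the
  l1-norm, hence the norm, is at most \<open>a\<close>; a union bound concludes.\<close>

lemma spectral_tail_bound:
  fixes \<nu> :: "(real^'n) measure"
  assumes "prob_space \<nu>" and sets[measurable_cong]: "sets \<nu> = sets borel"
    and \<Lambda>: "spectral_measure \<alpha> \<nu> \<Lambda>" and \<alpha>: "0 < \<alpha>" "\<alpha> \<le> 2"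
  obtains K where "\<And>a. a > 0 \<Longrightarrow> measure \<nu> {x. norm x > a} \<le> K * a powr (- \<alpha>)"
proof -
  interpret prob_space \<nu> by fact
  have space: "space \<nu> = UNIV" using sets_eq_imp_space_eq[OF sets] by simp
  define \<sigma> where "\<sigma> i = (\<integral>x. \<bar>axis i 1 \<bullet> x\<bar> powr \<alpha> \<partial>\<Lambda>)" for i :: 'n
  have \<sigma>0: "\<sigma> i \<ge> 0" for i by (simp add: \<sigma>_def)
  define q where "q = 1 - exp (- 1 / 2 :: real)"
  have "q > 0" by (simp add: q_def)
  have coord: "measure \<nu> {x. \<bar>x $ i\<bar> > a} \<le> (2 * \<sigma> i / q) * a powr (- \<alpha>)" if "a > 0" for a i
  proof -
    have "(CLINT x|\<nu>. iexp (t * (x $ i))) = complex_of_real (exp (- (\<sigma> i * \<bar>t\<bar> powr \<alpha>)))" for t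
    proof -
      have "(\<integral>x. \<bar>(t *\<^sub>R axis i 1) \<bullet> x\<bar> powr \<alpha> \<partial>\<Lambda>) = (\<integral>x. \<bar>t\<bar> powr \<alpha> * \<bar>axis i 1 \<bullet> x\<bar> powr \<alpha> \<partial>\<Lambda>)"
        by (simp add: abs_mult powr_mult)
      also have "\<dots> = \<sigma> i * \<bar>t\<bar> powr \<alpha>" by (simp add: \<sigma>_def)
      finally have "char_vec \<nu> (t *\<^sub>R axis i 1) = complex_of_real (exp (- (\<sigma> i * \<bar>t\<bar> powr \<alpha>)))"
        using \<Lambda> by (simp add: spectral_measure_def)
      then show ?thesis by (simp add: char_vec_def inner_axis')
    qed
    then have "prob {x \<in> space \<nu>. \<bar>x $ i\<bar> > a} * (1 - exp (- 1 / 2)) \<le> 2 * \<sigma> i * a powr (- \<alpha>)"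
      by (intro tail_bound_of_characteristic) (use \<alpha> \<sigma>0 that in auto)
    then show ?thesis
      using \<open>q > 0\<close> unfolding q_def[symmetric] by (simp add: space field_simps)
  qed
  define K where "K = (\<Sum>i\<in>UNIV. 2 * \<sigma> i / q) * real CARD('n) powr \<alpha>"
  show ?thesis
  proof (rule that[of K])
    fix a :: real assume "a > 0"
    let ?b = "a / CARD('n)"
    have "?b > 0" using \<open>a > 0\<close> by simp
    have "{x :: real^'n. norm x > a} \<subseteq> (\<Union>i. {x. \<bar>x $ i\<bar> > ?b})"
    proof (rule subsetI, rule ccontr)
      fix x :: "real^'n" assume x: "x \<in> {x. norm x > a}" "x \<notin> (\<Union>i. {x. \<bar>x $ i\<bar> > ?b})"
      then have "norm x \<le> (\<Sum>i\<in>(UNIV::'n set). ?b)"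
        by (intro order_trans[OF norm_le_l1_cart] sum_mono) (auto simp: not_less)
      then show False using x by simp
    qed
    then have "measure \<nu> {x. norm x > a} \<le> measure \<nu> (\<Union>i. {x. \<bar>x $ i\<bar> > ?b})"
      by (intro finite_measure_mono) auto
    also have "\<dots> \<le> (\<Sum>i\<in>UNIV. measure \<nu> {x. \<bar>x $ i\<bar> > ?b})"
      by (intro finite_measure_subadditive_finite) auto
    also have "\<dots> \<le> (\<Sum>i\<in>UNIV. (2 * \<sigma> i / q) * ?b powr (- \<alpha>))"
      by (intro sum_mono coord \<open>?b > 0\<close>)
    also have "\<dots> = K * a powr (- \<alpha>)"
    proof -
      have "?b powr (- \<alpha>) = real CARD('n) powr \<alpha> * a powr (- \<alpha>)"
        using \<open>a > 0\<close> by (simp add: powr_divide powr_minus field_simps)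
      then show ?thesis by (simp add: K_def sum_distrib_right mult.assoc)
    qed
    finally show "measure \<nu> {x. norm x > a} \<le> K * a powr (- \<alpha>)" .
  qed
qed

lemma ex_indep_vector_with_limit_char:
  fixes P :: "real^'n^'n" and \<nu> :: "(real^'n) measure"
  assumes "prob_space M" and \<nu>: "prob_space \<nu>"
    and \<Lambda>: "spectral_measure \<alpha> \<nu> \<Lambda>" and \<alpha>: "0 < \<alpha>" "\<alpha> \<le> 2"
    and P: "spectral_radius P < 1"
    and rich: "carries_iid_indep_of M \<nu> \<G>"
  shows "\<exists>Z. indep_vector_with_char M \<G> (limit_char \<alpha> \<Lambda> P) Z"
proof -
  interpret prob_space M by fact
  obtain \<xi> :: "nat \<Rightarrow> 'a \<Rightarrow> real^'n" where \<xi>: "indep_vars (\<lambda>_. borel) \<xi> UNIV"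
    "\<And>j. distr M borel (\<xi> j) = \<nu>"
    "indep_of M (Pi\<^sub>M UNIV (\<lambda>_. borel)) (\<lambda>w j. \<xi> j w) \<G>"
    using rich unfolding carries_iid_indep_of_def by blast
  have [measurable]: "\<xi> j \<in> borel_measurable M" for j
    using \<xi>(1) by (auto simp: indep_vars_def)
  have sets_\<nu>: "sets \<nu> = sets borel" using \<xi>(2)[of 0] by (metis sets_distr)
  obtain C \<rho> where C: "0 < \<rho>" "\<rho> < 1" "\<And>k. norm (matpow P k) \<le> C * \<rho> ^ k"
    by (rule matpow_geometric_decay[OF P], rule that)
  have "C \<ge> 0" using order_trans[OF norm_ge_zero C(3)[of 0]] by simp
  obtain K where K: "\<And>a. a > 0 \<Longrightarrow> measure \<nu> {x. norm x > a} \<le> K * a powr (- \<alpha>)"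
    using spectral_tail_bound[OF \<nu> sets_\<nu> \<Lambda> \<alpha>] by blast
  \<comment> \<open>The growth \<open>s ^ j\<close> allowed to \<open>\<xi> j\<close>:
    \<open>s > 1\<close> makes the tail probabilities summable, while
    \<open>\<rho> * s = sqrt \<rho> < 1\<close> keeps the series dominated by a geometric
    one.\<close>
  define s where "s = 1 / sqrt \<rho>"
  have s: "s > 1" "\<rho> * s = sqrt \<rho>" "sqrt \<rho> < 1"
    using C by (auto simp: s_def real_div_sqrt)
  have tail: "measure M {w \<in> space M. norm (\<xi> j w) > s ^ j} \<le> K * (s powr (- \<alpha>)) ^ j" for j
  proof -
    have "measure M {w \<in> space M. norm (\<xi> j w) > s ^ j} = measure (distr M borel (\<xi> j)) {x. norm x > s ^ j}"
      by (subst measure_distr) (auto intro!: arg_cong[where f = prob])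
    also have "\<dots> \<le> K * (s ^ j) powr (- \<alpha>)"
      unfolding \<xi>(2) by (rule K) (use s in simp)
    also have "(s ^ j) powr (- \<alpha>) = (s powr (- \<alpha>)) ^ j"
      using s(1) by (simp add: powr_realpow[symmetric] powr_powr mult.commute)
    finally show ?thesis .
  qed
  have "s powr (- \<alpha>) < 1" using s(1) \<alpha>(1) by (simp add: powr_less_one)
  then have "summable (\<lambda>j. K * (s powr (- \<alpha>)) ^ j)"
    by (intro summable_mult summable_geometric) simp
  then have "summable (\<lambda>j. measure M {w \<in> space M. norm (\<xi> j w) > s ^ j})"
    by (rule summable_comparison_test'[where N = 0]) (use tail in simp)
  then have "AE w in M. \<forall>\<^sub>F j in sequentially. w \<in> space M - {w \<in> space M. norm (\<xi> j w) > s ^ j}"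
    by (intro borel_cantelli_AE1) (auto simp: emeasure_eq_measure)
  then have summ: "AE w in M. summable (\<lambda>j. matpow P j *v \<xi> j w)"
  proof eventually_elim
    case (elim w)
    then obtain N where N: "\<And>j. j \<ge> N \<Longrightarrow> norm (\<xi> j w) \<le> s ^ j"
      by (auto simp: eventually_sequentially not_less)
    have "summable (\<lambda>j. C * sqrt \<rho> ^ j)"
      using s(3) C(1) by (intro summable_mult summable_geometric) simp
    moreover have "norm (matpow P j *v \<xi> j w) \<le> C * sqrt \<rho> ^ j" if "j \<ge> N" for j
    proof -
      have "norm (matpow P j *v \<xi> j w) \<le> (C * \<rho> ^ j) * s ^ j"
        using N[OF that] C \<open>C \<ge> 0\<close>
        by (intro order_trans[OF norm_matrix_vector_mult_le] mult_mono) auto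
      then show ?thesis by (simp add: s(2)[symmetric] power_mult_distrib mult_ac)
    qed
    ultimately show ?case by (rule summable_comparison_test')
  qed
  \<comment> \<open>Defined on the whole sequence space, with the value of \<open>suminf\<close>
    also where the series diverges. Thus \<open>Z\<close> is everywhere a measurable function of the
    sequence and inherits its independence without exceptional sets.\<close>
  define f where "f x = (\<Sum>j. matpow P j *v x j)" for x :: "nat \<Rightarrow> real^'n"
  define Z where "Z w = f (\<lambda>j. \<xi> j w)" for w
  have f_meas: "f \<in> borel_measurable (Pi\<^sub>M UNIV (\<lambda>_. borel))"
    unfolding f_def by measurable
  have Z_meas[measurable]: "Z \<in> borel_measurable M"
    unfolding Z_def f_def by measurable
  have \<xi>_meas: "(\<lambda>w j. \<xi> j w) \<in> measurable M (Pi\<^sub>M UNIV (\<lambda>_. borel))"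
    by (rule measurable_PiM_single') auto
  have "sets (vimage_algebra (space M) Z borel)
      \<subseteq> sets (vimage_algebra (space M) (\<lambda>w j. \<xi> j w) (Pi\<^sub>M UNIV (\<lambda>_. borel)))"
  proof -
    have "\<exists>B\<in>sets (Pi\<^sub>M UNIV (\<lambda>_. borel)). Z -` A \<inter> space M = (\<lambda>w j. \<xi> j w) -` B \<inter> space M"
      if "A \<in> sets borel" for A
      using measurable_sets[OF f_meas that]
      by (intro bexI[of _ "f -` A \<inter> space (Pi\<^sub>M UNIV (\<lambda>_. borel))"])
         (auto simp: Z_def space_PiM)
    then show ?thesis
      by (subst (1 2) sets_vimage_algebra2) (auto simp: space_PiM, meson)
  qed
  then have "indep_of M borel Z \<G>"
    using \<xi>(3) unfolding indep_of_def indep_set_def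
    by (elim indep_sets_mono_sets) (auto split: bool.split)
  moreover have "char_vec (distr M borel Z) \<theta> = limit_char \<alpha> \<Lambda> P \<theta>" for \<theta>
  proof -
    have partial: "(CLINT w|M. iexp (\<theta> \<bullet> (\<Sum>j<r. matpow P j *v \<xi> j w)))
        = (\<Prod>j<r. char_vec \<nu> (transpose (matpow P j) *v \<theta>))" for r
    proof -
      let ?X = "\<lambda>j w. (transpose (matpow P j) *v \<theta>) \<bullet> \<xi> j w"
      have "indep_vars (\<lambda>_. borel) \<xi> {..<r}" by (rule indep_vars_subset[OF \<xi>(1)]) simp
      then have "indep_vars (\<lambda>_. borel) ?X {..<r}"
        by (rule indep_vars_compose2[where Y = "\<lambda>j x. (transpose (matpow P j) *v \<theta>) \<bullet> x"]) simp
      then have "char (distr M borel (\<lambda>w. \<Sum>j<r. ?X j w)) 1 = (\<Prod>j<r. char (distr M borel (?X j)) 1)"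
        by (rule char_distr_sum)
      moreover have "char (distr M borel (?X j)) 1 = char_vec \<nu> (transpose (matpow P j) *v \<theta>)" for j
        unfolding char_def char_vec_def \<xi>(2)[of j, symmetric] by (simp add: integral_distr)
      moreover have "char (distr M borel (\<lambda>w. \<Sum>j<r. ?X j w)) 1
          = (CLINT w|M. iexp (\<theta> \<bullet> (\<Sum>j<r. matpow P j *v \<xi> j w)))"
        unfolding char_def
        by (simp add: integral_distr inner_sum_right dot_lmul_matrix transpose_matrix_vector)
      ultimately show ?thesis by simp
    qed
    have "(\<lambda>r. CLINT w|M. iexp (\<theta> \<bullet> (\<Sum>j<r. matpow P j *v \<xi> j w))) \<longlonglongrightarrow> (CLINT w|M. iexp (\<theta> \<bullet> Z w))"
    proof (rule integral_dominated_convergence[where w = "\<lambda>_. 1"])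
      show "AE w in M. (\<lambda>r. iexp (\<theta> \<bullet> (\<Sum>j<r. matpow P j *v \<xi> j w))) \<longlonglongrightarrow> iexp (\<theta> \<bullet> Z w)"
        using summ
      proof eventually_elim
        case (elim w)
        then have "(\<lambda>r. \<Sum>j<r. matpow P j *v \<xi> j w) \<longlonglongrightarrow> Z w"
          unfolding Z_def f_def by (rule summable_LIMSEQ)
        then show ?case by (intro tendsto_intros)
      qed
    qed auto
    then have "(CLINT w|M. iexp (\<theta> \<bullet> Z w)) = limit_char \<alpha> \<Lambda> P \<theta>"
      unfolding partial
      using prod_char_tendsto_limit_char[OF \<Lambda> \<alpha>(1) P] by (rule LIMSEQ_unique)
    then show ?thesis by (simp add: char_vec_def integral_distr)
  qed
  ultimately show ?thesis
    unfolding indep_vector_with_char_def using Z_meas by blast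
qed

section \<open>Conditioning on a filtration\<close>

lemma (in prob_space) integral_uniform_measure:
  fixes f :: "'a \<Rightarrow> 'b::{banach,second_countable_topology}"
  assumes [measurable]: "A \<in> sets M" "f \<in> borel_measurable M" and "prob A > 0"
  shows "integral\<^sup>L (uniform_measure M A) f = (\<integral>w. (indicator A w / prob A) *\<^sub>R f w \<partial>M)"
proof -
  have "indicator A x / emeasure M A = ennreal (indicator A x / prob A)" for x
    using assms(3) by (simp add: emeasure_eq_measure divide_ennreal[symmetric] ennreal_indicator)
  then show ?thesis
    unfolding uniform_measure_def by (simp add: integral_density)
qed

lemma (in prob_space) measure_uniform_measure':
  assumes "A \<in> sets M" "prob A > 0" "D \<in> sets M"
  shows "measure (uniform_measure M A) D = prob (A \<inter> D) / prob A"
  using assms by (intro measure_uniform_measure) (auto simp: emeasure_eq_measure)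

lemma (in prob_space) tendsto_in_prob_imp_L1:
  assumes "tendsto_in_prob M X Y"
    and [measurable]: "\<And>n. (\<lambda>w. dist (X n w) (Y w)) \<in> borel_measurable M"
  shows "(\<lambda>n. \<integral>w. min 1 (dist (X n w) (Y w)) \<partial>M) \<longlonglongrightarrow> 0"
proof (rule tendstoI)
  fix e :: real assume "e > 0"
  let ?D = "\<lambda>n. {w \<in> space M. dist (X n w) (Y w) > e / 2}"
  have "(\<lambda>n. prob (?D n)) \<longlonglongrightarrow> 0"
    using assms(1)[unfolded tendsto_in_prob_def, rule_format, of "e / 2"] \<open>e > 0\<close> by simp
  then have "\<forall>\<^sub>F n in sequentially. prob (?D n) < e / 2"
    using \<open>e > 0\<close> by (intro order_tendstoD) auto
  then show "\<forall>\<^sub>F n in sequentially. dist (\<integral>w. min 1 (dist (X n w) (Y w)) \<partial>M) 0 < e"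
  proof eventually_elim
    case (elim n)
    have ind: "integrable M (indicat_real (?D n))"
      by (intro integrable_real_indicator) (auto simp: emeasure_eq_measure)
    have "(\<integral>w. min 1 (dist (X n w) (Y w)) \<partial>M) \<le> (\<integral>w. e / 2 + indicator (?D n) w \<partial>M)"
    proof (rule integral_mono)
      show "integrable M (\<lambda>w. min 1 (dist (X n w) (Y w)))"
        by (rule integrable_const_bound[where B = 1]) auto
      show "integrable M (\<lambda>w. e / 2 + indicat_real (?D n) w)"
        using ind by simp
    qed (use \<open>e > 0\<close> in \<open>auto simp: indicator_def\<close>)
    also have "\<dots> = e / 2 + prob (?D n)"
      using ind by (simp add: prob_space)
    finally have "(\<integral>w. min 1 (dist (X n w) (Y w)) \<partial>M) < e" using elim by simp
    moreover have "0 \<le> (\<integral>w. min 1 (dist (X n w) (Y w)) \<partial>M)"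
      by (rule integral_nonneg_AE) simp
    ultimately show ?case by simp
  qed
qed

text \<open>Real and imaginary parts are conditioned separately, each staying within
  \<open>[-1, 1]\<close>; adding the two bounds gives the crude modulus bound 2, and any constant
  suffices later.\<close>

lemma complex_cond_exp_facts:
  assumes "prob_space M" and sub: "subalgebra M H"
    and [measurable]: "X \<in> borel_measurable M" and X: "\<And>w. cmod (X w) \<le> 1"
  shows "complex_cond_exp M H X \<in> borel_measurable H"
    and "AE w in M. cmod (complex_cond_exp M H X w) \<le> 2"
    and "W \<in> borel_measurable H \<Longrightarrow> integrable M W \<Longrightarrow>
      (CLINT w|M. W w * complex_cond_exp M H X w) = (CLINT w|M. W w * X w)"
proof -
  interpret prob_space M by fact
  interpret finite_measure_subalgebra M H by standard (rule sub)
  have "complex_cond_exp M H X = (\<lambda>w. complex_of_real (real_cond_exp M H (\<lambda>w. Re (X w)) w)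
      + \<i> * complex_of_real (real_cond_exp M H (\<lambda>w. Im (X w)) w))"
    by (simp add: complex_cond_exp_def Complex_eq fun_eq_iff)
  then show meas: "complex_cond_exp M H X \<in> borel_measurable H" by simp
  note measM = measurable_from_subalg[OF sub]
  have [measurable]: "complex_cond_exp M H X \<in> borel_measurable M" by (rule measM[OF meas])
  have ReIm: "\<bar>Re (X w)\<bar> \<le> 1" "\<bar>Im (X w)\<bar> \<le> 1" for w
    using X[of w] abs_Re_le_cmod[of "X w"] abs_Im_le_cmod[of "X w"] by linarith+
  have bound: "AE w in M. \<bar>real_cond_exp M H f w\<bar> \<le> 1"
    if f: "\<And>w. \<bar>f w\<bar> \<le> 1" and [measurable]: "f \<in> borel_measurable M" for f
  proof -
    have int: "integrable M f" by (rule integrable_const_bound[where B = 1]) (use f in auto)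
    have "AE w in M. f w \<le> 1" "AE w in M. f w \<ge> -1"
      using f by (auto simp: abs_le_iff minus_le_iff)
    then show ?thesis
      using real_cond_exp_le_c[OF int] real_cond_exp_ge_c[OF int] by (auto simp: abs_le_iff minus_le_iff)
  qed
  have "AE w in M. \<bar>Re (complex_cond_exp M H X w)\<bar> \<le> 1" "AE w in M. \<bar>Im (complex_cond_exp M H X w)\<bar> \<le> 1"
    unfolding complex_cond_exp_def by (auto intro!: bound ReIm)
  then show bnd: "AE w in M. cmod (complex_cond_exp M H X w) \<le> 2"
  proof eventually_elim
    case (elim w)
    then show ?case using cmod_le[of "complex_cond_exp M H X w"] by linarith
  qed
  show "(CLINT w|M. W w * complex_cond_exp M H X w) = (CLINT w|M. W w * X w)"
    if WH: "W \<in> borel_measurable H" and W: "integrable M W"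
  proof -
    have [measurable]: "W \<in> borel_measurable M" by (rule measM[OF WH])
    let ?C = "complex_cond_exp M H X"
    have tower: "(\<integral>w. u w * real_cond_exp M H f w \<partial>M) = (\<integral>w. u w * f w \<partial>M)"
        "integrable M (\<lambda>w. u w * real_cond_exp M H f w)" "integrable M (\<lambda>w. u w * f w)"
      if u: "integrable M u" "u \<in> borel_measurable H"
        and f: "\<And>w. \<bar>f w\<bar> \<le> 1" "f \<in> borel_measurable M" for u f :: "'a \<Rightarrow> real"
    proof -
      show i: "integrable M (\<lambda>w. u w * f w)"
        by (rule integrable_mult_bounded[where c = 1]) (use u f in auto)
      show "(\<integral>w. u w * real_cond_exp M H f w \<partial>M) = (\<integral>w. u w * f w \<partial>M)"
        "integrable M (\<lambda>w. u w * real_cond_exp M H f w)"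
        using real_cond_exp_intg[OF i u(2) f(2)] by auto
    qed
    have ReW: "integrable M (\<lambda>w. Re (W w))" "(\<lambda>w. Re (W w)) \<in> borel_measurable H"
      and ImW: "integrable M (\<lambda>w. Im (W w))" "(\<lambda>w. Im (W w)) \<in> borel_measurable H"
      using W WH by auto
    have ReX: "(\<lambda>w. Re (X w)) \<in> borel_measurable M" and ImX: "(\<lambda>w. Im (X w)) \<in> borel_measurable M"
      by auto
    note t = tower[OF ReW ReIm(1) ReX] tower[OF ReW ReIm(2) ImX]
      tower[OF ImW ReIm(1) ReX] tower[OF ImW ReIm(2) ImX]
    have iC: "integrable M (\<lambda>w. W w * ?C w)"
      by (rule integrable_mult_bounded[OF W _ bnd]) simp
    have iX: "integrable M (\<lambda>w. W w * X w)"
      by (rule integrable_mult_bounded[OF W, where c = 1]) (use X in auto)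
    show ?thesis
    proof (rule complex_eqI)
      show "Re (CLINT w|M. W w * ?C w) = Re (CLINT w|M. W w * X w)"
        unfolding integral_Re[OF iC, symmetric] integral_Re[OF iX, symmetric]
        using t by (simp add: complex_cond_exp_def)
      show "Im (CLINT w|M. W w * ?C w) = Im (CLINT w|M. W w * X w)"
        unfolding integral_Im[OF iC, symmetric] integral_Im[OF iX, symmetric]
        using t by (simp add: complex_cond_exp_def)
    qed
  qed
qed

section \<open>Approximating the terminal sigma-field\<close>

locale filtered_prob_space = prob_space M for M :: "'a measure" +
  fixes F :: "nat \<Rightarrow> 'a measure" and Finf :: "'a measure"
  assumes filt: "filtration (space M) F"
    and subalg: "\<And>n. subalgebra M (F n)"
    and Finf_eq: "Finf = limit_algebra (space M) F"
begin

lemma F_mono: "m \<le> n \<Longrightarrow> sets (F m) \<subseteq> sets (F n)"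
  using filt by (auto simp: filtration_def)

lemma space_F: "space (F n) = space M"
  using subalg by (auto simp: subalgebra_def)

lemma sets_Finf: "sets Finf = sigma_sets (space M) (\<Union>k. sets (F k))"
  unfolding Finf_eq limit_algebra_def
  by (rule sets_measure_of) (use space_F sets.sets_into_space in fastforce)

lemma space_Finf: "space Finf = space M"
  unfolding Finf_eq limit_algebra_def
  by (rule space_measure_of) (use space_F sets.sets_into_space in fastforce)

lemma subalg_Finf: "subalgebra M Finf"
proof -
  have "(\<Union>k. sets (F k)) \<subseteq> sets M" using subalg by (auto simp: subalgebra_def)
  then have "sigma_sets (space M) (\<Union>k. sets (F k)) \<subseteq> sets M"
    by (rule sets.sigma_sets_subset)
  then show ?thesis by (simp add: subalgebra_def space_Finf sets_Finf)
qed

lemma measurable_F_mono: "m \<le> n \<Longrightarrow> f \<in> borel_measurable (F m) \<Longrightarrow> f \<in> borel_measurable (F n)"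
  using F_mono by (auto simp: measurable_def space_F)

lemma measurable_F_M: "f \<in> borel_measurable (F m) \<Longrightarrow> f \<in> borel_measurable M"
  by (rule measurable_from_subalg[OF subalg])

lemma measurable_Finf_M: "f \<in> borel_measurable Finf \<Longrightarrow> f \<in> borel_measurable M"
  by (rule measurable_from_subalg[OF subalg_Finf])

definition approximable_set :: "'a set \<Rightarrow> bool" where
  "approximable_set D \<longleftrightarrow> D \<in> sets M \<and>
     (\<forall>e>0. \<exists>m. \<exists>A\<in>sets (F m). prob (sym_diff D A) < e)"

lemma F_sets_M: "A \<in> sets (F m) \<Longrightarrow> A \<in> sets M"
  using subalg by (auto simp: subalgebra_def)

lemma approximable_set_Un:
  assumes "approximable_set D" "approximable_set D'"
  shows "approximable_set (D \<union> D')"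
  unfolding approximable_set_def
proof (intro conjI allI impI)
  have [measurable]: "D \<in> sets M" "D' \<in> sets M" using assms by (auto simp: approximable_set_def)
  show "D \<union> D' \<in> sets M" by simp
  fix e :: real assume "e > 0"
  then obtain m A m' A' where A: "A \<in> sets (F m)" "prob (sym_diff D A) < e / 2"
    "A' \<in> sets (F m')" "prob (sym_diff D' A') < e / 2"
    using assms unfolding approximable_set_def by (metis half_gt_zero)
  have [measurable]: "A \<in> sets M" "A' \<in> sets M" using A F_sets_M by auto
  have "A \<union> A' \<in> sets (F (max m m'))"
    using A F_mono[of m "max m m'"] F_mono[of m' "max m m'"] by auto
  moreover have "prob (sym_diff (D \<union> D') (A \<union> A')) < e"
  proof -
    have "prob (sym_diff (D \<union> D') (A \<union> A'))
        \<le> prob (sym_diff D A \<union> sym_diff D' A')"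
      by (intro finite_measure_mono) auto
    also have "\<dots> \<le> prob (sym_diff D A) + prob (sym_diff D' A')"
      by (intro measure_Un_le) auto
    finally show ?thesis using A by simp
  qed
  ultimately show "\<exists>m. \<exists>B\<in>sets (F m). prob (sym_diff (D \<union> D') B) < e" by blast
qed

text \<open>As the filtration increases, the union of its sigma-fields is an intersection-stable
  generator, so it is enough that approximable sets form a Dynkin system. A countable union is first
  cut to a finite one by continuity of the measure.\<close>

lemma approximable_set_Finf:
  assumes "D \<in> sets Finf"
  shows "approximable_set D"
proof -
  let ?G = "\<Union>k. sets (F k)"
  have G: "Int_stable ?G"
  proof (rule Int_stableI)
    fix A B assume "A \<in> ?G" "B \<in> ?G"
    then obtain i j where "A \<in> sets (F i)" "B \<in> sets (F j)" by blast
    then have "A \<in> sets (F (max i j))" "B \<in> sets (F (max i j))"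
      using F_mono[of i "max i j"] F_mono[of j "max i j"] by auto
    then show "A \<inter> B \<in> ?G" by blast
  qed
  have sub: "?G \<subseteq> Pow (space M)" using space_F sets.sets_into_space by fastforce
  have D: "D \<in> sigma_sets (space M) ?G" using assms by (simp add: sets_Finf)
  show ?thesis
  proof (rule sigma_sets_induct_disjoint[OF G sub D])
    fix A assume "A \<in> ?G"
    then obtain k where "A \<in> sets (F k)" by blast
    then show "approximable_set A"
      using F_sets_M unfolding approximable_set_def by (auto intro!: exI[of _ k] bexI[of _ A])
  next
    show "approximable_set {}"
      unfolding approximable_set_def by (auto intro!: bexI[of _ "{}"])
  next
    fix A assume A: "A \<in> sigma_sets (space M) ?G" "approximable_set A"
    show "approximable_set (space M - A)"
      unfolding approximable_set_def
    proof (intro conjI allI impI)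
      have AM: "A \<in> sets M" using A by (simp add: approximable_set_def)
      then show "space M - A \<in> sets M" by simp
      fix e :: real assume "e > 0"
      then obtain m B where B: "B \<in> sets (F m)" "prob (sym_diff A B) < e"
        using A unfolding approximable_set_def by blast
      have "sym_diff (space M - A) (space M - B) = sym_diff A B"
        using sets.sets_into_space[OF AM] sets.sets_into_space[OF F_sets_M[OF B(1)]] by blast
      moreover have "space M - B \<in> sets (F m)"
        using sets.compl_sets[OF B(1)] by (simp add: space_F)
      ultimately show "\<exists>m. \<exists>B\<in>sets (F m). prob (sym_diff (space M - A) B) < e"
        using B(2) by (intro exI[of _ m] bexI[of _ "space M - B"]) auto
    qed
  next
    fix A :: "nat \<Rightarrow> 'a set"
    assume A: "disjoint_family A" "range A \<subseteq> sigma_sets (space M) ?G" "\<And>i. approximable_set (A i)"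
    have [measurable]: "A i \<in> sets M" for i using A(3) by (simp add: approximable_set_def)
    have fin: "approximable_set (\<Union>i<n. A i)" for n
    proof (induction n)
      case 0
      show ?case unfolding approximable_set_def by (auto intro!: bexI[of _ "{}"])
    next
      case (Suc n)
      then show ?case using approximable_set_Un[OF Suc A(3)[of n]] by (simp add: lessThan_Suc Un_commute)
    qed
    show "approximable_set (\<Union>i. A i)"
      unfolding approximable_set_def
    proof (intro conjI allI impI)
      show "(\<Union>i. A i) \<in> sets M" by simp
      fix e :: real assume "e > 0"
      let ?D = "\<lambda>n. \<Union>i<n. A i"
      have "(\<lambda>n. prob (?D n)) \<longlonglongrightarrow> prob (\<Union>n. ?D n)"
        by (rule finite_Lim_measure_incseq) (auto simp: incseq_def, meson lessThan_iff order_less_le_trans)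
      also have "(\<Union>n. ?D n) = (\<Union>i. A i)" by auto
      finally have "\<forall>\<^sub>F n in sequentially. prob (?D n) > prob (\<Union>i. A i) - e / 2"
        using \<open>e > 0\<close> by (intro order_tendstoD) auto
      then obtain n where n: "prob (?D n) > prob (\<Union>i. A i) - e / 2"
        using eventually_happens'[OF sequentially_bot] by blast
      obtain m B where B: "B \<in> sets (F m)" "prob (sym_diff (?D n) B) < e / 2"
        using fin[of n] \<open>e > 0\<close> unfolding approximable_set_def by (meson half_gt_zero)
      have [measurable]: "B \<in> sets M" using B F_sets_M by auto
      have "prob (sym_diff (\<Union>i. A i) B)
          \<le> prob (((\<Union>i. A i) - ?D n) \<union> sym_diff (?D n) B)"
        by (intro finite_measure_mono) auto
      also have "\<dots> \<le> prob ((\<Union>i. A i) - ?D n) + prob (sym_diff (?D n) B)"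
        by (intro measure_Un_le) auto
      also have "prob ((\<Union>i. A i) - ?D n) = prob (\<Union>i. A i) - prob (?D n)"
        by (intro finite_measure_Diff) auto
      finally have "prob (sym_diff (\<Union>i. A i) B) < e" using n B(2) by simp
      then show "\<exists>m. \<exists>B\<in>sets (F m). prob (sym_diff (\<Union>i. A i) B) < e"
        using B(1) by blast
    qed
  qed
qed

text \<open>Gives what Levy's upward theorem would give for conditional expectations of
  \<open>f\<close>. The induction runs under the measure restricted to \<open>Finf\<close>, so that
  only indicators of \<open>Finf\<close>-sets have to be approximated.\<close>

lemma L1_approximation:
  fixes f :: "'a \<Rightarrow> complex"
  assumes "f \<in> borel_measurable Finf" "integrable M f"
  shows "\<forall>e>0. \<exists>m g. g \<in> borel_measurable (F m) \<and> integrable M g \<and> (\<integral>w. norm (f w - g w) \<partial>M) < e"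
proof -
  let ?N = "restr_to_subalg M Finf"
  have N_M: "integrable M h" if "integrable ?N h" for h :: "'a \<Rightarrow> complex"
    using that by (rule integrable_from_subalg[OF subalg_Finf])
  have "integrable ?N f" by (rule integrable_in_subalg[OF subalg_Finf assms])
  then show ?thesis
  proof (induction rule: integrable_induct)
    case (base A c)
    show ?case
    proof (intro allI impI)
      fix e :: real assume "e > 0"
      have A: "A \<in> sets Finf" using base subalg_Finf by (simp add: sets_restr_to_subalg)
      then have [measurable]: "A \<in> sets M" using subalg_Finf by (auto simp: subalgebra_def)
      have "e / (cmod c + 1) > 0" using \<open>e > 0\<close> by (simp add: add_nonneg_pos)
      then obtain m B where B: "B \<in> sets (F m)" "prob (sym_diff A B) < e / (cmod c + 1)"
        using approximable_set_Finf[OF A] unfolding approximable_set_def by blast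
      have [measurable]: "B \<in> sets M" using B F_sets_M by auto
      let ?g = "\<lambda>w. indicat_real B w *\<^sub>R c"
      have "?g \<in> borel_measurable (F m)" using B(1) by simp
      moreover have "integrable M ?g"
        by (rule integrable_const_bound[where B = "cmod c"]) (auto simp: indicator_def)
      moreover have "(\<integral>w. norm (indicat_real A w *\<^sub>R c - ?g w) \<partial>M)
          = (\<integral>w. indicator (sym_diff A B) w * cmod c \<partial>M)"
        by (rule Bochner_Integration.integral_cong) (auto simp: indicator_def)
      moreover have "\<dots> = prob (sym_diff A B) * cmod c"
        by simp
      moreover have "\<dots> \<le> prob (sym_diff A B) * (cmod c + 1)"
        by (intro mult_left_mono) auto
      moreover have "\<dots> < e"
        using B(2) by (simp add: pos_less_divide_eq add_nonneg_pos)
      ultimately show "\<exists>m g. g \<in> borel_measurable (F m) \<and> integrable M g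
          \<and> (\<integral>w. norm (indicat_real A w *\<^sub>R c - g w) \<partial>M) < e"
        by (intro exI[of _ m] exI[of _ ?g]) linarith
    qed
  next
    case (add f h)
    show ?case
    proof (intro allI impI)
      fix e :: real assume "e > 0"
      obtain m g where g: "g \<in> borel_measurable (F m)" "integrable M g" "(\<integral>w. norm (f w - g w) \<partial>M) < e / 2"
        using add.IH(1) \<open>e > 0\<close> by (meson half_gt_zero)
      obtain m' g' where g': "g' \<in> borel_measurable (F m')" "integrable M g'" "(\<integral>w. norm (h w - g' w) \<partial>M) < e / 2"
        using add.IH(2) \<open>e > 0\<close> by (meson half_gt_zero)
      have int: "integrable M f" "integrable M h" using add N_M by auto
      have [measurable]: "g \<in> borel_measurable (F (max m m'))" "g' \<in> borel_measurable (F (max m m'))"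
        using g g' measurable_F_mono[of m "max m m'"] measurable_F_mono[of m' "max m m'"] by auto
      have "(\<integral>w. norm (f w + h w - (g w + g' w)) \<partial>M) \<le> (\<integral>w. norm (f w - g w) + norm (h w - g' w) \<partial>M)"
        using int g g'
        by (intro integral_mono) (auto simp: add_diff_add intro!: norm_triangle_ineq)
      also have "\<dots> < e" using int g g' by simp
      finally show "\<exists>m k. k \<in> borel_measurable (F m) \<and> integrable M k \<and> (\<integral>w. norm (f w + h w - k w) \<partial>M) < e"
        using g g' by (intro exI[of _ "max m m'"] exI[of _ "\<lambda>w. g w + g' w"]) auto
    qed
  next
    case (lim f s)
    show ?case
    proof (intro allI impI)
      fix e :: real assume "e > 0"
      have int: "integrable M f" "\<And>i. integrable M (s i)" using lim.hyps N_M by auto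
      have sp: "space ?N = space M" by (simp add: space_restr_to_subalg)
      have "(\<lambda>i. \<integral>w. norm (f w - s i w) \<partial>M) \<longlonglongrightarrow> (\<integral>w. 0 \<partial>M)"
      proof (rule integral_dominated_convergence[where w = "\<lambda>w. 3 * norm (f w)"])
        show "AE w in M. (\<lambda>i. norm (f w - s i w)) \<longlonglongrightarrow> 0"
        proof (rule AE_I2)
          fix w assume "w \<in> space M"
          then have "(\<lambda>i. f w - s i w) \<longlonglongrightarrow> f w - f w"
            using lim.hyps(2) sp by (intro tendsto_intros) auto
          then show "(\<lambda>i. norm (f w - s i w)) \<longlonglongrightarrow> 0" by (simp add: tendsto_norm_zero)
        qed
        show "AE w in M. norm (norm (f w - s i w)) \<le> 3 * norm (f w)" for i
        proof (rule AE_I2)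
          fix w assume "w \<in> space M"
          then have "norm (s i w) \<le> 2 * norm (f w)" using lim.hyps(3) sp by auto
          then show "norm (norm (f w - s i w)) \<le> 3 * norm (f w)"
            using norm_triangle_ineq4[of "f w" "s i w"] by simp
        qed
      qed (use int in auto)
      then have "\<forall>\<^sub>F i in sequentially. (\<integral>w. norm (f w - s i w) \<partial>M) < e / 2"
        using \<open>e > 0\<close> by (intro order_tendstoD) auto
      then obtain i where i: "(\<integral>w. norm (f w - s i w) \<partial>M) < e / 2"
        using eventually_happens'[OF sequentially_bot] by blast
      obtain m g where g: "g \<in> borel_measurable (F m)" "integrable M g" "(\<integral>w. norm (s i w - g w) \<partial>M) < e / 2"
        using lim.IH[of i] \<open>e > 0\<close> by (meson half_gt_zero)
      have "(\<integral>w. norm (f w - g w) \<partial>M) \<le> (\<integral>w. norm (f w - s i w) + norm (s i w - g w) \<partial>M)"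
        using int g norm_triangle_ineq[of "f w - s i w" "s i w - g w" for w]
        by (intro integral_mono) auto
      also have "\<dots> < e" using int g i by simp
      finally show "\<exists>m g. g \<in> borel_measurable (F m) \<and> integrable M g \<and> (\<integral>w. norm (f w - g w) \<partial>M) < e"
        using g by blast
    qed
  qed
qed

end

section \<open>Successive conditioning on the past\<close>

context filtered_prob_space
begin

text \<open>Integrates out the newest increment. The tower property requires a weight known at time
  \<open>n - 1\<close>, so \<open>f\<close> is exchanged for an \<open>F m\<close>-measurable
  \<open>g\<close>. Since \<open>cond\<close> only speaks about \<open>A\<close>, the weight has to
  vanish off \<open>A\<close> when the conditional expectation is replaced by
  \<open>z\<close>.\<close>

lemma iterated_characteristic_step:
  fixes Y :: "nat \<Rightarrow> 'a \<Rightarrow> real^'n" and f :: "'a \<Rightarrow> complex"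
  assumes A: "A \<in> sets Finf" "prob A > 0"
    and Y: "\<And>n. Y n \<in> borel_measurable (F n)"
    and cond: "tendsto_in_prob (uniform_measure M A)
        (\<lambda>n. complex_cond_exp M (F (n - 1)) (\<lambda>w. iexp (\<theta> \<bullet> Y n w))) (\<lambda>_. z)"
    and f: "f \<in> borel_measurable Finf" "\<And>w. cmod (f w) \<le> k" "\<And>w. w \<notin> A \<Longrightarrow> f w = 0"
    and S: "\<And>n. S n \<in> borel_measurable (F n)"
  shows "(\<lambda>n. (CLINT w|M. f w * iexp (S (n - 1) w) * iexp (\<theta> \<bullet> Y n w))
      - z * (CLINT w|M. f w * iexp (S (n - 1) w))) \<longlonglongrightarrow> 0"
proof (rule tendstoI)
  fix e :: real assume "e > 0"
  have k0: "k \<ge> 0" using f(2) by (rule order_trans[OF norm_ge_zero])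
  have AM[measurable]: "A \<in> sets M" using A subalg_Finf by (auto simp: subalgebra_def)
  let ?Q = "uniform_measure M A"
  interpret Q: prob_space ?Q
    by (rule prob_space_uniform_measure) (use A in \<open>auto simp: emeasure_eq_measure\<close>)
  have [measurable]: "f \<in> borel_measurable M" using f(1) by (rule measurable_Finf_M)
  have [measurable]: "Y n \<in> borel_measurable M" "S n \<in> borel_measurable M" for n
    using Y S measurable_F_M by blast+
  define E where "E n w = iexp (\<theta> \<bullet> Y n w)" for n w
  define C where "C n = complex_cond_exp M (F (n - 1)) (E n)" for n
  define X where "X n w = iexp (S n w)" for n w
  have [measurable]: "E n \<in> borel_measurable M" "X n \<in> borel_measurable M" for n
    unfolding E_def X_def by measurable
  have X_F: "X n \<in> borel_measurable (F n)" for n unfolding X_def using S[of n] by measurable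
  have nE: "cmod (E n w) \<le> 1" and nX: "cmod (X n w) = 1" for n w by (simp_all add: E_def X_def)
  note Cf = complex_cond_exp_facts[OF prob_space_axioms subalg _ nE]
  have [measurable]: "C n \<in> borel_measurable M" for n
    unfolding C_def by (rule measurable_F_M[OF Cf(1)]) simp
  have C2: "AE w in M. cmod (C n w) \<le> 2" for n unfolding C_def by (rule Cf(2)) simp
  \<comment> \<open>Almost everywhere \<open>dist (C n w) z\<close> is at most
    \<open>2 + cmod z\<close>, hence at most \<open>K * min 1 (dist (C n w) z)\<close>; boundedness
    turns convergence in probability into convergence in L1.\<close>
  define K where "K = 3 + cmod z"
  define d where "d n = (\<integral>w. min 1 (dist (C n w) z) \<partial>?Q)" for n
  have d_eq: "d n = (\<integral>w. indicator A w / prob A * min 1 (dist (C n w) z) \<partial>M)" for n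
    unfolding d_def by (subst integral_uniform_measure) (use A in auto)
  have "tendsto_in_prob ?Q C (\<lambda>_. z)"
    using cond by (simp only: C_def[abs_def] E_def[abs_def])
  then have "d \<longlonglongrightarrow> 0"
    unfolding d_def by (rule Q.tendsto_in_prob_imp_L1) measurable
  then have "(\<lambda>n. k * K * prob A * d n) \<longlonglongrightarrow> k * K * prob A * 0" by (intro tendsto_intros)
  then have dn: "\<forall>\<^sub>F n in sequentially. k * K * prob A * d n < e / 4"
    using \<open>e > 0\<close> by (intro order_tendstoD) auto
  have int_f: "integrable M f"
    by (rule integrable_const_bound[where B = k]) (use f in auto)
  obtain m g where g: "g \<in> borel_measurable (F m)" "integrable M g" "(\<integral>w. norm (f w - g w) \<partial>M) < e / 4"
    using L1_approximation[OF f(1) int_f, rule_format, of "e / 4"] \<open>e > 0\<close> by auto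
  have [measurable]: "g \<in> borel_measurable M" using g by simp
  note int = integrable_mult_bounded
  have "\<forall>\<^sub>F n in sequentially. n > m" by (rule eventually_gt_at_top)
  with dn show "\<forall>\<^sub>F n in sequentially. dist ((CLINT w|M. f w * iexp (S (n - 1) w) * iexp (\<theta> \<bullet> Y n w))
      - z * (CLINT w|M. f w * iexp (S (n - 1) w))) 0 < e"
  proof eventually_elim
    case (elim n)
    let ?X = "X (n - 1)"
    have m: "m \<le> n - 1" using elim by simp
    have nX1: "AE w in M. cmod (?X w) \<le> 1" by (simp add: nX)
    have nXE: "AE w in M. cmod (?X w * E n w) \<le> 1" using nE by (simp add: norm_mult nX)
    have nXC: "AE w in M. cmod (?X w * C n w) \<le> 2" using C2[of n] by (simp add: norm_mult nX)
    have gX: "integrable M (\<lambda>w. g w * ?X w)" by (rule int[OF g(2) _ nX1]) simp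
    have "(\<lambda>w. g w * ?X w) \<in> borel_measurable (F (n - 1))"
      using measurable_F_mono[OF m g(1)] X_F by (rule borel_measurable_times)
    then have tower: "(CLINT w|M. g w * ?X w * C n w) = (CLINT w|M. g w * ?X w * E n w)"
      unfolding C_def using gX by (intro Cf(3)) auto
    have fg: "integrable M (\<lambda>w. f w - g w)" using int_f g(2) by simp
    have i1: "integrable M (\<lambda>w. (f w - g w) * (?X w * E n w))" by (rule int[OF fg _ nXE]) simp
    have i2: "integrable M (\<lambda>w. (f w - g w) * (?X w * C n w))" by (rule int[OF fg _ nXC]) simp
    have i3: "integrable M (\<lambda>w. f w * (?X w * C n w))" by (rule int[OF int_f _ nXC]) simp
    have i4: "integrable M (\<lambda>w. f w * ?X w)" by (rule int[OF int_f _ nX1]) simp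
    have i5: "integrable M (\<lambda>w. g w * (?X w * E n w))" by (rule int[OF g(2) _ nXE]) simp
    have i6: "integrable M (\<lambda>w. g w * (?X w * C n w))" by (rule int[OF g(2) _ nXC]) simp
    have i7: "integrable M (\<lambda>w. f w * (?X w * E n w))" by (rule int[OF int_f _ nXE]) simp
    have i8: "integrable M (\<lambda>w. f w * ?X w * (C n w - z))"
      using Bochner_Integration.integrable_diff[OF i3 integrable_mult_left[OF i4, of z]]
      by (simp add: algebra_simps)
    \<comment> \<open>The integrals against \<open>g\<close> cancel by \<open>tower\<close>. What
      remains costs one and two times the L1-distance of \<open>f\<close> and \<open>g\<close>, plus
      the error of putting \<open>z\<close> for \<open>C n\<close>: \<open>e / 4\<close>,
      \<open>2 * e / 4\<close> and \<open>e / 4\<close>.\<close>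
    have split: "(CLINT w|M. f w * ?X w * E n w) - z * (CLINT w|M. f w * ?X w)
        = (CLINT w|M. (f w - g w) * (?X w * E n w)) - (CLINT w|M. (f w - g w) * (?X w * C n w))
          + (CLINT w|M. f w * ?X w * (C n w - z))"
    proof -
      have "(CLINT w|M. (f w - g w) * (?X w * E n w))
          = (CLINT w|M. f w * (?X w * E n w)) - (CLINT w|M. g w * (?X w * E n w))"
        unfolding left_diff_distrib by (rule Bochner_Integration.integral_diff[OF i7 i5])
      moreover have "(CLINT w|M. (f w - g w) * (?X w * C n w))
          = (CLINT w|M. f w * (?X w * C n w)) - (CLINT w|M. g w * (?X w * C n w))"
        unfolding left_diff_distrib by (rule Bochner_Integration.integral_diff[OF i3 i6])
      moreover have "(CLINT w|M. f w * ?X w * (C n w - z))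
          = (CLINT w|M. f w * (?X w * C n w)) - (CLINT w|M. f w * ?X w) * z"
      proof -
        have eq: "f w * ?X w * (C n w - z) = f w * (?X w * C n w) - f w * ?X w * z" for w
          by (simp add: algebra_simps)
        show ?thesis
          unfolding eq Bochner_Integration.integral_diff[OF i3 integrable_mult_left[OF i4]]
            integral_mult_left_zero ..
      qed
      ultimately show ?thesis using tower by (simp add: mult.assoc mult.commute[of z])
    qed
    have "cmod ((CLINT w|M. f w * ?X w * E n w) - z * (CLINT w|M. f w * ?X w))
        \<le> cmod (CLINT w|M. (f w - g w) * (?X w * E n w))
        + cmod (CLINT w|M. (f w - g w) * (?X w * C n w)) + cmod (CLINT w|M. f w * ?X w * (C n w - z))"
      unfolding split by (intro norm_triangle_mono norm_triangle_ineq4 order_refl)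
    also have "\<dots> \<le> (\<integral>w. norm (f w - g w) \<partial>M) + 2 * (\<integral>w. norm (f w - g w) \<partial>M) + k * K * prob A * d n"
    proof (intro add_mono)
      have "cmod (CLINT w|M. (f w - g w) * (?X w * E n w)) \<le> (\<integral>w. norm ((f w - g w) * (?X w * E n w)) \<partial>M)"
        by (rule integral_norm_bound)
      also have "\<dots> \<le> (\<integral>w. norm (f w - g w) \<partial>M)"
        by (rule integral_mono[OF integrable_norm[OF i1] integrable_norm[OF fg]])
           (auto simp: norm_mult nX mult_left_le nE)
      finally show "cmod (CLINT w|M. (f w - g w) * (?X w * E n w)) \<le> (\<integral>w. norm (f w - g w) \<partial>M)" .
      have "cmod (CLINT w|M. (f w - g w) * (?X w * C n w)) \<le> (\<integral>w. norm ((f w - g w) * (?X w * C n w)) \<partial>M)"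
        by (rule integral_norm_bound)
      also have "\<dots> \<le> (\<integral>w. 2 * norm (f w - g w) \<partial>M)"
      proof (rule integral_mono_AE)
        show "AE w in M. norm ((f w - g w) * (?X w * C n w)) \<le> 2 * norm (f w - g w)"
          using nXC
        proof eventually_elim
          case (elim w)
          then show ?case
            using mult_left_mono[OF elim, of "norm (f w - g w)"] by (simp add: norm_mult mult.commute)
        qed
      qed (use integrable_norm[OF i2] fg in auto)
      finally show "cmod (CLINT w|M. (f w - g w) * (?X w * C n w)) \<le> 2 * (\<integral>w. norm (f w - g w) \<partial>M)"
        by simp
      have "cmod (CLINT w|M. f w * ?X w * (C n w - z)) \<le> (\<integral>w. norm (f w * ?X w * (C n w - z)) \<partial>M)"
        by (rule integral_norm_bound)
      also have "\<dots> \<le> (\<integral>w. k * K * prob A * (indicator A w / prob A * min 1 (dist (C n w) z)) \<partial>M)"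
      proof (rule integral_mono_AE)
        show "integrable M (\<lambda>w. k * K * prob A * (indicator A w / prob A * min 1 (dist (C n w) z)))"
        proof (rule integrable_mult_right, rule integrable_const_bound[where B = "1 / prob A"])
          show "AE w in M. norm (indicator A w / prob A * min 1 (dist (C n w) z)) \<le> 1 / prob A"
            using A by (auto simp: indicator_def divide_right_mono)
        qed simp
        show "AE w in M. norm (f w * ?X w * (C n w - z))
            \<le> k * K * prob A * (indicator A w / prob A * min 1 (dist (C n w) z))"
          using C2[of n]
        proof eventually_elim
          case (elim w)
          show ?case
          proof (cases "w \<in> A")
            case True
            let ?t = "dist (C n w) z"
            have "?t \<le> K" using elim norm_triangle_ineq4[of "C n w" z] by (simp add: dist_norm K_def)
            then have "?t \<le> K * min 1 ?t"
              using mult_right_mono[of 1 K ?t] by (auto simp: min_def K_def)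
            then have "cmod (f w) * ?t \<le> k * (K * min 1 ?t)"
              using f(2) k0 by (intro mult_mono) auto
            then show ?thesis using True A by (simp add: norm_mult nX dist_norm mult.assoc)
          qed (simp add: f(3))
        qed
      qed (use integrable_norm[OF i8] in auto)
      also have "\<dots> = k * K * prob A * d n" unfolding d_eq by (rule integral_mult_right_zero)
      finally show "cmod (CLINT w|M. f w * ?X w * (C n w - z)) \<le> k * K * prob A * d n" .
    qed
    also have "\<dots> < e" using g(3) elim(1) by linarith
    finally show ?case by (simp add: X_def E_def)
  qed
qed

text \<open>The newest factor \<open>Y n\<close> goes first. The others are known at time
  \<open>n - 1\<close> and form a sum of the same shape at that time with shifted frequencies,
  whence the induction over arbitrary \<theta>.\<close>

lemma iterated_characteristic_aux:
  fixes Y :: "nat \<Rightarrow> 'a \<Rightarrow> real^'n" and f :: "'a \<Rightarrow> complex"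
  assumes A: "A \<in> sets Finf" "prob A > 0"
    and Y: "\<And>n. Y n \<in> borel_measurable (F n)"
    and cond: "\<And>\<theta>. tendsto_in_prob (uniform_measure M A)
        (\<lambda>n. complex_cond_exp M (F (n - 1)) (\<lambda>w. iexp (\<theta> \<bullet> Y n w))) (\<lambda>_. \<phi> \<theta>)"
    and f: "f \<in> borel_measurable Finf" "\<And>w. cmod (f w) \<le> k" "\<And>w. w \<notin> A \<Longrightarrow> f w = 0"
  shows "(\<lambda>n. CLINT w|M. f w * iexp (\<Sum>j<r. \<theta> j \<bullet> Y (n - j) w))
      \<longlonglongrightarrow> (CLINT w|M. f w) * (\<Prod>j<r. \<phi> (\<theta> j))"
proof (induction r arbitrary: \<theta>)
  case (Suc r)
  define S where "S n w = (\<Sum>j<r. \<theta> (Suc j) \<bullet> Y (n - j) w)" for n w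
  have "S n \<in> borel_measurable (F n)" for n
  proof -
    have "Y (n - j) \<in> borel_measurable (F n)" for j
      by (rule measurable_F_mono[OF _ Y]) simp
    then show ?thesis unfolding S_def by (intro borel_measurable_sum borel_measurable_inner) auto
  qed
  note step = iterated_characteristic_step[OF A Y cond[of "\<theta> 0"] f this]
  have "(\<lambda>n. CLINT w|M. f w * iexp (S (n - 1) w))
      \<longlonglongrightarrow> (CLINT w|M. f w) * (\<Prod>j<r. \<phi> (\<theta> (Suc j)))"
    unfolding S_def by (rule filterlim_compose[OF Suc filterlim_minus_const_nat_at_top])
  from tendsto_add[OF step tendsto_mult_left[OF this, of "\<phi> (\<theta> 0)"]]
  have "(\<lambda>n. CLINT w|M. f w * iexp (S (n - 1) w) * iexp (\<theta> 0 \<bullet> Y n w))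
      \<longlonglongrightarrow> \<phi> (\<theta> 0) * ((CLINT w|M. f w) * (\<Prod>j<r. \<phi> (\<theta> (Suc j))))"
    by simp
  moreover have "f w * iexp (S (n - 1) w) * iexp (\<theta> 0 \<bullet> Y n w)
      = f w * iexp (\<Sum>j<Suc r. \<theta> j \<bullet> Y (n - j) w)" for n w
    by (simp add: S_def sum.lessThan_Suc_shift distrib_left exp_add mult.assoc del: sum.lessThan_Suc)
  moreover have "\<phi> (\<theta> 0) * ((CLINT w|M. f w) * (\<Prod>j<r. \<phi> (\<theta> (Suc j))))
      = (CLINT w|M. f w) * (\<Prod>j<Suc r. \<phi> (\<theta> j))"
    by (simp add: prod.lessThan_Suc_shift del: prod.lessThan_Suc)
  ultimately show ?case by (simp only:)
qed simp

text \<open>The density \<open>indicator A w / prob A\<close> joins the weight, which stays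
  \<open>Finf\<close>-measurable because \<open>A\<close> is in \<open>Finf\<close>.\<close>

lemma iterated_characteristic:
  fixes Y :: "nat \<Rightarrow> 'a \<Rightarrow> real^'n" and f :: "'a \<Rightarrow> complex"
  assumes A: "A \<in> sets Finf" "prob A > 0"
    and Y: "\<And>n. Y n \<in> borel_measurable (F n)"
    and cond: "\<And>\<theta>. tendsto_in_prob (uniform_measure M A)
        (\<lambda>n. complex_cond_exp M (F (n - 1)) (\<lambda>w. iexp (\<theta> \<bullet> Y n w))) (\<lambda>_. \<phi> \<theta>)"
    and f: "f \<in> borel_measurable Finf" "\<And>w. cmod (f w) \<le> k"
  shows "(\<lambda>n. CLINT w|uniform_measure M A. f w * iexp (\<Sum>j<r. \<theta> j \<bullet> Y (n - j) w))
      \<longlonglongrightarrow> (CLINT w|uniform_measure M A. f w) * (\<Prod>j<r. \<phi> (\<theta> j))"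
proof -
  have AM[measurable]: "A \<in> sets M" using A subalg_Finf by (auto simp: subalgebra_def)
  have [measurable]: "f \<in> borel_measurable M" using f(1) by (rule measurable_Finf_M)
  have [measurable]: "Y n \<in> borel_measurable M" for n
    using Y measurable_F_M by blast
  define f' where "f' w = (indicator A w / prob A) *\<^sub>R f w" for w
  have "f' \<in> borel_measurable Finf"
    unfolding f'_def using f(1) A(1) by measurable
  moreover have "cmod (f' w) \<le> k / prob A" for w
    using f(2)[of w] A(2) order_trans[OF norm_ge_zero f(2)[of w]]
    by (auto simp: f'_def indicator_def divide_right_mono)
  moreover have "w \<notin> A \<Longrightarrow> f' w = 0" for w by (simp add: f'_def)
  ultimately have "(\<lambda>n. CLINT w|M. f' w * iexp (\<Sum>j<r. \<theta> j \<bullet> Y (n - j) w))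
      \<longlonglongrightarrow> (CLINT w|M. f' w) * (\<Prod>j<r. \<phi> (\<theta> j))"
    by (rule iterated_characteristic_aux[OF A Y cond])
  then show ?thesis
    using A by (simp add: integral_uniform_measure f'_def)
qed

end

section \<open>Negligible and tight sequences\<close>

text \<open>Convergence to 0 in probability, metrised by the mean of
  \<open>min 1 (norm (X n w))\<close>, so that estimates become inequalities between
  integrals.\<close>

definition negligible_seq :: "'a measure \<Rightarrow> (nat \<Rightarrow> 'a \<Rightarrow> 'b::euclidean_space) \<Rightarrow> bool" where
  "negligible_seq Q X \<longleftrightarrow> (\<lambda>n. \<integral>w. min 1 (norm (X n w)) \<partial>Q) \<longlonglongrightarrow> 0"

context prob_space
begin

lemma integrable_min_1:
  "X \<in> borel_measurable M \<Longrightarrow> integrable M (\<lambda>w. min 1 (norm (X w :: 'b::euclidean_space)))"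
  by (rule integrable_const_bound[where B = 1]) auto

lemma negligible_seq_of_tendsto_in_prob:
  fixes X :: "nat \<Rightarrow> 'a \<Rightarrow> 'b::euclidean_space"
  assumes "tendsto_in_prob M X Y" and [measurable]: "\<And>n. X n \<in> borel_measurable M" "Y \<in> borel_measurable M"
  shows "negligible_seq M (\<lambda>n w. X n w - Y w)"
  using tendsto_in_prob_imp_L1[OF assms(1)] by (simp add: negligible_seq_def dist_norm)

lemma negligible_seq_mono:
  fixes X :: "nat \<Rightarrow> 'a \<Rightarrow> 'b::euclidean_space" and Y :: "nat \<Rightarrow> 'a \<Rightarrow> 'c::euclidean_space"
  assumes "negligible_seq M Y" and [measurable]: "\<And>n. X n \<in> borel_measurable M" "\<And>n. Y n \<in> borel_measurable M"
    and "\<forall>\<^sub>F n in sequentially. AE w in M. min 1 (norm (X n w)) \<le> c * min 1 (norm (Y n w))"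
  shows "negligible_seq M X"
  unfolding negligible_seq_def
proof (rule tendsto_sandwich)
  show "\<forall>\<^sub>F n in sequentially. 0 \<le> (\<integral>w. min 1 (norm (X n w)) \<partial>M)"
    by (intro always_eventually allI integral_nonneg_AE) simp
  show "\<forall>\<^sub>F n in sequentially. (\<integral>w. min 1 (norm (X n w)) \<partial>M) \<le> c * (\<integral>w. min 1 (norm (Y n w)) \<partial>M)"
    using assms(4)
  proof eventually_elim
    case (elim n)
    have "(\<integral>w. min 1 (norm (X n w)) \<partial>M) \<le> (\<integral>w. c * min 1 (norm (Y n w)) \<partial>M)"
      by (intro integral_mono_AE integrable_mult_right integrable_min_1 elim) measurable
    then show ?case by simp
  qed
  show "(\<lambda>n. c * (\<integral>w. min 1 (norm (Y n w)) \<partial>M)) \<longlonglongrightarrow> 0"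
    using tendsto_mult_left[OF assms(1)[unfolded negligible_seq_def], of c] by simp
qed simp

lemma negligible_seq_add:
  fixes X :: "nat \<Rightarrow> 'a \<Rightarrow> 'b::euclidean_space"
  assumes "negligible_seq M X" "negligible_seq M Y"
    and [measurable]: "\<And>n. X n \<in> borel_measurable M" "\<And>n. Y n \<in> borel_measurable M"
  shows "negligible_seq M (\<lambda>n w. X n w + Y n w)"
  unfolding negligible_seq_def
proof (rule tendsto_sandwich)
  show "\<forall>\<^sub>F n in sequentially. 0 \<le> (\<integral>w. min 1 (norm (X n w + Y n w)) \<partial>M)"
    by (intro always_eventually allI integral_nonneg_AE) simp
  have "(\<integral>w. min 1 (norm (X n w + Y n w)) \<partial>M)
      \<le> (\<integral>w. min 1 (norm (X n w)) + min 1 (norm (Y n w)) \<partial>M)" for n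
  proof (rule integral_mono)
    fix w
    show "min 1 (norm (X n w + Y n w)) \<le> min 1 (norm (X n w)) + min 1 (norm (Y n w))"
      using norm_triangle_ineq[of "X n w" "Y n w"] norm_ge_zero[of "X n w"] norm_ge_zero[of "Y n w"]
      unfolding min_def by (smt (verit))
  qed (auto intro!: integrable_min_1)
  also have "\<dots> n = (\<integral>w. min 1 (norm (X n w)) \<partial>M) + (\<integral>w. min 1 (norm (Y n w)) \<partial>M)" for n
    by (rule Bochner_Integration.integral_add) (auto intro!: integrable_min_1)
  finally show "\<forall>\<^sub>F n in sequentially. (\<integral>w. min 1 (norm (X n w + Y n w)) \<partial>M)
      \<le> (\<integral>w. min 1 (norm (X n w)) \<partial>M) + (\<integral>w. min 1 (norm (Y n w)) \<partial>M)"
    by (intro always_eventually allI)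
  show "(\<lambda>n. (\<integral>w. min 1 (norm (X n w)) \<partial>M) + (\<integral>w. min 1 (norm (Y n w)) \<partial>M)) \<longlonglongrightarrow> 0"
    using tendsto_add[OF assms(1,2)[unfolded negligible_seq_def]] by simp
qed simp

lemma negligible_seq_sum:
  fixes X :: "'i \<Rightarrow> nat \<Rightarrow> 'a \<Rightarrow> 'b::euclidean_space"
  assumes "\<And>i. i \<in> I \<Longrightarrow> negligible_seq M (X i)" "\<And>i n. X i n \<in> borel_measurable M"
  shows "negligible_seq M (\<lambda>n w. \<Sum>i\<in>I. X i n w)"
  using assms(1)
proof (induction I rule: infinite_finite_induct)
  case (insert i I)
  then have "negligible_seq M (\<lambda>n w. X i n w + (\<Sum>i\<in>I. X i n w))"
    using assms(2) by (intro negligible_seq_add) auto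
  then show ?case using insert by simp
qed (simp_all add: negligible_seq_def)

lemma tight_seq_shift: "tight_seq M X \<Longrightarrow> tight_seq M (\<lambda>n. X (n - r))"
  unfolding tight_seq_def
  using eventually_compose_filterlim[OF _ filterlim_minus_const_nat_at_top, of _ r] by fast

text \<open>Where \<open>norm (V w) \<le> K\<close>, the product is at most
  \<open>K * norm (L w)\<close>, and \<open>K \<ge> 1\<close> allows the minimum with 1 to be taken
  inside. Serves both for random \<open>L\<close> tending to 0 and for the constant matrix
  \<open>matpow P r\<close>.\<close>

lemma integral_min_1_le:
  fixes X :: "'a \<Rightarrow> 'b::euclidean_space" and V :: "'a \<Rightarrow> 'c::euclidean_space" and L :: "'a \<Rightarrow> 'd::euclidean_space"
  assumes [measurable]: "X \<in> borel_measurable M" "V \<in> borel_measurable M" "L \<in> borel_measurable M"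
    and "\<And>w. norm (X w) \<le> norm (L w) * norm (V w)" and "K \<ge> 1"
  shows "(\<integral>w. min 1 (norm (X w)) \<partial>M)
    \<le> prob {w \<in> space M. norm (V w) > K} + K * (\<integral>w. min 1 (norm (L w)) \<partial>M)"
proof -
  let ?D = "{w \<in> space M. norm (V w) > K}"
  have ind: "integrable M (indicat_real ?D)"
    by (intro integrable_real_indicator) (auto simp: emeasure_eq_measure)
  have "(\<integral>w. min 1 (norm (X w)) \<partial>M) \<le> (\<integral>w. indicator ?D w + K * min 1 (norm (L w)) \<partial>M)"
  proof (rule integral_mono)
    show "integrable M (\<lambda>w. indicator ?D w + K * min 1 (norm (L w)))"
      using ind integrable_min_1[of L] by simp
    show "integrable M (\<lambda>w. min 1 (norm (X w)))" by (rule integrable_min_1) simp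
    fix w assume w: "w \<in> space M"
    show "min 1 (norm (X w)) \<le> indicator ?D w + K * min 1 (norm (L w))"
    proof (cases "w \<in> ?D")
      case True
      then show ?thesis using \<open>K \<ge> 1\<close> by (simp add: min.coboundedI1 add_increasing2)
    next
      case False
      then have "norm (X w) \<le> norm (L w) * K"
        using w by (intro order_trans[OF assms(4)] mult_left_mono) auto
      then show ?thesis using False \<open>K \<ge> 1\<close> by (auto simp: min_def mult.commute)
    qed
  qed
  also have "\<dots> = prob ?D + K * (\<integral>w. min 1 (norm (L w)) \<partial>M)"
    using ind integrable_min_1[of L] by simp
  finally show ?thesis .
qed

lemma negligible_seq_mult_tight:
  fixes L :: "nat \<Rightarrow> 'a \<Rightarrow> real^'n^'m" and V :: "nat \<Rightarrow> 'a \<Rightarrow> real^'n"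
  assumes L: "negligible_seq M L" and V: "tight_seq M V"
    and meas[measurable]: "\<And>n. L n \<in> borel_measurable M" "\<And>n. V n \<in> borel_measurable M"
  shows "negligible_seq M (\<lambda>n w. L n w *v V n w)"
  unfolding negligible_seq_def
proof (rule tendstoI)
  fix e :: real assume "e > 0"
  obtain K where K: "K \<ge> 1" "\<forall>\<^sub>F n in sequentially. prob {w \<in> space M. norm (V n w) > K} \<le> e / 2"
    using tight_seqE[OF V meas(2), of "e / 2" 1] \<open>e > 0\<close> by auto
  have "(\<lambda>n. K * (\<integral>w. min 1 (norm (L n w)) \<partial>M)) \<longlonglongrightarrow> 0"
    using tendsto_mult_left[OF L[unfolded negligible_seq_def], of K] by simp
  then have "\<forall>\<^sub>F n in sequentially. K * (\<integral>w. min 1 (norm (L n w)) \<partial>M) < e / 2"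
    using \<open>e > 0\<close> by (intro order_tendstoD) auto
  with K(2) show "\<forall>\<^sub>F n in sequentially. dist (\<integral>w. min 1 (norm (L n w *v V n w)) \<partial>M) 0 < e"
  proof eventually_elim
    case (elim n)
    have "(\<integral>w. min 1 (norm (L n w *v V n w)) \<partial>M)
        \<le> prob {w \<in> space M. norm (V n w) > K} + K * (\<integral>w. min 1 (norm (L n w)) \<partial>M)"
      by (rule integral_min_1_le) (use K norm_matrix_vector_mult_le in auto)
    also have "\<dots> < e" using elim by linarith
    finally show ?case by (simp add: integral_nonneg_AE)
  qed
qed

lemma tight_seq_add:
  fixes X :: "nat \<Rightarrow> 'a \<Rightarrow> 'b::euclidean_space"
  assumes "tight_seq M X" "tight_seq M Y"
    and meas[measurable]: "\<And>n. X n \<in> borel_measurable M" "\<And>n. Y n \<in> borel_measurable M"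
  shows "tight_seq M (\<lambda>n w. X n w + Y n w)"
  unfolding tight_seq_def
proof (intro allI impI)
  fix e :: real assume "e > 0"
  then have "e / 2 > 0" by simp
  then obtain K K' where K: "\<forall>\<^sub>F n in sequentially. prob {w \<in> space M. norm (X n w) > K} \<le> e / 2"
    "\<forall>\<^sub>F n in sequentially. prob {w \<in> space M. norm (Y n w) > K'} \<le> e / 2"
    using assms(1,2) unfolding tight_seq_def by meson
  then have "\<forall>\<^sub>F n in sequentially. prob {w \<in> space M. norm (X n w + Y n w) > K + K'} \<le> e"
  proof eventually_elim
    case (elim n)
    have "prob {w \<in> space M. norm (X n w + Y n w) > K + K'}
        \<le> prob ({w \<in> space M. norm (X n w) > K} \<union> {w \<in> space M. norm (Y n w) > K'})"
    proof (rule finite_measure_mono)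
      show "{w \<in> space M. norm (X n w + Y n w) > K + K'}
          \<subseteq> {w \<in> space M. norm (X n w) > K} \<union> {w \<in> space M. norm (Y n w) > K'}"
        by safe (smt (verit) norm_triangle_ineq)
    qed measurable
    also have "\<dots> \<le> prob {w \<in> space M. norm (X n w) > K} + prob {w \<in> space M. norm (Y n w) > K'}"
      by (intro measure_Un_le) measurable
    finally show ?case using elim by linarith
  qed
  then show "\<exists>K. \<forall>\<^sub>F n in sequentially. prob {w \<in> space M. norm (X n w + Y n w) > K} \<le> e" by blast
qed

lemma tight_seq_mono:
  fixes X :: "nat \<Rightarrow> 'a \<Rightarrow> 'b::euclidean_space" and Y :: "nat \<Rightarrow> 'a \<Rightarrow> 'c::euclidean_space"
  assumes Y: "tight_seq M Y" and meas[measurable]: "\<And>n. X n \<in> borel_measurable M" "\<And>n. Y n \<in> borel_measurable M"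
    and le: "\<forall>\<^sub>F n in sequentially. AE w in M. norm (X n w) \<le> c * norm (Y n w)" and "c > 0"
  shows "tight_seq M X"
  unfolding tight_seq_def
proof (intro allI impI)
  fix e :: real assume "e > 0"
  then obtain K where "\<forall>\<^sub>F n in sequentially. prob {w \<in> space M. norm (Y n w) > K} \<le> e"
    using Y unfolding tight_seq_def by blast
  with le have "\<forall>\<^sub>F n in sequentially. prob {w \<in> space M. norm (X n w) > c * K} \<le> e"
  proof eventually_elim
    case (elim n)
    have "prob {w \<in> space M. norm (X n w) > c * K} \<le> prob {w \<in> space M. norm (Y n w) > K}"
    proof (rule finite_measure_mono_AE)
      show "AE w in M. w \<in> {w \<in> space M. norm (X n w) > c * K} \<longrightarrow> w \<in> {w \<in> space M. norm (Y n w) > K}"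
        using elim(1)
      proof eventually_elim
        case (elim w)
        have "c * K < c * norm (Y n w)" if "c * K < norm (X n w)" using that elim by simp
        then show ?case using \<open>c > 0\<close> by auto
      qed
    qed measurable
    then show ?case using elim(2) by simp
  qed
  then show "\<exists>K. \<forall>\<^sub>F n in sequentially. prob {w \<in> space M. norm (X n w) > K} \<le> e" by blast
qed

lemma tight_seq_of_negligible:
  fixes X :: "nat \<Rightarrow> 'a \<Rightarrow> 'b::euclidean_space"
  assumes "negligible_seq M X" and meas[measurable]: "\<And>n. X n \<in> borel_measurable M"
  shows "tight_seq M X"
  unfolding tight_seq_def
proof (intro allI impI exI[of _ 1])
  fix e :: real assume "e > 0"
  have "\<forall>\<^sub>F n in sequentially. (\<integral>w. min 1 (norm (X n w)) \<partial>M) < e"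
    using assms(1) \<open>e > 0\<close> unfolding negligible_seq_def by (intro order_tendstoD)
  then show "\<forall>\<^sub>F n in sequentially. prob {w \<in> space M. norm (X n w) > 1} \<le> e"
  proof eventually_elim
    case (elim n)
    let ?D = "{w \<in> space M. norm (X n w) > 1}"
    have "integrable M (indicat_real ?D)"
      by (intro integrable_real_indicator) (auto simp: emeasure_eq_measure)
    then have "(\<integral>w. indicator ?D w \<partial>M) \<le> (\<integral>w. min 1 (norm (X n w)) \<partial>M)"
      by (rule integral_mono[OF _ integrable_min_1]) (auto simp: indicator_def)
    then show ?case using elim by simp
  qed
qed

lemma tight_seq_const:
  fixes Y :: "'a \<Rightarrow> 'b::euclidean_space"
  assumes "Y \<in> borel_measurable M"
  shows "tight_seq M (\<lambda>n. Y)"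
  unfolding tight_seq_def using random_vector_tight[OF assms] by (metis less_imp_le always_eventually)

text \<open>In the constant, 2 is the trivial bound for the difference of two unit numbers and
  \<open>norm \<theta>\<close> the Lipschitz constant; their sum covers both ranges of the
  minimum.\<close>

lemma iexp_perturbation:
  fixes X Y :: "'a \<Rightarrow> 'b::euclidean_space" and f :: "'a \<Rightarrow> complex"
  assumes [measurable]: "X \<in> borel_measurable M" "Y \<in> borel_measurable M" "f \<in> borel_measurable M"
    and f: "\<And>w. cmod (f w) \<le> k"
  shows "cmod ((CLINT w|M. f w * iexp (\<theta> \<bullet> X w)) - (CLINT w|M. f w * iexp (\<theta> \<bullet> Y w)))
    \<le> k * (2 + norm \<theta>) * (\<integral>w. min 1 (norm (X w - Y w)) \<partial>M)"
proof -
  have k0: "k \<ge> 0" using f by (rule order_trans[OF norm_ge_zero])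
  have i: "integrable M (\<lambda>w. f w * iexp (\<theta> \<bullet> W w))" if [measurable]: "W \<in> borel_measurable M" for W
    by (rule integrable_const_bound[where B = k]) (use f in \<open>auto simp: norm_mult\<close>)
  have "(CLINT w|M. f w * iexp (\<theta> \<bullet> X w)) - (CLINT w|M. f w * iexp (\<theta> \<bullet> Y w))
      = (CLINT w|M. f w * iexp (\<theta> \<bullet> X w) - f w * iexp (\<theta> \<bullet> Y w))"
    using i[of X] i[of Y] by simp
  also have "cmod \<dots> \<le> (\<integral>w. k * (2 + norm \<theta>) * min 1 (norm (X w - Y w)) \<partial>M)"
  proof (rule norm_integral_le)
    show "integrable M (\<lambda>w. f w * iexp (\<theta> \<bullet> X w) - f w * iexp (\<theta> \<bullet> Y w))"
      using i[of X] i[of Y] by simp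
    show "integrable M (\<lambda>w. k * (2 + norm \<theta>) * min 1 (norm (X w - Y w)))"
      by (intro integrable_mult_right integrable_min_1) simp
    fix w
    let ?a = "\<theta> \<bullet> X w" and ?b = "\<theta> \<bullet> Y w"
    let ?m = "min 1 (norm (X w - Y w))"
    have split: "iexp ?a = iexp ?b * iexp (?a - ?b)"
      by (simp add: exp_add[symmetric] right_diff_distrib)
    have "iexp ?a - iexp ?b = iexp ?b * (iexp (?a - ?b) - 1)"
      unfolding split by (simp add: algebra_simps)
    then have eq: "cmod (iexp ?a - iexp ?b) = cmod (iexp (?a - ?b) - 1)"
      by (simp add: norm_mult)
    have "cmod (iexp (?a - ?b) - 1) \<le> \<bar>?a - ?b\<bar>"
      using iexp_approx1[of "?a - ?b" 0] by simp
    also have "\<dots> \<le> norm \<theta> * norm (X w - Y w)"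
      unfolding inner_diff_right[symmetric] by (rule Cauchy_Schwarz_ineq2)
    finally have 1: "cmod (iexp ?a - iexp ?b) \<le> norm \<theta> * norm (X w - Y w)" unfolding eq .
    have 2: "cmod (iexp ?a - iexp ?b) \<le> 2"
      using norm_triangle_ineq4[of "iexp ?a" "iexp ?b"] by simp
    have "cmod (iexp ?a - iexp ?b) \<le> (2 + norm \<theta>) * ?m"
    proof (cases "norm (X w - Y w) \<le> 1")
      case True
      then have "(2 + norm \<theta>) * ?m = norm \<theta> * norm (X w - Y w) + 2 * norm (X w - Y w)"
        by (simp add: algebra_simps)
      then show ?thesis using 1 norm_ge_zero[of "X w - Y w"] by linarith
    next
      case False
      then show ?thesis using 2 by (simp add: add_increasing2)
    qed
    then have "cmod (f w) * cmod (iexp ?a - iexp ?b) \<le> k * ((2 + norm \<theta>) * ?m)"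
      using f k0 by (intro mult_mono) auto
    then show "cmod (f w * iexp ?a - f w * iexp ?b) \<le> k * (2 + norm \<theta>) * ?m"
      unfolding right_diff_distrib[symmetric] norm_mult by (simp add: mult.assoc)
  qed
  also have "\<dots> = k * (2 + norm \<theta>) * (\<integral>w. min 1 (norm (X w - Y w)) \<partial>M)"
    by simp
  finally show ?thesis .
qed

end

section \<open>The limit theorem\<close>

text \<open>With \<open>j < r \<le> n\<close> every index \<open>n - j\<close> is at least 1, so the
  value \<open>Delta U 0 = 0\<close> never enters.\<close>

lemma sum_Delta_telescope:
  assumes "r \<le> n"
  shows "U n w = (\<Sum>j<r. Delta U (n - j) w) + U (n - r) w"
  using assms
proof (induction r)
  case (Suc r)
  then have "Delta U (n - r) w = U (n - r) w - U (n - Suc r) w" by (simp add: Delta_def)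
  then show ?case using Suc by simp
qed simp

lemma matrix_inv_cancel:
  fixes B C :: "real^'n^'n"
  assumes "invertible C"
  shows "(B ** matrix_inv C) *v (C *v x) = B *v x"
proof -
  have "(B ** matrix_inv C) *v (C *v x) = (B ** (matrix_inv C ** C)) *v x"
    by (simp only: matrix_vector_mul_assoc matrix_mul_assoc)
  then show ?thesis by (simp add: matrix_mult_inv_left[OF assms])
qed

lemma rescaled_sum_decomposition:
  fixes B :: "nat \<Rightarrow> 'a \<Rightarrow> real^'n^'n"
  assumes "r \<le> n" and inv: "\<And>m. n - r \<le> m \<Longrightarrow> m \<le> n \<Longrightarrow> invertible (B m w)"
  shows "B n w *v U n w
    = (\<Sum>j<r. (B n w ** matrix_inv (B (n - j) w)) *v (B (n - j) w *v Delta U (n - j) w))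
      + (B n w ** matrix_inv (B (n - r) w)) *v (B (n - r) w *v U (n - r) w)"
proof -
  have "(\<Sum>j<r. (B n w ** matrix_inv (B (n - j) w)) *v (B (n - j) w *v Delta U (n - j) w))
      = (\<Sum>j<r. B n w *v Delta U (n - j) w)"
    using assms by (intro sum.cong refl matrix_inv_cancel inv) auto
  moreover have "(B n w ** matrix_inv (B (n - r) w)) *v (B (n - r) w *v U (n - r) w) = B n w *v U (n - r) w"
    using assms by (intro matrix_inv_cancel inv) auto
  ultimately show ?thesis
    using sum_Delta_telescope[OF assms(1), of U w]
    by (simp add: matrix_vector_right_distrib matrix_vector_mult_sum_right)
qed

section \<open>Limit of the weighted characteristic functions\<close>

context filtered_prob_space
begin

text \<open>For fixed \<open>r\<close> the first \<open>r\<close> terms converge as \<open>n\<close>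
  grows; the remaining term is small uniformly in large \<open>n\<close>, so \<open>r\<close> is
  fixed before \<open>n\<close> is sent to infinity. Smallness of \<open>matpow P r\<close> and the
  product limit \<psi> are the two facts about \<open>P\<close> that enter.\<close>

lemma characteristic_limit:
  fixes U :: "nat \<Rightarrow> 'a \<Rightarrow> real^'n" and B :: "nat \<Rightarrow> 'a \<Rightarrow> real^'n^'n" and P :: "real^'n^'n"
    and f :: "'a \<Rightarrow> complex"
  defines "V \<equiv> \<lambda>n w. B n w *v U n w"
  assumes A: "A \<in> sets Finf" "prob A > 0"
    and U_ad: "\<And>n. U n \<in> borel_measurable (F n)"
    and B_ad: "\<And>n. B n \<in> borel_measurable (F n)"
    and B_inv: "\<forall>\<^sub>F n in sequentially. AE w in M. invertible (B n w)"
    and ratio: "\<And>r. r \<ge> 1 \<Longrightarrow> tendsto_in_prob (uniform_measure M A)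
        (\<lambda>n w. B n w ** matrix_inv (B (n - r) w)) (\<lambda>_. matpow P r)"
    and V_tight: "tight_seq (uniform_measure M A) V"
    and cond: "\<And>\<theta>. tendsto_in_prob (uniform_measure M A)
        (\<lambda>n. complex_cond_exp M (F (n - 1)) (\<lambda>w. iexp (\<theta> \<bullet> (B n w *v Delta U n w)))) (\<lambda>_. \<phi> \<theta>)"
    and P: "(\<lambda>r. norm (matpow P r)) \<longlonglongrightarrow> 0"
    and \<psi>: "\<And>\<theta>. (\<lambda>r. \<Prod>j<r. \<phi> (transpose (matpow P j) *v \<theta>)) \<longlonglongrightarrow> \<psi> \<theta>"
    and f: "f \<in> borel_measurable Finf" "\<And>w. cmod (f w) \<le> k"
  shows "(\<lambda>n. CLINT w|uniform_measure M A. f w * iexp (\<theta> \<bullet> V n w))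
      \<longlonglongrightarrow> (CLINT w|uniform_measure M A. f w) * \<psi> \<theta>"
proof -
  let ?Q = "uniform_measure M A"
  have AM[measurable]: "A \<in> sets M" using A subalg_Finf by (auto simp: subalgebra_def)
  interpret Q: prob_space ?Q
    by (rule prob_space_uniform_measure) (use A in \<open>auto simp: emeasure_eq_measure\<close>)
  have [measurable]: "f \<in> borel_measurable M" using f(1) by (rule measurable_Finf_M)
  have [measurable]: "U n \<in> borel_measurable M" "B n \<in> borel_measurable M" for n
    using U_ad B_ad measurable_F_M by blast+
  have [measurable]: "Delta U n \<in> borel_measurable M" for n
    unfolding Delta_def[abs_def] by (cases "n = 0") simp_all
  define Y where "Y n w = B n w *v Delta U n w" for n w
  define D where "D r n w = B n w ** matrix_inv (B (n - r) w) - matpow P r" for r n w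
  have [measurable]: "V n \<in> borel_measurable M" "Y n \<in> borel_measurable M" "D r n \<in> borel_measurable M" for n r
    unfolding V_def Y_def D_def by measurable
  have Y_ad: "Y n \<in> borel_measurable (F n)" for n
  proof -
    have [measurable]: "U (n - Suc 0) \<in> borel_measurable (F n)"
      by (rule measurable_F_mono[OF _ U_ad]) simp
    have [measurable]: "U n \<in> borel_measurable (F n)" "B n \<in> borel_measurable (F n)"
      by (rule U_ad B_ad)+
    have "Delta U n \<in> borel_measurable (F n)"
      unfolding Delta_def[abs_def] by (cases "n = 0") simp_all
    then show ?thesis unfolding Y_def by measurable
  qed
  obtain N where N: "\<And>n. n \<ge> N \<Longrightarrow> AE w in M. invertible (B n w)"
    using B_inv by (auto simp: eventually_sequentially)
  have "AE w in M. \<forall>n. n \<ge> N \<longrightarrow> invertible (B n w)"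
    unfolding AE_all_countable using N by auto
  then have inv_all: "AE w in ?Q. \<forall>n\<ge>N. invertible (B n w)"
    by (intro AE_uniform_measureI) auto
  \<comment> \<open>The bound \<open>N + r\<close> keeps all indices from \<open>n - r\<close> to
    \<open>n\<close> where \<open>B\<close> is almost everywhere invertible, and
    \<open>r \<le> n\<close>.\<close>
  have decomp: "AE w in ?Q. V n w = (\<Sum>j<r. (D j n w + matpow P j) *v Y (n - j) w)
      + (D r n w + matpow P r) *v V (n - r) w" if "n \<ge> N + r" for n r
    using inv_all
  proof eventually_elim
    case (elim w)
    then show ?case
      using that rescaled_sum_decomposition[of r n B w U] by (simp add: V_def Y_def D_def)
  qed
  have D_negl: "negligible_seq ?Q (D r)" for r
  proof (cases "r \<ge> 1")
    case True
    then show ?thesis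
      unfolding D_def using Q.negligible_seq_of_tendsto_in_prob[OF ratio[OF True]] by simp
  next
    \<comment> \<open>Lag 0 is outside the ratio hypothesis; there \<open>D 0 n\<close> vanishes
      almost everywhere, but only once \<open>B n\<close> is invertible.\<close>
    case False
    then have "r = 0" by simp
    have zero: "negligible_seq ?Q (\<lambda>n w. 0 :: real)" by (simp add: negligible_seq_def)
    have "\<forall>\<^sub>F n in sequentially. AE w in ?Q. min 1 (norm (D r n w)) \<le> 0 * min 1 (norm (0 :: real))"
      using eventually_ge_at_top[of N]
    proof eventually_elim
      case (elim n)
      show ?case using inv_all
      proof eventually_elim
        case (elim w)
        with \<open>N \<le> n\<close> have "invertible (B n w)" by simp
        then show ?case using \<open>r = 0\<close> by (simp add: D_def matrix_mult_inv_right)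
      qed
    qed
    from Q.negligible_seq_mono[OF zero _ _ this] show ?thesis by simp
  qed
  have V_shift: "tight_seq ?Q (\<lambda>n. V (n - r))" for r
    by (rule Q.tight_seq_shift[OF V_tight])
  have DV: "negligible_seq ?Q (\<lambda>n w. D r n w *v V (n - r) w)" for r
    by (rule Q.negligible_seq_mult_tight[OF D_negl V_shift]) simp_all
  have Y_tight: "tight_seq ?Q Y"
  proof -
    have 1: "tight_seq ?Q (\<lambda>n w. - (matpow P 1 *v V (n - 1) w))"
    proof (rule Q.tight_seq_mono[OF V_shift])
      show "\<forall>\<^sub>F n in sequentially. AE w in ?Q. norm (- (matpow P 1 *v V (n - 1) w))
          \<le> (norm (matpow P 1) + 1) * norm (V (n - 1) w)"
        by (intro always_eventually allI AE_I2)
           (simp add: distrib_right add_increasing2 norm_matrix_vector_mult_le del: matpow.simps)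
    qed (simp_all add: add_nonneg_pos)
    have 2: "tight_seq ?Q (\<lambda>n w. - (D 1 n w *v V (n - 1) w))"
      by (rule Q.tight_seq_mono[OF Q.tight_seq_of_negligible[OF DV[of 1]], where c = 1]) simp_all
    have W: "tight_seq ?Q (\<lambda>n w. V n w + - (matpow P 1 *v V (n - 1) w) + - (D 1 n w *v V (n - 1) w))"
      by (intro Q.tight_seq_add V_tight 1 2) simp_all
    show ?thesis
    proof (rule Q.tight_seq_mono[OF W, where c = 1])
      show "\<forall>\<^sub>F n in sequentially. AE w in ?Q. norm (Y n w)
          \<le> 1 * norm (V n w + - (matpow P 1 *v V (n - 1) w) + - (D 1 n w *v V (n - 1) w))"
        using eventually_ge_at_top[of "N + 1"]
      proof eventually_elim
        case (elim n)
        from inv_all show ?case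
        proof eventually_elim
          case (elim w)
          have "B n w ** matrix_inv (B n w) = mat 1"
            using elim \<open>N + 1 \<le> n\<close> by (simp add: matrix_mult_inv_right)
          then have "V n w = Y n w + (D 1 n w + matpow P 1) *v V (n - 1) w"
            using elim \<open>N + 1 \<le> n\<close> rescaled_sum_decomposition[of 1 n B w U]
            by (simp add: V_def Y_def D_def)
          then show ?case by (simp add: matrix_vector_mult_add_rdistrib del: matpow.simps)
        qed
      qed
    qed simp_all
  qed
  \<comment> \<open>For large \<open>n\<close>, almost everywhere,
    \<open>V n = T r n + R r n + matpow P r *v V (n - r)\<close>: main term, negligible replacement
    error, and the term made small by the choice of \<open>r\<close>.\<close>
  define T where "T r n w = (\<Sum>j<r. matpow P j *v Y (n - j) w)" for r n w
  define R where "R r n w = (\<Sum>j<r. D j n w *v Y (n - j) w) + D r n w *v V (n - r) w" for r n w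
  have [measurable]: "T r n \<in> borel_measurable M" "R r n \<in> borel_measurable M" for r n
    unfolding T_def R_def by measurable
  have "negligible_seq ?Q (\<lambda>n w. D j n w *v Y (n - j) w)" for j
    by (rule Q.negligible_seq_mult_tight[OF D_negl Q.tight_seq_shift[OF Y_tight]]) simp_all
  then have R_negl: "negligible_seq ?Q (R r)" for r
    unfolding R_def by (intro Q.negligible_seq_add Q.negligible_seq_sum DV) simp_all
  have T_lim: "(\<lambda>n. CLINT w|?Q. f w * iexp (\<theta> \<bullet> T r n w))
      \<longlonglongrightarrow> (CLINT w|?Q. f w) * (\<Prod>j<r. \<phi> (transpose (matpow P j) *v \<theta>))" for r
  proof -
    have "\<theta> \<bullet> T r n w = (\<Sum>j<r. (transpose (matpow P j) *v \<theta>) \<bullet> Y (n - j) w)" for n w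
      by (simp add: T_def inner_sum_right dot_lmul_matrix transpose_matrix_vector)
    then show ?thesis
      using iterated_characteristic[OF A Y_ad _ f, of \<phi> "\<lambda>j. transpose (matpow P j) *v \<theta>" r] cond
      by (simp add: Y_def)
  qed
  show ?thesis
  proof (rule tendstoI)
    fix e :: real assume "e > 0"
    have k0: "k \<ge> 0" using f(2) by (rule order_trans[OF norm_ge_zero])
    define c where "c = k * (2 + norm \<theta>) + 1"
    have "c > 0" using k0 by (simp add: c_def add_nonneg_pos)
    \<comment> \<open>The error \<open>V n - T r n\<close> costs at most
      \<open>c * 3 * d = 3 e / 8\<close>: one \<open>d\<close> each for \<open>R\<close>, for the
      tail of \<open>V\<close> beyond \<open>K\<close>, and for
      \<open>K * norm (matpow P r)\<close>. For the last, \<open>K\<close> has to be fixed before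
      \<open>r\<close>. Two further errors of \<open>e / 4\<close> still leave room.\<close>
    define d where "d = e / (8 * c)"
    have "d > 0" using \<open>e > 0\<close> \<open>c > 0\<close> by (simp add: d_def)
    obtain K where K: "K \<ge> 1" "\<forall>\<^sub>F n in sequentially. Q.prob {w \<in> space ?Q. norm (V n w) > K} \<le> d"
      using Q.tight_seqE[OF V_tight _ \<open>d > 0\<close>, of 1] by auto
    let ?I = "CLINT w|?Q. f w"
    let ?prod = "\<lambda>r. \<Prod>j<r. \<phi> (transpose (matpow P j) *v \<theta>)"
    have "(\<lambda>r. K * norm (matpow P r)) \<longlonglongrightarrow> 0" using tendsto_mult_left[OF P, of K] by simp
    then have "\<forall>\<^sub>F r in sequentially. K * norm (matpow P r) < d"
      using \<open>d > 0\<close> by (intro order_tendstoD)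
    moreover have "\<forall>\<^sub>F r in sequentially. dist (?I * ?prod r) (?I * \<psi> \<theta>) < e / 4"
      by (rule tendstoD[OF tendsto_mult_left[OF \<psi>]]) (use \<open>e > 0\<close> in simp)
    ultimately have "\<forall>\<^sub>F r in sequentially. K * norm (matpow P r) < d \<and> dist (?I * ?prod r) (?I * \<psi> \<theta>) < e / 4"
      by eventually_elim simp
    then obtain r where r: "K * norm (matpow P r) < d" "dist (?I * ?prod r) (?I * \<psi> \<theta>) < e / 4"
      using eventually_happens'[OF sequentially_bot] by blast
    have "\<forall>\<^sub>F n in sequentially. (\<integral>w. min 1 (norm (R r n w)) \<partial>?Q) < d"
      using R_negl[of r] \<open>d > 0\<close> unfolding negligible_seq_def by (intro order_tendstoD)
    moreover have "\<forall>\<^sub>F n in sequentially. Q.prob {w \<in> space ?Q. norm (V (n - r) w) > K} \<le> d"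
      using eventually_compose_filterlim[OF K(2) filterlim_minus_const_nat_at_top] .
    moreover have "\<forall>\<^sub>F n in sequentially. dist (CLINT w|?Q. f w * iexp (\<theta> \<bullet> T r n w)) (?I * ?prod r) < e / 4"
      by (rule tendstoD[OF T_lim]) (use \<open>e > 0\<close> in simp)
    moreover have "\<forall>\<^sub>F n in sequentially. n \<ge> N + r" by (rule eventually_ge_at_top)
    ultimately show "\<forall>\<^sub>F n in sequentially. dist (CLINT w|?Q. f w * iexp (\<theta> \<bullet> V n w)) (?I * \<psi> \<theta>) < e"
    proof eventually_elim
      case (elim n)
      let ?PV = "\<lambda>w. matpow P r *v V (n - r) w"
      have "(\<integral>w. min 1 (norm (V n w - T r n w)) \<partial>?Q)
          \<le> (\<integral>w. min 1 (norm (R r n w)) + min 1 (norm (?PV w)) \<partial>?Q)"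
      proof (rule integral_mono_AE)
        show "AE w in ?Q. min 1 (norm (V n w - T r n w)) \<le> min 1 (norm (R r n w)) + min 1 (norm (?PV w))"
          using decomp[OF elim(4)]
        proof eventually_elim
          case (elim w)
          then have "V n w - T r n w = R r n w + ?PV w"
            by (simp add: T_def R_def matrix_vector_mult_add_rdistrib sum.distrib)
          then show ?case
            using norm_triangle_ineq[of "R r n w" "?PV w"] norm_ge_zero[of "R r n w"] norm_ge_zero[of "?PV w"]
            unfolding min_def by (smt (verit))
        qed
      qed (auto intro!: Q.integrable_min_1)
      also have "\<dots> = (\<integral>w. min 1 (norm (R r n w)) \<partial>?Q) + (\<integral>w. min 1 (norm (?PV w)) \<partial>?Q)"
        by (rule Bochner_Integration.integral_add) (auto intro!: Q.integrable_min_1)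
      also have "(\<integral>w. min 1 (norm (?PV w)) \<partial>?Q)
          \<le> Q.prob {w \<in> space ?Q. norm (V (n - r) w) > K} + K * (\<integral>w. min 1 (norm (matpow P r)) \<partial>?Q)"
        by (rule Q.integral_min_1_le) (use K(1) norm_matrix_vector_mult_le in auto)
      also have "(\<integral>w. min 1 (norm (matpow P r)) \<partial>?Q) = min 1 (norm (matpow P r))"
        using Q.prob_space by simp
      also have "K * min 1 (norm (matpow P r)) \<le> K * norm (matpow P r)"
        using K(1) by (intro mult_left_mono) auto
      finally have "(\<integral>w. min 1 (norm (V n w - T r n w)) \<partial>?Q) \<le> 3 * d"
        using elim r(1) by linarith
      then have "k * (2 + norm \<theta>) * (\<integral>w. min 1 (norm (V n w - T r n w)) \<partial>?Q) \<le> c * (3 * d)"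
        using k0 \<open>d > 0\<close> by (intro mult_mono) (auto simp: c_def intro!: integral_nonneg_AE)
      also have "c * (3 * d) = 3 / 8 * e" using \<open>c > 0\<close> by (simp add: d_def)
      finally have "dist (CLINT w|?Q. f w * iexp (\<theta> \<bullet> V n w)) (CLINT w|?Q. f w * iexp (\<theta> \<bullet> T r n w)) \<le> 3 / 8 * e"
        unfolding dist_norm by (rule order_trans[OF Q.iexp_perturbation, rotated -1]) (use f in auto)
      then show ?case
        using elim(3) r(2) \<open>e > 0\<close>
          dist_triangle[of "CLINT w|?Q. f w * iexp (\<theta> \<bullet> V n w)" "?I * \<psi> \<theta>" "CLINT w|?Q. f w * iexp (\<theta> \<bullet> T r n w)"]
          dist_triangle[of "CLINT w|?Q. f w * iexp (\<theta> \<bullet> T r n w)" "?I * \<psi> \<theta>" "?I * ?prod r"]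
        by linarith
    qed
  qed
qed

end

text \<open>Conditional expectation is self-adjoint, so it can be moved from \<open>h\<close> to the
  test variable \<xi>, which thereby becomes \<open>H\<close>-measurable; the result is then
  truncated to a bounded weight, at a cost uniform in \<open>n\<close> because \<open>h\<close> is
  bounded.\<close>

lemma (in prob_space) stably_convergesI:
  fixes X :: "nat \<Rightarrow> 'a \<Rightarrow> real^'n"
  assumes sub: "subalgebra M H"
    and X[measurable]: "\<And>n. X n \<in> borel_measurable M" "Y \<in> borel_measurable M"
    and bounded: "\<And>(g :: 'a \<Rightarrow> real) k (h :: real^'n \<Rightarrow> real).
      g \<in> borel_measurable H \<Longrightarrow> (\<And>w. \<bar>g w\<bar> \<le> k) \<Longrightarrow> continuous_on UNIV h \<Longrightarrow> bounded (range h) \<Longrightarrow>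
      (\<lambda>n. \<integral>w. g w * h (X n w) \<partial>M) \<longlonglongrightarrow> (\<integral>w. g w * h (Y w) \<partial>M)"
  shows "stably_converges M H X Y"
  unfolding stably_converges_def
proof (intro allI impI)
  fix \<xi> :: "'a \<Rightarrow> real" and h :: "real^'n \<Rightarrow> real"
  assume \<xi>: "integrable M \<xi>" and h: "continuous_on UNIV h" "bounded (range h)"
  interpret finite_measure_subalgebra M H by standard (rule sub)
  obtain H0 where H0: "\<And>x. \<bar>h x\<bar> \<le> H0" using h(2) by (auto simp: bounded_iff)
  have "H0 \<ge> 0" using H0 by (rule order_trans[OF abs_ge_zero])
  have [measurable]: "h \<in> borel_measurable borel" using h(1) by (rule borel_measurable_continuous_onI)
  define c where "c = real_cond_exp M H \<xi>"
  have cH: "c \<in> borel_measurable H" unfolding c_def by simp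
  have [measurable]: "c \<in> borel_measurable M" unfolding c_def by simp
  have c: "integrable M c" unfolding c_def by (rule real_cond_exp_int(1)[OF \<xi>])
  have swap: "(\<integral>w. \<xi> w * real_cond_exp M H (\<lambda>w. h (W w)) w \<partial>M) = (\<integral>w. c w * h (W w) \<partial>M)"
    if [measurable]: "W \<in> borel_measurable M" for W
  proof -
    let ?E = "real_cond_exp M H (\<lambda>w. h (W w))"
    have hW: "integrable M (\<lambda>w. h (W w))"
      by (rule integrable_const_bound[where B = H0]) (use H0 in auto)
    have "AE w in M. h (W w) \<le> H0" "AE w in M. - H0 \<le> h (W w)"
      using H0 by (auto simp: abs_le_iff minus_le_iff)
    then have E: "AE w in M. \<bar>?E w\<bar> \<le> H0"
      using real_cond_exp_le_c[OF hW] real_cond_exp_ge_c[OF hW] by (auto simp: abs_le_iff minus_le_iff)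
    have "integrable M (\<lambda>w. \<xi> w * ?E w)"
      by (rule integrable_mult_bounded[OF \<xi>, where c = H0]) (use E in auto)
    then have i1: "integrable M (\<lambda>w. ?E w * \<xi> w)" by (simp only: mult.commute)
    have i2: "integrable M (\<lambda>w. c w * h (W w))"
      by (rule integrable_mult_bounded[OF c, where c = H0]) (use H0 in auto)
    have "(\<integral>w. \<xi> w * ?E w \<partial>M) = (\<integral>w. ?E w * c w \<partial>M)"
      using real_cond_exp_intg(2)[OF i1] \<xi> by (simp add: c_def mult.commute)
    also have "\<dots> = (\<integral>w. c w * h (W w) \<partial>M)"
      using real_cond_exp_intg(2)[OF i2 cH] by (simp add: mult.commute)
    finally show ?thesis .
  qed
  have "(\<lambda>n. \<integral>w. c w * h (X n w) \<partial>M) \<longlonglongrightarrow> (\<integral>w. c w * h (Y w) \<partial>M)"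
  proof (rule tendstoI)
    fix e :: real assume "e > 0"
    define g where "g k w = (if \<bar>c w\<bar> \<le> real k then c w else 0)" for k w
    have gH: "g k \<in> borel_measurable H" for k unfolding g_def using cH by measurable
    have [measurable]: "g k \<in> borel_measurable M" for k unfolding g_def by measurable
    have gk: "\<bar>g k w\<bar> \<le> real k" for k w by (simp add: g_def)
    have gi: "integrable M (g k)" for k
      by (rule integrable_const_bound[where B = "real k"]) (use gk in auto)
    have "(\<lambda>k. \<integral>w. \<bar>c w - g k w\<bar> \<partial>M) \<longlonglongrightarrow> (\<integral>w. 0 \<partial>M)"
    proof (rule integral_dominated_convergence[where w = "\<lambda>w. \<bar>c w\<bar>"])
      show "AE w in M. (\<lambda>k. \<bar>c w - g k w\<bar>) \<longlonglongrightarrow> 0"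
      proof (rule AE_I2)
        fix w
        obtain k0 where k0: "\<bar>c w\<bar> \<le> real k0" using real_arch_simple by blast
        have "\<forall>\<^sub>F k in sequentially. \<bar>c w - g k w\<bar> = 0"
          by (rule eventually_mono[OF eventually_ge_at_top[of k0]]) (use k0 in \<open>auto simp: g_def\<close>)
        then show "(\<lambda>k. \<bar>c w - g k w\<bar>) \<longlonglongrightarrow> 0" by (rule tendsto_eventually)
      qed
      show "AE w in M. norm \<bar>c w - g k w\<bar> \<le> \<bar>c w\<bar>" for k by (auto simp: g_def)
    qed (use c in auto)
    then have "(\<lambda>k. H0 * (\<integral>w. \<bar>c w - g k w\<bar> \<partial>M)) \<longlonglongrightarrow> H0 * 0" by (intro tendsto_intros) simp
    then have "\<forall>\<^sub>F k in sequentially. H0 * (\<integral>w. \<bar>c w - g k w\<bar> \<partial>M) < e / 3"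
      using \<open>e > 0\<close> by (intro order_tendstoD) auto
    then obtain k where k: "H0 * (\<integral>w. \<bar>c w - g k w\<bar> \<partial>M) < e / 3"
      using eventually_happens'[OF sequentially_bot] by blast
    have close: "dist (\<integral>w. c w * h (W w) \<partial>M) (\<integral>w. g k w * h (W w) \<partial>M) < e / 3"
      if [measurable]: "W \<in> borel_measurable M" for W
    proof -
      have i: "integrable M (\<lambda>w. u w * h (W w))" if "integrable M u" for u
        by (rule integrable_mult_bounded[OF that, where c = H0]) (use H0 in auto)
      have split: "(\<integral>w. c w * h (W w) \<partial>M) - (\<integral>w. g k w * h (W w) \<partial>M) = (\<integral>w. (c w - g k w) * h (W w) \<partial>M)"
        using i[OF c] i[OF gi] by (simp add: left_diff_distrib)
      have "norm (\<integral>w. (c w - g k w) * h (W w) \<partial>M) \<le> (\<integral>w. H0 * \<bar>c w - g k w\<bar> \<partial>M)"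
      proof (rule norm_integral_le)
        show "integrable M (\<lambda>w. (c w - g k w) * h (W w))" using c gi by (intro i) simp
        show "integrable M (\<lambda>w. H0 * \<bar>c w - g k w\<bar>)" using c gi by simp
        show "norm ((c w - g k w) * h (W w)) \<le> H0 * \<bar>c w - g k w\<bar>" for w
          using mult_left_mono[OF H0, of "\<bar>c w - g k w\<bar>"] by (simp add: abs_mult mult.commute)
      qed
      then show ?thesis using k unfolding dist_norm split by simp
    qed
    have "\<forall>\<^sub>F n in sequentially. dist (\<integral>w. g k w * h (X n w) \<partial>M) (\<integral>w. g k w * h (Y w) \<partial>M) < e / 3"
      by (rule tendstoD[OF bounded[OF gH gk h]]) (use \<open>e > 0\<close> in simp)
    then show "\<forall>\<^sub>F n in sequentially. dist (\<integral>w. c w * h (X n w) \<partial>M) (\<integral>w. c w * h (Y w) \<partial>M) < e"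
    proof eventually_elim
      case (elim n)
      show ?case
        using close[OF X(1), of n] close[OF X(2)] elim
        by (smt (verit) dist_commute dist_triangle field_sum_of_halves divide_nonneg_nonneg dist_triangle_third)
    qed
  qed
  then show "(\<lambda>n. \<integral>w. \<xi> w * real_cond_exp M H (\<lambda>w. h (X n w)) w \<partial>M)
      \<longlonglongrightarrow> (\<integral>w. \<xi> w * real_cond_exp M H (\<lambda>w. h (Y w)) w \<partial>M)"
    by (simp add: swap)
qed

text \<open>No continuity of the matrix inverse is needed: on \<open>|\<eta>\<^sup>-\<^sup>1| \<le> \<kappa>\<close> and \<open>|H\<^sub>n - \<eta>| \<le> 1 / (2 \<kappa>)\<close> one has
  \<open>|V\<^sub>n| \<le> \<kappa> |\<eta> V\<^sub>n| \<le> \<kappa> |H\<^sub>n V\<^sub>n| + |V\<^sub>n| / 2\<close>.\<close>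

lemma (in prob_space) tight_seq_cancel_matrix:
  fixes H :: "nat \<Rightarrow> 'a \<Rightarrow> real^'n^'n" and V :: "nat \<Rightarrow> 'a \<Rightarrow> real^'n"
  assumes H: "tendsto_in_prob M H \<eta>" and inv: "AE w in M. invertible (\<eta> w)"
    and HV: "tight_seq M (\<lambda>n w. H n w *v V n w)"
    and [measurable]: "\<And>n. H n \<in> borel_measurable M" "\<And>n. V n \<in> borel_measurable M" "\<eta> \<in> borel_measurable M"
  shows "tight_seq M V"
  unfolding tight_seq_def
proof (intro allI impI)
  fix e :: real assume "e > 0"
  then have e3: "e / 3 > 0" by simp
  let ?inv = "\<lambda>w. matrix_inv (\<eta> w)"
  have "?inv \<in> borel_measurable M" by measurable
  then obtain \<kappa> where \<kappa>: "\<kappa> > 0" "prob {w \<in> space M. norm (?inv w) > \<kappa>} < e / 3"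
    using random_vector_tight[OF _ e3] by blast
  obtain K where K: "\<forall>\<^sub>F n in sequentially. prob {w \<in> space M. norm (H n w *v V n w) > K} \<le> e / 3"
    using HV e3 unfolding tight_seq_def by blast
  have "(\<lambda>n. prob {w \<in> space M. dist (H n w) (\<eta> w) > 1 / (2 * \<kappa>)}) \<longlonglongrightarrow> 0"
    using H[unfolded tendsto_in_prob_def, rule_format, of "1 / (2 * \<kappa>)"] \<kappa> by simp
  then have "\<forall>\<^sub>F n in sequentially. prob {w \<in> space M. dist (H n w) (\<eta> w) > 1 / (2 * \<kappa>)} < e / 3"
    using e3 by (rule order_tendstoD)
  with K have "\<forall>\<^sub>F n in sequentially. prob {w \<in> space M. norm (V n w) > 2 * \<kappa> * K} \<le> e"
  proof eventually_elim
    case (elim n)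
    let ?A = "{w \<in> space M. norm (H n w *v V n w) > K}"
    let ?B = "{w \<in> space M. dist (H n w) (\<eta> w) > 1 / (2 * \<kappa>)}"
    let ?C = "{w \<in> space M. norm (?inv w) > \<kappa>}"
    have "prob {w \<in> space M. norm (V n w) > 2 * \<kappa> * K} \<le> prob (?A \<union> (?B \<union> ?C))"
    proof (rule finite_measure_mono_AE)
      show "AE w in M. w \<in> {w \<in> space M. norm (V n w) > 2 * \<kappa> * K} \<longrightarrow> w \<in> ?A \<union> (?B \<union> ?C)"
        using inv AE_space
      proof eventually_elim
        case (elim w)
        let ?v = "V n w"
        have "norm ?v \<le> 2 * \<kappa> * K" if A: "norm (H n w *v ?v) \<le> K"
          and B: "dist (H n w) (\<eta> w) \<le> 1 / (2 * \<kappa>)" and C: "norm (?inv w) \<le> \<kappa>"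
        proof -
          have "?v = ?inv w *v (\<eta> w *v ?v)"
            using elim(1) by (simp add: matrix_vector_mul_assoc matrix_mult_inv_left)
          then have "norm ?v \<le> norm (?inv w) * norm (\<eta> w *v ?v)"
            by (metis norm_matrix_vector_mult_le)
          also have "\<dots> \<le> \<kappa> * norm (\<eta> w *v ?v)" using C by (intro mult_right_mono) auto
          also have "norm (\<eta> w *v ?v) \<le> norm (H n w *v ?v) + norm ((H n w - \<eta> w) *v ?v)"
            unfolding matrix_vector_mult_diff_rdistrib using norm_triangle_ineq4[of "H n w *v ?v" "(H n w *v ?v) - \<eta> w *v ?v"] by simp
          also have "norm ((H n w - \<eta> w) *v ?v) \<le> 1 / (2 * \<kappa>) * norm ?v"
            using B by (intro order_trans[OF norm_matrix_vector_mult_le] mult_right_mono) (auto simp: dist_norm)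
          finally have "norm ?v \<le> \<kappa> * (norm (H n w *v ?v) + 1 / (2 * \<kappa>) * norm ?v)"
            using \<kappa>(1) by (simp add: mult_left_mono)
          also have "\<dots> = \<kappa> * norm (H n w *v ?v) + norm ?v / 2"
            using \<kappa>(1) by (simp add: distrib_left)
          finally have "norm ?v \<le> 2 * (\<kappa> * norm (H n w *v ?v))" by simp
          also have "\<dots> \<le> 2 * (\<kappa> * K)" using A \<kappa>(1) by (intro mult_left_mono) auto
          finally show ?thesis by simp
        qed
        then show ?case using elim(2) by force
      qed
    qed measurable
    also have "\<dots> \<le> prob ?A + prob (?B \<union> ?C)" by (intro measure_Un_le) measurable
    also have "prob (?B \<union> ?C) \<le> prob ?B + prob ?C" by (intro measure_Un_le) measurable
    finally show ?case using elim \<kappa>(2) by linarith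
  qed
  then show "\<exists>K. \<forall>\<^sub>F n in sequentially. prob {w \<in> space M. norm (V n w) > K} \<le> e" by blast
qed

text \<open>The measure conditioned on \<open>A\<close> is dominated by
  \<open>prob G / prob A\<close> times the one conditioned on \<open>G\<close>.\<close>

lemma (in prob_space) tendsto_in_prob_uniform_subset:
  assumes "tendsto_in_prob (uniform_measure M G) X Y" "A \<subseteq> G"
    and [measurable]: "A \<in> sets M" "G \<in> sets M" and "prob A > 0"
    and [measurable]: "\<And>n. (\<lambda>w. dist (X n w) (Y w)) \<in> borel_measurable M"
  shows "tendsto_in_prob (uniform_measure M A) X Y"
  unfolding tendsto_in_prob_def
proof (intro allI impI)
  fix e :: real assume "e > 0"
  let ?D = "\<lambda>n. {w \<in> space M. dist (X n w) (Y w) > e}"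
  have G: "prob G > 0" using assms(2,5) finite_measure_mono[of A G] by simp
  have D[measurable]: "?D n \<in> sets M" for n by measurable
  note unif = measure_uniform_measure'[OF \<open>A \<in> sets M\<close> \<open>prob A > 0\<close> D]
    measure_uniform_measure'[OF \<open>G \<in> sets M\<close> G D]
  have "(\<lambda>n. measure (uniform_measure M G) (?D n)) \<longlonglongrightarrow> 0"
    using assms(1) \<open>e > 0\<close> by (simp add: tendsto_in_prob_def)
  from tendsto_mult_left[OF this, of "prob G / prob A"]
  have lim: "(\<lambda>n. prob G / prob A * measure (uniform_measure M G) (?D n)) \<longlonglongrightarrow> 0" by simp
  have "measure (uniform_measure M A) (?D n) \<le> prob G / prob A * measure (uniform_measure M G) (?D n)" for n
  proof -
    have "prob (A \<inter> ?D n) \<le> prob (G \<inter> ?D n)" by (intro finite_measure_mono) (use assms(2) in auto)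
    then show ?thesis using G assms(5) unfolding unif by (simp add: divide_right_mono)
  qed
  then have "(\<lambda>n. measure (uniform_measure M A) (?D n)) \<longlonglongrightarrow> 0"
    by (intro tendsto_sandwich[OF _ _ tendsto_const lim]) auto
  then show "(\<lambda>n. measure (uniform_measure M A) {w \<in> space (uniform_measure M A). dist (X n w) (Y w) > e}) \<longlonglongrightarrow> 0"
    by simp
qed

section \<open>Independence under the conditioned measure\<close>

context filtered_prob_space
begin

text \<open>Because \<open>A\<close> itself belongs to \<open>Finf\<close>, so does
  \<open>A \<inter> b\<close>; conditioning on \<open>A\<close> leaves the law of \<open>Z\<close>
  unchanged and preserves independence.\<close>

lemma indep_of_uniform_measure:
  fixes Z :: "'a \<Rightarrow> real^'n"
  assumes A: "A \<in> sets Finf" "prob A > 0" and [measurable]: "Z \<in> borel_measurable M" and Z: "indep_of M borel Z Finf"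
  shows "indep_of (uniform_measure M A) borel Z Finf"
proof -
  let ?Q = "uniform_measure M A"
  have AM[measurable]: "A \<in> sets M" using A subalg_Finf by (auto simp: subalgebra_def)
  interpret Q: prob_space ?Q
    by (rule prob_space_uniform_measure) (use A in \<open>auto simp: emeasure_eq_measure\<close>)
  let ?S = "sets (vimage_algebra (space M) Z borel)"
  have indep: "prob (a \<inter> b) = prob a * prob b" if "a \<in> ?S" "b \<in> sets Finf" for a b
    using Z that unfolding indep_of_def by (intro indep_setD)
  have S: "?S \<subseteq> sets M" by (subst sets_vimage_algebra2) auto
  have F: "sets Finf \<subseteq> sets M" using subalg_Finf by (auto simp: subalgebra_def)
  have "Q.indep_set ?S (sets Finf)"
  proof (rule Q.indep_setI)
    fix a b assume ab: "a \<in> ?S" "b \<in> sets Finf"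
    then have M: "a \<in> sets M" "b \<in> sets M" using S F by auto
    have "prob (A \<inter> (a \<inter> b)) = prob (a \<inter> (A \<inter> b))" by (simp add: Int_left_commute Int_commute)
    also have "\<dots> = prob a * prob (A \<inter> b)" using ab A by (intro indep) auto
    finally have 1: "prob (A \<inter> (a \<inter> b)) = prob a * prob (A \<inter> b)" .
    have 2: "prob (A \<inter> a) = prob a * prob A" using indep[OF ab(1) A(1)] by (simp add: Int_commute)
    show "Q.prob (a \<inter> b) = Q.prob a * Q.prob b"
      using M A(2) by (simp add: measure_uniform_measure'[OF AM A(2)] 1 2)
  qed (use S F in auto)
  then show ?thesis by (simp add: indep_of_def)
qed

text \<open>With the density of the conditioned measure inside the weight, this is the product rule
  under \<open>M\<close>; hence the second factor on the right is an integral over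
  \<open>M\<close>.\<close>

lemma indep_integral_uniform_measure:
  fixes Z :: "'a \<Rightarrow> real^'n" and f :: "'a \<Rightarrow> complex" and h :: "real^'n \<Rightarrow> complex"
  assumes A: "A \<in> sets Finf" "prob A > 0" and [measurable]: "Z \<in> borel_measurable M" and Z: "indep_of M borel Z Finf"
    and f: "f \<in> borel_measurable Finf" "\<And>w. cmod (f w) \<le> k"
    and h[measurable]: "h \<in> borel_measurable borel" and hb: "\<And>x. cmod (h x) \<le> l"
  shows "(CLINT w|uniform_measure M A. f w * h (Z w))
    = (CLINT w|uniform_measure M A. f w) * (CLINT w|M. h (Z w))"
proof -
  have AM[measurable]: "A \<in> sets M" using A subalg_Finf by (auto simp: subalgebra_def)
  have fM[measurable]: "f \<in> borel_measurable M" using f(1) by (rule measurable_Finf_M)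
  define g where "g w = (indicator A w / prob A) *\<^sub>R f w" for w
  have gF: "g \<in> borel_measurable Finf" unfolding g_def using f(1) A(1) by measurable
  have [measurable]: "g \<in> borel_measurable M" using gF by (rule measurable_Finf_M)
  have g: "integrable M g"
  proof (rule integrable_const_bound[where B = "k / prob A"])
    show "AE w in M. norm (g w) \<le> k / prob A"
      using f(2) A(2) order_trans[OF norm_ge_zero f(2)]
      by (auto simp: g_def indicator_def divide_right_mono)
  qed simp
  have hZ: "integrable M (\<lambda>w. h (Z w))"
    by (rule integrable_const_bound[where B = l]) (use hb in auto)
  have "indep_var borel (\<lambda>w. h (Z w)) borel g"
    unfolding indep_var_eq
  proof (intro conjI)
    let ?S = "sets (vimage_algebra (space M) Z borel)"
    have "sigma_sets (space M) {(\<lambda>w. h (Z w)) -` B \<inter> space M |B. B \<in> sets borel} \<subseteq> ?S"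
    proof -
      have "(\<lambda>w. h (Z w)) -` B \<inter> space M \<in> ?S" if "B \<in> sets borel" for B
      proof -
        have "(\<lambda>w. h (Z w)) -` B \<inter> space M = Z -` (h -` B) \<inter> space M" by auto
        then show ?thesis
          using measurable_sets[OF h that] by (auto intro: in_vimage_algebra)
      qed
      then have "{(\<lambda>w. h (Z w)) -` B \<inter> space M |B. B \<in> sets borel} \<subseteq> ?S" by auto
      from sets.sigma_sets_subset[OF this] show ?thesis by simp
    qed
    moreover have "sigma_sets (space M) {g -` B \<inter> space M |B. B \<in> sets borel} \<subseteq> sets Finf"
    proof -
      have "{g -` B \<inter> space M |B. B \<in> sets borel} \<subseteq> sets Finf"
        using measurable_sets[OF gF] by (auto simp: space_Finf)
      from sets.sigma_sets_subset[OF this] show ?thesis by (simp add: space_Finf)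
    qed
    ultimately show "indep_set (sigma_sets (space M) {(\<lambda>w. h (Z w)) -` B \<inter> space M |B. B \<in> sets borel})
        (sigma_sets (space M) {g -` B \<inter> space M |B. B \<in> sets borel})"
      using Z unfolding indep_of_def indep_set_def
      by (elim indep_sets_mono_sets) (auto split: bool.split)
  qed simp_all
  then have "(CLINT w|M. h (Z w) * g w) = (CLINT w|M. h (Z w)) * (CLINT w|M. g w)"
    by (rule indep_var_lebesgue_integral[OF _ hZ g])
  then show ?thesis
    using A by (simp add: integral_uniform_measure g_def mult.commute)
qed

end

lemma (in prob_space) tight_seq_Pair:
  fixes X :: "nat \<Rightarrow> 'a \<Rightarrow> 'b::euclidean_space" and Y :: "nat \<Rightarrow> 'a \<Rightarrow> 'c::euclidean_space"
  assumes X: "tight_seq M X" and Y: "tight_seq M Y"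
    and [measurable]: "\<And>n. X n \<in> borel_measurable M" "\<And>n. Y n \<in> borel_measurable M"
  shows "tight_seq M (\<lambda>n w. (X n w, Y n w))"
proof -
  have "tight_seq M (\<lambda>n w. (X n w, 0 :: 'c))"
    by (rule tight_seq_mono[OF X, where c = 1]) (simp_all add: norm_Pair)
  moreover have "tight_seq M (\<lambda>n w. (0 :: 'b, Y n w))"
    by (rule tight_seq_mono[OF Y, where c = 1]) (simp_all add: norm_Pair)
  ultimately have "tight_seq M (\<lambda>n w. (X n w, 0) + (0, Y n w))"
    by (rule tight_seq_add) simp_all
  then show ?thesis by simp
qed

lemma summable_norm_matpow_transpose:
  fixes P :: "real^'n^'n"
  assumes "spectral_radius P < 1"
  shows "summable (\<lambda>j. norm (matpow P j))" "summable (\<lambda>j. norm (transpose (matpow P j) *v \<theta>))"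
proof -
  obtain C \<rho> where C: "0 < \<rho>" "\<rho> < 1" "\<And>k. norm (matpow P k) \<le> C * \<rho> ^ k"
    by (rule matpow_geometric_decay[OF assms], rule that)
  have "summable (\<lambda>j. C * \<rho> ^ j)" using C by (intro summable_mult summable_geometric) simp
  then show 1: "summable (\<lambda>j. norm (matpow P j))"
    by (rule summable_comparison_test'[where N = 0]) (use C in simp)
  show "summable (\<lambda>j. norm (transpose (matpow P j) *v \<theta>))"
    by (rule summable_comparison_test'[OF summable_mult2[OF 1, of "norm \<theta>"], where N = 0])
       (use norm_transpose_mult_le[of "matpow P j" \<theta> for j] in simp)
qed

theorem corollary1p9:
  fixes M :: "'a measure"
    and F :: "nat \<Rightarrow> 'a measure"
    and Finf :: "'a measure"
    and U :: "nat \<Rightarrow> 'a \<Rightarrow> real^'n"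
    and B :: "nat \<Rightarrow> 'a \<Rightarrow> real^'n^'n"
    and Q :: "nat \<Rightarrow> real^'n^'n"
    and G E :: "'a set"
    and \<alpha> :: real
    and \<zeta> :: "'a \<Rightarrow> real^'n"
    and \<mu> \<Lambda> :: "(real^'n) measure"
    and \<eta> :: "'a \<Rightarrow> real^'n^'n"
    and P :: "real^'n^'n"
  assumes prob: "prob_space M"
    and filt: "filtration (space M) F"
    and subalg: "\<And>n. subalgebra M (F n)"
    and Finf_eq: "Finf = limit_algebra (space M) F"
    and U_adapted: "\<And>n. U n \<in> borel_measurable (F n)"
    and B_adapted: "\<And>n. B n \<in> borel_measurable (F n)"
    and B_inv: "\<forall>\<^sub>F n in sequentially. AE \<omega> in M. invertible (B n \<omega>)"
    and Q_lim: "Q \<longlonglongrightarrow> 0"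
    and Q_inv: "\<forall>\<^sub>F n in sequentially. invertible (Q n)"
    and G_meas: "G \<in> sets Finf"
    and G_pos: "measure M G > 0"
    and alpha: "0 < \<alpha>" "\<alpha> < 2"
    and zeta_rv: "\<zeta> \<in> borel_measurable M"
    and mu: "\<mu> = distr M borel \<zeta>"
    and zeta_stable: "symmetric_stable \<alpha> \<mu>"
    and zeta_spectral: "spectral_measure \<alpha> \<mu> \<Lambda>"
    and rich: "carries_iid_indep_of M \<mu> Finf"
    and E_eq: "E = {\<omega> \<in> space M. invertible (\<eta> \<omega>)}"
    and i_meas: "\<eta> \<in> borel_measurable Finf"
    and i_pos: "measure M (G \<inter> E) > 0"
    and i_conv: "tendsto_in_prob (uniform_measure M G) (\<lambda>n \<omega>. Q n ** matrix_inv (B n \<omega>)) \<eta>"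
    and ii: "((\<lambda>K :: real. SUP n\<in>{1..}.
                measure (uniform_measure M (G \<inter> E)) {\<omega> \<in> space M. norm (Q n *v U n \<omega>) > K})
              \<longlongrightarrow> 0) at_top"
    and iii_inv: "invertible P"
    and iii_radius: "spectral_radius P < 1"
    and iii_conv: "\<And>r. r \<ge> 1 \<Longrightarrow>
           tendsto_in_prob (uniform_measure M G)
             (\<lambda>n \<omega>. B n \<omega> ** matrix_inv (B (n - r) \<omega>)) (\<lambda>_. matpow P r)"
    and iv: "\<And>\<theta>. tendsto_in_prob (uniform_measure M (G \<inter> E))
             (\<lambda>n. complex_cond_exp M (F (n - 1)) (\<lambda>\<omega>. iexp (\<theta> \<bullet> (B n \<omega> *v Delta U n \<omega>))))
             (\<lambda>_. CLINT x|\<mu>. iexp (\<theta> \<bullet> x))"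
  shows "(\<exists>Z. indep_vector_with_char M Finf (limit_char \<alpha> \<Lambda> P) Z) \<and>
    (\<forall>Z. indep_vector_with_char M Finf (limit_char \<alpha> \<Lambda> P) Z \<longrightarrow>
       mixing_converges (uniform_measure M (G \<inter> E)) Finf (\<lambda>n \<omega>. B n \<omega> *v U n \<omega>) Z \<and>
       stably_converges (uniform_measure M (G \<inter> E)) Finf
         (\<lambda>n \<omega>. Q n *v U n \<omega>) (\<lambda>\<omega>. \<eta> \<omega> *v Z \<omega>) \<and>
       (distr M borel \<zeta> = cauchy_law \<longrightarrow>
          (\<forall>\<theta>. char_vec (distr M borel Z) \<theta> =
             complex_of_real (exp (- (\<Sum>j. norm (transpose (matpow P j) *v \<theta>)))))))"
proof -
  interpret prob_space M by (rule prob)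
  interpret filtered_prob_space M F Finf
    by (intro filtered_prob_space.intro filtered_prob_space_axioms.intro prob filt subalg Finf_eq)
  define A where "A = G \<inter> E"
  let ?QA = "uniform_measure M A"
  have [measurable]: "U n \<in> borel_measurable M" "B n \<in> borel_measurable M" for n
    using U_adapted B_adapted measurable_F_M by blast+
  have \<eta>M[measurable]: "\<eta> \<in> borel_measurable M" using i_meas by (rule measurable_Finf_M)
  have E: "E \<in> sets Finf"
  proof -
    have "E = {w \<in> space Finf. det (\<eta> w) \<noteq> 0}"
      by (simp add: E_eq space_Finf invertible_det_nz)
    also have "\<dots> \<in> sets Finf" using borel_measurable_det[OF i_meas] by measurable
    finally show ?thesis .
  qed
  have A: "A \<in> sets Finf" "prob A > 0"
    using E G_meas i_pos by (auto simp: A_def)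
  have Finf_M: "sets Finf \<subseteq> sets M" using subalg_Finf by (auto simp: subalgebra_def)
  then have AM[measurable]: "A \<in> sets M" and GM[measurable]: "G \<in> sets M" using A G_meas by auto
  interpret QA: prob_space ?QA
    by (rule prob_space_uniform_measure) (use A in \<open>auto simp: emeasure_eq_measure\<close>)
  have \<mu>: "prob_space \<mu>" unfolding mu by (rule prob_space_distr[OF zeta_rv])
  define \<psi> where "\<psi> = limit_char \<alpha> \<Lambda> P"
  have prod_lim: "(\<lambda>r. \<Prod>j<r. char_vec \<mu> (transpose (matpow P j) *v \<theta>)) \<longlonglongrightarrow> \<psi> \<theta>" for \<theta>
    unfolding \<psi>_def by (rule prod_char_tendsto_limit_char[OF zeta_spectral alpha(1) iii_radius])

  \<comment> \<open>Once \<open>B n\<close> is invertible, \<open>Q n *v U n\<close> is the product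
    \<open>H n *v V n\<close>, whose factors converge in different senses and so have to be treated
    jointly.\<close>
  define H where "H n w = Q n ** matrix_inv (B n w)" for n w
  define V where "V n w = B n w *v U n w" for n w
  have [measurable]: "H n \<in> borel_measurable M" "V n \<in> borel_measurable M" for n
    unfolding H_def V_def by measurable
  have "A \<subseteq> G" by (simp add: A_def)
  have H_lim: "tendsto_in_prob ?QA H \<eta>"
    by (rule tendsto_in_prob_uniform_subset[OF _ \<open>A \<subseteq> G\<close> AM GM A(2)])
       (use i_conv in \<open>simp_all add: H_def[abs_def]\<close>)
  have ratio: "tendsto_in_prob ?QA (\<lambda>n w. B n w ** matrix_inv (B (n - r) w)) (\<lambda>_. matpow P r)"
    if "r \<ge> 1" for r
    by (rule tendsto_in_prob_uniform_subset[OF iii_conv[OF that] \<open>A \<subseteq> G\<close> AM GM A(2)]) measurable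
  have \<eta>_inv: "AE w in ?QA. invertible (\<eta> w)"
    by (rule AE_uniform_measureI[OF AM]) (auto simp: A_def E_eq)
  have HV: "\<forall>\<^sub>F n in sequentially. AE w in ?QA. H n w *v V n w = Q n *v U n w"
    using B_inv
  proof eventually_elim
    case (elim n)
    have "AE w in M. H n w *v V n w = Q n *v U n w"
      using elim by eventually_elim (simp add: H_def V_def matrix_inv_cancel)
    then show ?case by (intro AE_uniform_measureI) auto
  qed
  have QU_tight: "tight_seq ?QA (\<lambda>n w. Q n *v U n w)"
    unfolding tight_seq_def
  proof (intro allI impI)
    fix e :: real assume "e > 0"
    let ?p = "\<lambda>n K. QA.prob {w \<in> space M. norm (Q n *v U n w) > K}"
    \<comment> \<open>Hypothesis (ii) is a limit in \<open>K\<close> of suprema over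
      \<open>n\<close>, so a single \<open>K\<close> serves all \<open>n \<ge> 1\<close>; the
      supremum is bounded by 1.\<close>
    have "\<forall>\<^sub>F K in at_top. (SUP n\<in>{1..}. ?p n K) < e"
      using order_tendstoD(2)[OF ii \<open>e > 0\<close>] by (simp add: A_def)
    then obtain K where K: "(SUP n\<in>{1..}. ?p n K) < e"
      using eventually_happens'[OF trivial_limit_at_top_linorder] by blast
    have "?p n K \<le> e" if "n \<ge> 1" for n
    proof -
      have "?p n K \<le> (SUP n\<in>{1..}. ?p n K)"
        using that by (intro cSUP_upper bdd_aboveI[of _ 1]) auto
      then show ?thesis using K by simp
    qed
    then have "\<forall>\<^sub>F n in sequentially. QA.prob {w \<in> space ?QA. norm (Q n *v U n w) > K} \<le> e"
      unfolding eventually_sequentially by (intro exI[of _ 1]) auto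
    then show "\<exists>K. \<forall>\<^sub>F n in sequentially. QA.prob {w \<in> space ?QA. norm (Q n *v U n w) > K} \<le> e"
      by blast
  qed
  have "tight_seq ?QA (\<lambda>n w. H n w *v V n w)"
  proof (rule QA.tight_seq_mono[OF QU_tight, where c = 1])
    show "\<forall>\<^sub>F n in sequentially. AE w in ?QA. norm (H n w *v V n w) \<le> 1 * norm (Q n *v U n w)"
      by (rule eventually_mono[OF HV]) (rule eventually_mono, assumption, simp)
  qed simp_all
  then have V_tight: "tight_seq ?QA V"
    by (rule QA.tight_seq_cancel_matrix[OF H_lim \<eta>_inv]) simp_all
  have H_negl: "negligible_seq ?QA (\<lambda>n w. H n w - \<eta> w)"
    by (rule QA.negligible_seq_of_tendsto_in_prob[OF H_lim]) simp_all
  \<comment> \<open>\<open>H n\<close> is a negligible sequence plus the fixed random matrix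
    \<eta>.\<close>
  have H_tight: "tight_seq ?QA H"
    using QA.tight_seq_add[OF QA.tight_seq_of_negligible[OF H_negl] QA.tight_seq_const[of \<eta>]] by simp
  have V_char: "(\<lambda>n. CLINT w|?QA. f w * iexp (\<theta> \<bullet> V n w)) \<longlonglongrightarrow> (CLINT w|?QA. f w) * \<psi> \<theta>"
    if f: "f \<in> borel_measurable Finf" "\<And>w. cmod (f w) \<le> k" for f k \<theta>
    unfolding V_def
  proof (rule characteristic_limit[OF A U_adapted B_adapted B_inv ratio _ _ _ prod_lim f])
    show "tight_seq ?QA (\<lambda>n w. B n w *v U n w)" using V_tight by (simp add: V_def[abs_def])
    show "tendsto_in_prob ?QA
        (\<lambda>n. complex_cond_exp M (F (n - 1)) (\<lambda>w. iexp (\<theta> \<bullet> (B n w *v Delta U n w)))) (\<lambda>_. char_vec \<mu> \<theta>)" for \<theta>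
      using iv[of \<theta>] by (simp add: A_def char_vec_def)
    show "(\<lambda>r. norm (matpow P r)) \<longlonglongrightarrow> 0"
      by (rule summable_LIMSEQ_zero[OF summable_norm_matpow_transpose(1)[OF iii_radius]])
  qed

  have main: "mixing_converges ?QA Finf V Z \<and> stably_converges ?QA Finf (\<lambda>n w. Q n *v U n w) (\<lambda>w. \<eta> w *v Z w)"
    if Z: "indep_vector_with_char M Finf \<psi> Z" for Z
  proof -
    have [measurable]: "Z \<in> borel_measurable M" and Zi: "indep_of M borel Z Finf"
      and Zc: "\<And>\<theta>. (CLINT w|M. iexp (\<theta> \<bullet> Z w)) = \<psi> \<theta>"
      using Z by (auto simp: indep_vector_with_char_def char_vec_def integral_distr)
    \<comment> \<open>Composing the test function with \<open>snd\<close> gives the claim on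
      \<open>V\<close>, and with the matrix-vector product the claim on
      \<open>Q n *v U n\<close>.\<close>
    have joint: "(\<lambda>n. \<integral>w. g w * h (H n w, V n w) \<partial>?QA) \<longlonglongrightarrow> (\<integral>w. g w * h (\<eta> w, Z w) \<partial>?QA)"
      if g: "g \<in> borel_measurable Finf" "\<And>w. \<bar>g w\<bar> \<le> k" and h: "continuous_on UNIV h" "bounded (range h)"
      for g :: "'a \<Rightarrow> real" and k and h :: "(real^'n^'n) \<times> (real^'n) \<Rightarrow> real"
    proof -
      have gM[measurable]: "g \<in> borel_measurable M" using g(1) by (rule measurable_Finf_M)
      have "(\<lambda>n. CLINT w|?QA. g w * iexp (t \<bullet> (H n w, V n w)))
          \<longlonglongrightarrow> (CLINT w|?QA. g w * iexp (t \<bullet> (\<eta> w, Z w)))" for t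
      proof -
        obtain T \<tau> where t: "t = (T, \<tau>)" by (cases t)
        define f where "f w = complex_of_real (g w) * iexp (T \<bullet> \<eta> w)" for w
        have f: "f \<in> borel_measurable Finf" unfolding f_def using g(1) i_meas by measurable
        have fk: "cmod (f w) \<le> k" for w using g(2) by (simp add: f_def norm_mult)
        have split: "iexp (t \<bullet> (h', v)) = iexp (\<tau> \<bullet> v) * iexp (T \<bullet> h')" for h' v
          by (simp add: t distrib_left exp_add mult.commute)
        have "(CLINT w|?QA. f w) * \<psi> \<tau> = (CLINT w|?QA. f w * iexp (\<tau> \<bullet> Z w))"
          using indep_integral_uniform_measure[OF A _ Zi f fk, of "\<lambda>z. iexp (\<tau> \<bullet> z)" 1] by (simp add: Zc)
        with V_char[OF f fk, of \<tau>]
        have lim: "(\<lambda>n. CLINT w|?QA. f w * iexp (\<tau> \<bullet> V n w)) \<longlonglongrightarrow> (CLINT w|?QA. f w * iexp (\<tau> \<bullet> Z w))"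
          by simp
        \<comment> \<open>The weight is now \<open>g w * iexp (\<tau> \<bullet> V n w)\<close>: it
          varies with \<open>n\<close> but stays bounded by \<open>k\<close>, so \<open>H n\<close>
          can be exchanged for \<eta> at a vanishing cost.\<close>
        let ?d = "\<lambda>n. (CLINT w|?QA. g w * iexp (\<tau> \<bullet> V n w) * iexp (T \<bullet> H n w))
            - (CLINT w|?QA. g w * iexp (\<tau> \<bullet> V n w) * iexp (T \<bullet> \<eta> w))"
        have "?d \<longlonglongrightarrow> 0"
        proof (rule Lim_null_comparison)
          show "\<forall>\<^sub>F n in sequentially. norm (?d n) \<le> k * (2 + norm T) * (\<integral>w. min 1 (norm (H n w - \<eta> w)) \<partial>?QA)"
            by (intro always_eventually allI QA.iexp_perturbation) (use g(2) in \<open>auto simp: norm_mult\<close>)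
          show "(\<lambda>n. k * (2 + norm T) * (\<integral>w. min 1 (norm (H n w - \<eta> w)) \<partial>?QA)) \<longlonglongrightarrow> 0"
            using tendsto_mult_left[OF H_negl[unfolded negligible_seq_def], of "k * (2 + norm T)"] by simp
        qed
        from tendsto_add[OF this lim] show ?thesis
          by (simp add: split f_def mult_ac)
      qed
      then show ?thesis
        by (intro QA.integral_tendsto_of_characteristic[OF _ _ _ g(2) _ QA.tight_seq_Pair[OF H_tight V_tight] h]) simp_all
    qed
    have sub: "subalgebra ?QA Finf"
      using subalg_Finf by (simp add: subalgebra_def)
    have "stably_converges ?QA Finf V Z"
    proof (rule QA.stably_convergesI[OF sub])
      fix g :: "'a \<Rightarrow> real" and k and h :: "real^'n \<Rightarrow> real"
      assume g: "g \<in> borel_measurable Finf" "\<And>w. \<bar>g w\<bar> \<le> k" and h: "continuous_on UNIV h" "bounded (range h)"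
      have "continuous_on UNIV (\<lambda>p :: (real^'n^'n) \<times> (real^'n). h (snd p))"
        by (rule continuous_on_compose2[OF h(1)]) (auto intro!: continuous_intros)
      moreover have "bounded (range (\<lambda>p :: (real^'n^'n) \<times> (real^'n). h (snd p)))"
        by (rule bounded_subset[OF h(2)]) auto
      ultimately show "(\<lambda>n. \<integral>w. g w * h (V n w) \<partial>?QA) \<longlonglongrightarrow> (\<integral>w. g w * h (Z w) \<partial>?QA)"
        using joint[OF g] by fastforce
    qed simp_all
    moreover have "indep_of ?QA borel Z Finf"
      by (rule indep_of_uniform_measure[OF A _ Zi]) simp
    moreover have "stably_converges ?QA Finf (\<lambda>n w. Q n *v U n w) (\<lambda>w. \<eta> w *v Z w)"
    proof (rule QA.stably_convergesI[OF sub])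
      fix g :: "'a \<Rightarrow> real" and k and h :: "real^'n \<Rightarrow> real"
      assume g: "g \<in> borel_measurable Finf" "\<And>w. \<bar>g w\<bar> \<le> k" and h: "continuous_on UNIV h" "bounded (range h)"
      have gM[measurable]: "g \<in> borel_measurable M" using g(1) by (rule measurable_Finf_M)
      have [measurable]: "h \<in> borel_measurable borel" using h(1) by (rule borel_measurable_continuous_onI)
      have "continuous_on UNIV (\<lambda>p :: (real^'n^'n) \<times> (real^'n). h (fst p *v snd p))"
        by (rule continuous_on_compose2[OF h(1)]) (auto intro!: continuous_intros)
      moreover have "bounded (range (\<lambda>p :: (real^'n^'n) \<times> (real^'n). h (fst p *v snd p)))"
        by (rule bounded_subset[OF h(2)]) auto
      ultimately have lim: "(\<lambda>n. \<integral>w. g w * h (H n w *v V n w) \<partial>?QA) \<longlonglongrightarrow> (\<integral>w. g w * h (\<eta> w *v Z w) \<partial>?QA)"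
        using joint[OF g] by fastforce
      have "\<forall>\<^sub>F n in sequentially. (\<integral>w. g w * h (H n w *v V n w) \<partial>?QA) = (\<integral>w. g w * h (Q n *v U n w) \<partial>?QA)"
        using HV
      proof eventually_elim
        case (elim n)
        show ?case
        proof (rule integral_cong_AE)
          show "AE w in ?QA. g w * h (H n w *v V n w) = g w * h (Q n *v U n w)"
            using elim by eventually_elim simp
        qed measurable
      qed
      with lim show "(\<lambda>n. \<integral>w. g w * h (Q n *v U n w) \<partial>?QA) \<longlonglongrightarrow> (\<integral>w. g w * h (\<eta> w *v Z w) \<partial>?QA)"
        by (rule Lim_transform_eventually)
    qed simp_all
    ultimately show ?thesis by (simp add: mixing_converges_def)
  qed

  \<comment> \<open>The product limit is evaluated a second time, with the Cauchy characteristic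
    function, and limits are unique; the spectral measure of the Cauchy law need not be
    identified.\<close>
  have cauchy: "\<psi> \<theta> = complex_of_real (exp (- (\<Sum>j. norm (transpose (matpow P j) *v \<theta>))))"
    if "distr M borel \<zeta> = cauchy_law" for \<theta>
  proof -
    have "\<mu> = cauchy_law" using that mu by simp
    then have char: "char_vec \<mu> \<theta>' = complex_of_real (exp (- norm \<theta>'))" for \<theta>'
      using char_vec_cauchy_law \<mu> by simp
    have "(\<Prod>j<r. char_vec \<mu> (transpose (matpow P j) *v \<theta>))
        = complex_of_real (exp (- (\<Sum>j<r. norm (transpose (matpow P j) *v \<theta>))))" for r
      by (simp add: char exp_sum sum_negf[symmetric])
    moreover have "(\<lambda>r. complex_of_real (exp (- (\<Sum>j<r. norm (transpose (matpow P j) *v \<theta>)))))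
        \<longlonglongrightarrow> complex_of_real (exp (- (\<Sum>j. norm (transpose (matpow P j) *v \<theta>))))"
      by (intro tendsto_intros summable_LIMSEQ summable_norm_matpow_transpose iii_radius)
    ultimately show ?thesis
      using prod_lim[of \<theta>] LIMSEQ_unique by fastforce
  qed

  \<comment> \<open>The limit statements hold for every such \<open>Z\<close>; the richness of the
    space guarantees that there is one.\<close>
  have "\<exists>Z. indep_vector_with_char M Finf \<psi> Z"
    unfolding \<psi>_def using alpha
    by (intro ex_indep_vector_with_limit_char[OF prob \<mu> zeta_spectral _ _ iii_radius rich]) auto
  then show ?thesis
    using main cauchy
    unfolding A_def V_def[abs_def] \<psi>_def[symmetric] by (auto simp: indep_vector_with_char_def)
qed

end
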